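(* Let $n\ge 1$, let $\sigma\subseteq\{1,\dots,n\}$, and let $T=T(n,\sigma)$ be the corresponding threshold graph on $n+1$ vertices, with associated anti-lecture hall composition $\lambda(T)=(\lambda_1(T),\dots,\lambda_n(T))$. Then for every $1\le k\le n$, $$\lambda_k(T)=\left|E^\lambda_k(\overline{T})\right|,\qquad\text{where } E^\lambda_k(\overline{T})=\{uv\notin E(T)\mid \ell_\lambda(uv)=k\}.$$
   Context: For $n\ge 1$ and $\sigma\subseteq\{1,\dots,n\}$, $T(n,\sigma)$ is the graph with vertex set $\{0,1,\dots,n\}$ in which, for $0\le u<v\le n$, the pair $uv$ is an edge if and only if $v\notin\sigma$. (Every threshold graph on $n+1$ vertices is isomorphic to exactly one $T(n,\sigma)$, and threshold graphs are always labeled in this way; elements of $\sigma$ are called isolated vertices, elements of $\{1,\dots,n\}\setminus\sigma$ dominating vertices.) $\overline{T}$ denotes the complement graph of $T$; its edges are the non-edges $uv$ ($u\ne v$) of $T$. For a vertex $v$ of $T=T(n,\sigma)$, let $i_T(v)=|\{w\in\sigma\mid w>v\}|$. The $\lambda$-labeling of the non-edges of $T$ is $\ell_\lambda(uv)=u+1+i_T(v)$ for each non-edge $uv$ of $T$ with $u<v$. Betti sequence: let $\Bbbk$ be a field, $R=\Bbbk[x_0,\dots,x_n]$, $I_c(T)=\langle x_ux_v\mid u\neq v,\ uv\notin E(T)\rangle$ and $\Bbbk[T]=R/I_c(T)$. The ideal $I_c(T)$ is $2$-linear, i.e. the graded Betti numbers $\beta_{i,j}(\Bbbk[T])$ vanish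 unless $j=i+1$ or $(i,j)=(0,0)$. The Betti sequence of $T$ is $\beta(T)=(\beta_1(T),\dots,\beta_n(T))$ with $\beta_i(T)=\beta_{i,i+1}(\Bbbk[T])$. The anti-lecture hall composition associated to $T$ is $\lambda(T)=(\lambda_1(T),\dots,\lambda_n(T))$ with $$\lambda_i(T)=\sum_{k=i}^n(-1)^{i+k}\binom{k-1}{i-1}\beta_k(T).$$ It is known that $T\mapsto\lambda(T)$ is a bijection from threshold graphs on $n+1$ vertices (up to isomorphism) to anti-lecture hall compositions of length $n$ bounded above by $1$, i.e. integer sequences $(\lambda_1,\dots,\lambda_n)$ with $1\ge\lambda_1/1\ge\lambda_2/2\ge\cdots\ge\lambda_n/n\ge 0$. *)

theory Defs
  imports "HOL-Library.Poly_Mapping" "HOL-Algebra.QuotRing" "Jordan_Normal_Form.Matrix"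
begin

section \<open>Threshold graphs and the \<open>\<lambda>\<close>-labeling\<close>

text \<open>A finite simple graph is a pair of a vertex set and a set of two-element edges.\<close>

type_synonym graph = "nat set \<times> nat set set"

abbreviation verts :: "graph \<Rightarrow> nat set" where "verts \<equiv> fst"
abbreviation edges :: "graph \<Rightarrow> nat set set" where "edges \<equiv> snd"

definition complement_graph :: "graph \<Rightarrow> graph" where
  "complement_graph T =
     (verts T, {{u, v} | u v. u \<in> verts T \<and> v \<in> verts T \<and> u \<noteq> v \<and> {u, v} \<notin> edges T})"

definition threshold_graph :: "nat \<Rightarrow> nat set \<Rightarrow> graph" where
  "threshold_graph n \<sigma> = ({0..n}, {{u, v} | u v. u < v \<and> v \<le> n \<and> v \<notin> \<sigma>})"

definition isolated_above :: "nat set \<Rightarrow> nat \<Rightarrow> nat" where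
  "isolated_above \<sigma> v = card {w \<in> \<sigma>. v < w}"

text \<open>The label of the non-edge \<open>uv\<close>, where \<open>u < v\<close>.\<close>

definition lambda_label :: "nat set \<Rightarrow> nat \<Rightarrow> nat \<Rightarrow> nat" where
  "lambda_label \<sigma> u v = u + 1 + isolated_above \<sigma> v"

definition lambda_edges :: "nat \<Rightarrow> nat set \<Rightarrow> nat \<Rightarrow> nat set set" where
  "lambda_edges n \<sigma> k =
     {{u, v} | u v. u < v \<and> {u, v} \<in> edges (complement_graph (threshold_graph n \<sigma>))
                    \<and> lambda_label \<sigma> u v = k}"

section \<open>Polynomial rings with the standard grading\<close>

text \<open>Exponent vectors are finitely supported maps \<open>nat \<Rightarrow>\<^sub>0 nat\<close>; a polynomial maps finitely many
  exponent vectors to their coefficients, and multiplication is convolution.\<close>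

type_synonym 'k mpoly = "(nat \<Rightarrow>\<^sub>0 nat) \<Rightarrow>\<^sub>0 'k"

definition var :: "nat \<Rightarrow> 'k::comm_ring_1 mpoly" where
  "var v = Poly_Mapping.single (Poly_Mapping.single v 1) 1"

definition mono_deg :: "(nat \<Rightarrow>\<^sub>0 nat) \<Rightarrow> nat" where
  "mono_deg m = (\<Sum>v\<in>Poly_Mapping.keys m. Poly_Mapping.lookup m v)"

definition homogeneous :: "nat \<Rightarrow> 'k::comm_ring_1 mpoly \<Rightarrow> bool" where
  "homogeneous d p \<longleftrightarrow> (\<forall>m\<in>Poly_Mapping.keys p. mono_deg m = d)"

definition poly_ring :: "nat set \<Rightarrow> 'k::comm_ring_1 mpoly ring" where
  "poly_ring V = \<lparr>carrier = {p. \<forall>m\<in>Poly_Mapping.keys p. Poly_Mapping.keys m \<subseteq> V},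
     monoid.mult = (*), one = 1, zero = 0, add = (+)\<rparr>"

definition irrelevant_ideal :: "nat set \<Rightarrow> 'k::comm_ring_1 mpoly set" where
  "irrelevant_ideal V = genideal (poly_ring V) (var ` V)"

section \<open>Minimal graded free resolutions and graded Betti numbers\<close>

text \<open>Let \<open>R = poly_ring V\<close>. A graded free \<open>R\<close>-module \<open>\<Oplus>\<^sub>b R(-\<delta>\<^sub>b)\<close> of finite rank is given by the
  list \<open>\<delta>\<close> of the degrees of its basis elements; its elements are the column vectors below.\<close>

definition free_elems :: "nat set \<Rightarrow> nat list \<Rightarrow> 'k::comm_ring_1 mpoly vec set" where
  "free_elems V \<delta> = {f \<in> carrier_vec (length \<delta>). \<forall>b < length \<delta>. f $ b \<in> carrier (poly_ring V)}"

text \<open>Matrices of the degree-preserving \<open>R\<close>-linear maps from the free module with degrees \<open>\<delta>'\<close>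
  to the one with degrees \<open>\<delta>\<close>: the entry in position \<open>(a, b)\<close> is homogeneous of degree
  \<open>\<delta>'\<^sub>b - \<delta>\<^sub>a\<close>, hence zero if this number is negative.\<close>

definition graded_mats :: "nat set \<Rightarrow> nat list \<Rightarrow> nat list \<Rightarrow> 'k::comm_ring_1 mpoly mat set" where
  "graded_mats V \<delta> \<delta>' =
     {A \<in> carrier_mat (length \<delta>) (length \<delta>').
        \<forall>a < length \<delta>. \<forall>b < length \<delta>'.
          A $$ (a, b) \<in> carrier (poly_ring V) \<and>
          (\<forall>m \<in> Poly_Mapping.keys (A $$ (a, b)). mono_deg m + \<delta> ! a = \<delta>' ! b)}"

text \<open>The \<open>R\<close>-linear map to \<open>M\<close> that sends the \<open>b\<close>-th basis element to \<open>g ! b\<close>.\<close>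

definition augmentation ::
  "('k::comm_ring_1 mpoly, 'm) module \<Rightarrow> 'm list \<Rightarrow> 'k mpoly vec \<Rightarrow> 'm" where
  "augmentation M g f = finsum M (\<lambda>b. (f $ b) \<odot>\<^bsub>M\<^esub> (g ! b)) {..<length g}"

text \<open>Let \<open>M\<close> be a graded \<open>R\<close>-module with homogeneous components \<open>G j\<close>. The exact complex
  \<open>\<dots> \<rightarrow> F\<^sub>2 \<rightarrow> F\<^sub>1 \<rightarrow> F\<^sub>0 \<rightarrow> M \<rightarrow> 0\<close> has \<open>F\<^sub>i\<close> with basis degrees \<open>\<delta> i\<close>, the map \<open>F\<^bsub>i+1\<^esub> \<rightarrow> F\<^sub>i\<close> with matrix
  \<open>D i\<close>, and the map \<open>F\<^sub>0 \<rightarrow> M\<close> given by the list \<open>g\<close>. It is minimal if the image of \<open>F\<^bsub>i+1\<^esub>\<close> lies in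
  \<open>\<mm> F\<^sub>i\<close> with \<open>\<mm>\<close> the irrelevant ideal, i.e. if all matrix entries lie in \<open>\<mm>\<close>.\<close>

definition minimal_graded_free_resolution ::
  "nat set \<Rightarrow> ('k::comm_ring_1 mpoly, 'm) module \<Rightarrow> (nat \<Rightarrow> 'm set) \<Rightarrow>
   (nat \<Rightarrow> nat list) \<Rightarrow> 'm list \<Rightarrow> (nat \<Rightarrow> 'k mpoly mat) \<Rightarrow> bool" where
  "minimal_graded_free_resolution V M G \<delta> g D \<longleftrightarrow>
     length g = length (\<delta> 0) \<and>
     (\<forall>b < length g. g ! b \<in> G (\<delta> 0 ! b)) \<and>
     (\<forall>i. D i \<in> graded_mats V (\<delta> i) (\<delta> (Suc i))) \<and>
     augmentation M g ` free_elems V (\<delta> 0) = carrier M \<and>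
     {f \<in> free_elems V (\<delta> 0). augmentation M g f = \<zero>\<^bsub>M\<^esub>}
       = (\<lambda>f. D 0 *\<^sub>v f) ` free_elems V (\<delta> 1) \<and>
     (\<forall>i. {f \<in> free_elems V (\<delta> (Suc i)). D i *\<^sub>v f = 0\<^sub>v (length (\<delta> i))}
            = (\<lambda>f. D (Suc i) *\<^sub>v f) ` free_elems V (\<delta> (Suc (Suc i)))) \<and>
     (\<forall>i. \<forall>a < length (\<delta> i). \<forall>b < length (\<delta> (Suc i)). D i $$ (a, b) \<in> irrelevant_ideal V)"

text \<open>\<open>\<beta>\<^sub>i\<^sub>,\<^sub>j(M)\<close> is the number of basis elements of degree \<open>j\<close> in the \<open>i\<close>-th module of a minimal
  graded free resolution of \<open>M\<close>; it does not depend on the resolution.\<close>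

definition graded_betti ::
  "nat set \<Rightarrow> ('k::field mpoly, 'm) module \<Rightarrow> (nat \<Rightarrow> 'm set) \<Rightarrow> nat \<Rightarrow> nat \<Rightarrow> nat" where
  "graded_betti V M G i j =
     (THE b. \<exists>\<delta> g D. minimal_graded_free_resolution V M G \<delta> g D \<and> b = count_list (\<delta> i) j)"

section \<open>The Betti sequence and the anti-lecture hall composition of a graph\<close>

text \<open>Module records extend ring records, so \<open>mult\<close> and \<open>one\<close> must be supplied as well; only \<open>zero\<close>,
  \<open>add\<close> and \<open>smult\<close> matter for the module structure.\<close>

definition quotient_module :: "'a ring \<Rightarrow> 'a set \<Rightarrow> ('a, 'a set) module" where
  "quotient_module R I =
     \<lparr>carrier = carrier (R Quot I), monoid.mult = monoid.mult (R Quot I), one = one (R Quot I),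
      zero = zero (R Quot I), add = add (R Quot I),
      smult = (\<lambda>r C. (I +>\<^bsub>R\<^esub> r) \<otimes>\<^bsub>R Quot I\<^esub> C)\<rparr>"

definition quotient_component ::
  "nat set \<Rightarrow> 'k::comm_ring_1 mpoly set \<Rightarrow> nat \<Rightarrow> 'k mpoly set set" where
  "quotient_component V I j =
     {I +>\<^bsub>poly_ring V\<^esub> p | p. p \<in> carrier (poly_ring V) \<and> homogeneous j p}"

definition nonedge_ideal :: "graph \<Rightarrow> 'k::comm_ring_1 mpoly set" where
  "nonedge_ideal T = genideal (poly_ring (verts T))
     {var u * var v | u v. u \<in> verts T \<and> v \<in> verts T \<and> u \<noteq> v \<and> {u, v} \<notin> edges T}"

text \<open>The coefficient field is the type argument.\<close>

definition betti_seq :: "'k::field itself \<Rightarrow> graph \<Rightarrow> nat \<Rightarrow> nat" where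
  "betti_seq _ T i =
     (let V = verts T; I = (nonedge_ideal T :: 'k mpoly set)
      in graded_betti V (quotient_module (poly_ring V) I) (quotient_component V I) i (i + 1))"

definition anti_lecture_hall :: "'k::field itself \<Rightarrow> nat \<Rightarrow> graph \<Rightarrow> nat \<Rightarrow> int" where
  "anti_lecture_hall K n T i =
     (\<Sum>k = i..n. (- 1) ^ (i + k) * int ((k - 1) choose (i - 1)) * int (betti_seq K T k))"

end

theory Submission
  imports Defs "HOL-Library.Product_Lexorder" "Jordan_Normal_Form.Determinant"
begin

text \<open>The monomials \<open>x\<^sub>u x\<^sub>v\<close> with \<open>u < v\<close> and \<open>v \<in> \<sigma>\<close> generate the ideal. It is minimally resolved by the
  cellular complex whose cells are the products of simplices on pairs of non-empty sets \<open>A\<close> and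
  \<open>B \<subseteq> \<sigma>\<close> with \<open>max A < min B\<close>. In each multidegree this complex is contracted in two steps, first
  towards the smallest available vertex of \<open>A\<close> and then towards a vertex of \<open>B\<close>. Betti numbers are read
  off from any minimal resolution, because comparison maps between two of them are mutually inverse
  up to homotopy, hence inverse modulo the irrelevant ideal.

  A cell with \<open>|A| + |B| = i + 1\<close> consists of the non-edge \<open>u v\<close> with \<open>u = max A\<close> and \<open>v = min B\<close>,
  together with \<open>i - 1\<close> of the \<open>\<ell> - 1\<close> vertices below \<open>u\<close> or in \<open>\<sigma>\<close> above \<open>v\<close>, where \<open>\<ell>\<close> is the label
  of \<open>u v\<close>. So \<open>\<beta>\<^sub>i\<close> is the sum of \<open>\<ell> - 1 choose i - 1\<close> over the non-edges, and binomial inversion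
  gives the number of non-edges with label \<open>k\<close>.\<close>

text \<open>\<open>graded_betti\<close> is a definite description over all minimal resolutions, so a
  resolution has to be exhibited and any two have to be shown to agree degree by degree. The
  condition max A < min B comes from the generators: a pair is a generator exactly if its larger
  vertex lies in \<sigma>, so every element of A pairs with every element of B, and the points of
  the product of simplices are generators. It also makes A and B disjoint. The monomial of a cell is
  then squarefree of degree |A| + |B|, and passing to a facet divides it by one variable; this makes
  the resolution linear and minimal. An element of \<sigma> can occur in either factor, which is why
  vertices are tagged. Exactness reduces to scalars: the coefficients that contribute to a
  multidegree form the chain complex of the cells inside its support. This complex is not simply a
  cone, because no factor of a cell may become empty. That obstacle forces the second contraction
  and leaves a single point, which the augmentation removes.\<close>

subsection \<open>Monomials\<close>

lemma poly_mapping_sum_single: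
  "p = (\<Sum>m\<in>Poly_Mapping.keys p. Poly_Mapping.single m (Poly_Mapping.lookup p m))"
  by (rule poly_mapping_eqI)
    (simp add: lookup_sum lookup_single when_def in_keys_iff)

lemma lookup_monomial_mult:
  fixes q :: "(nat \<Rightarrow>\<^sub>0 nat) \<Rightarrow>\<^sub>0 'k::comm_ring_1"
  shows "Poly_Mapping.lookup (Poly_Mapping.single m c * q) (m + k) = c * Poly_Mapping.lookup q k"
proof -
  have "Poly_Mapping.single m c * q = (\<Sum>l\<in>Poly_Mapping.keys q. Poly_Mapping.single (m + l) (c * Poly_Mapping.lookup q l))"
    by (subst poly_mapping_sum_single[of q]) (simp add: sum_distrib_left mult_single)
  then show ?thesis
    by (simp add: lookup_sum lookup_single when_def in_keys_iff sum.delta)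
qed

lemma keys_monomial_mult:
  fixes q :: "(nat \<Rightarrow>\<^sub>0 nat) \<Rightarrow>\<^sub>0 'k::comm_ring_1"
  assumes "k \<in> Poly_Mapping.keys (Poly_Mapping.single m c * q)"
  obtains l where "k = m + l" "l \<in> Poly_Mapping.keys q"
  using assms keys_mult[of "Poly_Mapping.single m c" q] by (auto split: if_splits)

lemma keys_plus_nat:
  "Poly_Mapping.keys (m + l) = Poly_Mapping.keys m \<union> Poly_Mapping.keys (l :: nat \<Rightarrow>\<^sub>0 nat)"
  by (auto simp: in_keys_iff lookup_add)

lemma mono_deg_superset:
  "finite A \<Longrightarrow> Poly_Mapping.keys m \<subseteq> A \<Longrightarrow> mono_deg m = (\<Sum>v\<in>A. Poly_Mapping.lookup m v)"
  unfolding mono_deg_def by (rule sum.mono_neutral_left) (auto simp: in_keys_iff)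

lemma mono_deg_add: "mono_deg (m + l) = mono_deg m + mono_deg l"
proof -
  let ?A = "Poly_Mapping.keys m \<union> Poly_Mapping.keys l"
  show ?thesis
    using mono_deg_superset[of ?A m] mono_deg_superset[of ?A l] mono_deg_superset[of ?A "m + l"]
    by (simp add: keys_plus_nat lookup_add sum.distrib)
qed

lemma mono_deg_0 [simp]: "mono_deg 0 = 0"
  by (simp add: mono_deg_def)

lemma mono_deg_single [simp]: "mono_deg (Poly_Mapping.single v a) = a"
  by (simp add: mono_deg_def)

lemma mono_deg_eq_0_iff: "mono_deg m = 0 \<longleftrightarrow> m = 0"
proof
  assume "mono_deg m = 0"
  then have "Poly_Mapping.lookup m v = 0" for v
    by (cases "v \<in> Poly_Mapping.keys m") (auto simp: mono_deg_def in_keys_iff)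
  then show "m = 0" by (intro poly_mapping_eqI) simp
qed simp

lemma zero_sum_nat_poly_mapping: "m + l = 0 \<longleftrightarrow> m = 0 \<and> l = (0 :: nat \<Rightarrow>\<^sub>0 nat)"
  by (metis add_eq_0_iff_both_eq_0 mono_deg_add mono_deg_eq_0_iff)

subsection \<open>Polynomial rings\<close>

abbreviation polys :: "nat set \<Rightarrow> 'k::comm_ring_1 mpoly set" where
  "polys V \<equiv> carrier (poly_ring V)"

lemma in_polys_iff: "p \<in> polys V \<longleftrightarrow> (\<forall>m\<in>Poly_Mapping.keys p. Poly_Mapping.keys m \<subseteq> V)"
  by (simp add: poly_ring_def)

lemma poly_ring_simps [simp]:
  "x \<otimes>\<^bsub>poly_ring V\<^esub> y = x * y" "x \<oplus>\<^bsub>poly_ring V\<^esub> y = x + y"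
  "\<one>\<^bsub>poly_ring V\<^esub> = 1" "\<zero>\<^bsub>poly_ring V\<^esub> = 0"
  by (simp_all add: poly_ring_def)

lemma polys_0 [simp]: "0 \<in> polys V" and polys_1 [simp]: "1 \<in> polys V"
  by (auto simp: in_polys_iff)

lemma polys_add [intro]: "p \<in> polys V \<Longrightarrow> q \<in> polys V \<Longrightarrow> p + q \<in> polys V"
  using keys_add[of p q] by (auto simp: in_polys_iff)

lemma polys_uminus [intro]: "p \<in> polys V \<Longrightarrow> - p \<in> polys V"
  by (auto simp: in_polys_iff in_keys_iff)

lemma polys_diff [intro]: "p \<in> polys V \<Longrightarrow> q \<in> polys V \<Longrightarrow> p - q \<in> polys V"
  using polys_add[of p V "- q"] polys_uminus[of q V] by simp

lemma polys_mult [intro]: "p \<in> polys V \<Longrightarrow> q \<in> polys V \<Longrightarrow> p * q \<in> polys V"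
  using keys_mult[of p q] by (fastforce simp: in_polys_iff keys_plus_nat)

lemma polys_sum [intro]: "(\<And>x. x \<in> A \<Longrightarrow> f x \<in> polys V) \<Longrightarrow> sum f A \<in> polys V"
  by (induction A rule: infinite_finite_induct) auto

lemma polys_single [intro]: "Poly_Mapping.keys m \<subseteq> V \<Longrightarrow> Poly_Mapping.single m c \<in> polys V"
  by (simp add: in_polys_iff)

lemma polys_var [intro]: "v \<in> V \<Longrightarrow> var v \<in> polys V"
  by (simp add: var_def polys_single)

lemma cring_poly_ring: "cring (poly_ring V :: 'k::comm_ring_1 mpoly ring)"
proof (rule cringI)
  show "abelian_group (poly_ring V :: 'k mpoly ring)"
  proof (rule abelian_groupI)
    fix x :: "'k mpoly" assume "x \<in> polys V"
    then show "\<exists>y\<in>polys V. y \<oplus>\<^bsub>poly_ring V\<^esub> x = \<zero>\<^bsub>poly_ring V\<^esub>"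
      by (intro bexI[of _ "- x"]) auto
  qed (auto simp: add.assoc add.commute)
  show "comm_monoid (poly_ring V :: 'k mpoly ring)"
    by (rule comm_monoidI) (auto simp: mult.assoc mult.commute)
qed (auto simp: distrib_right)

lemma ring_poly_ring: "ring (poly_ring V :: 'k::comm_ring_1 mpoly ring)"
  using cring_poly_ring by (rule cring.axioms)

lemma poly_ring_a_inv:
  fixes p :: "'k::comm_ring_1 mpoly"
  assumes "p \<in> polys V"
  shows "\<ominus>\<^bsub>poly_ring V\<^esub> p = - p"
proof -
  interpret ring "poly_ring V :: 'k mpoly ring" by (rule ring_poly_ring)
  show ?thesis using assms by (intro minus_equality) auto
qed

lemma idealI_polys:
  fixes I :: "'k::comm_ring_1 mpoly set"
  assumes "I \<subseteq> polys V" "0 \<in> I" "\<And>p q. p \<in> I \<Longrightarrow> q \<in> I \<Longrightarrow> p + q \<in> I"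
    "\<And>p q. p \<in> I \<Longrightarrow> q \<in> polys V \<Longrightarrow> q * p \<in> I"
  shows "ideal I (poly_ring V)"
proof (rule idealI)
  interpret ring "poly_ring V :: 'k mpoly ring" by (rule ring_poly_ring)
  have "inv\<^bsub>add_monoid (poly_ring V)\<^esub> p \<in> I" if "p \<in> I" for p
    using subsetD[OF assms(1) that] assms(4)[OF that, of "- 1"] polys_uminus[OF polys_1, of V]
    unfolding a_inv_def[symmetric] by (simp add: poly_ring_a_inv)
  then show "subgroup I (add_monoid (poly_ring V :: 'k mpoly ring))"
    using assms(1-3)
    by (intro group.subgroupI[OF a_group]) auto
qed (use assms in \<open>auto simp: ring_poly_ring mult.commute\<close>)

lemma ideal_polys:
  fixes I :: "'k::comm_ring_1 mpoly set"
  assumes "ideal I (poly_ring V)"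
  shows "p \<in> I \<Longrightarrow> p \<in> polys V" "0 \<in> I" "p \<in> I \<Longrightarrow> q \<in> I \<Longrightarrow> p + q \<in> I"
    "p \<in> I \<Longrightarrow> q \<in> polys V \<Longrightarrow> q * p \<in> I" "p \<in> I \<Longrightarrow> - p \<in> I"
    "p \<in> I \<Longrightarrow> q \<in> I \<Longrightarrow> p - q \<in> I"
    "(\<And>x. x \<in> A \<Longrightarrow> f x \<in> I) \<Longrightarrow> sum f A \<in> I"
proof -
  interpret ideal I "poly_ring V" by fact
  show car: "p \<in> I \<Longrightarrow> p \<in> polys V" for p using a_subset by blast
  show zero: "0 \<in> I" using additive_subgroup.zero_closed[OF is_additive_subgroup] by simp
  show add: "p \<in> I \<Longrightarrow> q \<in> I \<Longrightarrow> p + q \<in> I" for p q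
    using additive_subgroup.a_closed[OF is_additive_subgroup, of p q] by simp
  show mult: "p \<in> I \<Longrightarrow> q \<in> polys V \<Longrightarrow> q * p \<in> I" for p q using I_l_closed[of p q] by simp
  show neg: "p \<in> I \<Longrightarrow> - p \<in> I" for p
    using mult[of p "- 1"] polys_uminus[OF polys_1, of V] by simp
  show "p \<in> I \<Longrightarrow> q \<in> I \<Longrightarrow> p - q \<in> I" using add[of p "- q"] neg[of q] by simp
  show "(\<And>x. x \<in> A \<Longrightarrow> f x \<in> I) \<Longrightarrow> sum f A \<in> I"
    by (induction A rule: infinite_finite_induct) (auto intro: zero add)
qed

subsection \<open>Constant terms\<close>

abbreviation const_term :: "'k::comm_ring_1 mpoly \<Rightarrow> 'k" where
  "const_term p \<equiv> Poly_Mapping.lookup p 0"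

text \<open>Exponents are natural numbers, so \<open>m + l = 0\<close> forces both to vanish.
  Constant terms of matrix entries thus realise reduction modulo the irrelevant ideal.\<close>

lemma const_term_mult: "const_term (p * q) = const_term p * const_term q"
proof -
  have "p * q = (\<Sum>m\<in>Poly_Mapping.keys p. \<Sum>l\<in>Poly_Mapping.keys q.
      Poly_Mapping.single (m + l) (Poly_Mapping.lookup p m * Poly_Mapping.lookup q l))"
    by (subst poly_mapping_sum_single[of p], subst poly_mapping_sum_single[of q])
      (simp add: sum_product mult_single)
  then have "const_term (p * q) = (\<Sum>m\<in>Poly_Mapping.keys p. \<Sum>l\<in>Poly_Mapping.keys q.
      if m = 0 \<and> l = 0 then Poly_Mapping.lookup p m * Poly_Mapping.lookup q l else 0)"
    by (simp add: lookup_sum lookup_single when_def zero_sum_nat_poly_mapping)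
  also have "\<dots> = (\<Sum>m\<in>Poly_Mapping.keys p. if m = 0 then const_term p * const_term q else 0)"
    by (rule sum.cong) (auto simp: in_keys_iff sum.delta)
  also have "\<dots> = const_term p * const_term q"
    by (auto simp: in_keys_iff)
  finally show ?thesis .
qed

lemma irrelevant_ideal_ideal: "ideal (irrelevant_ideal V) (poly_ring V :: 'k::comm_ring_1 mpoly ring)"
  unfolding irrelevant_ideal_def
  by (rule ring.genideal_ideal[OF ring_poly_ring]) auto

lemma var_in_irrelevant_ideal: "v \<in> V \<Longrightarrow> var v \<in> irrelevant_ideal V"
  unfolding irrelevant_ideal_def by (rule subsetD[OF ring.genideal_self[OF ring_poly_ring]]) auto

text \<open>The polynomials without constant term form an ideal that contains the variables. The
  comparison of resolutions uses minimality in this form.\<close>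

lemma const_term_irrelevant_ideal:
  fixes p :: "'k::comm_ring_1 mpoly"
  assumes "p \<in> irrelevant_ideal V"
  shows "const_term p = 0"
proof -
  have "ideal {p \<in> polys V. const_term p = (0 :: 'k)} (poly_ring V)"
    by (rule idealI_polys) (auto simp: lookup_add const_term_mult)
  moreover have "const_term (var v :: 'k mpoly) = 0" for v
    unfolding var_def lookup_single by (metis mono_deg_0 mono_deg_single when_def zero_neq_one)
  ultimately have "irrelevant_ideal V \<subseteq> {p \<in> polys V. const_term p = (0 :: 'k)}"
    unfolding irrelevant_ideal_def by (intro ring.genideal_minimal[OF ring_poly_ring]) auto
  then show ?thesis using assms by auto
qed

subsection \<open>Homogeneous components\<close>

text \<open>Selecting by a predicate rather than by a degree lets the condition depend on the
  coordinate in a free module, where it is shifted by the degree of the basis element.\<close>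

definition poly_filter :: "((nat \<Rightarrow>\<^sub>0 nat) \<Rightarrow> bool) \<Rightarrow> 'k::comm_ring_1 mpoly \<Rightarrow> 'k mpoly" where
  "poly_filter P p = (\<Sum>m | m \<in> Poly_Mapping.keys p \<and> P m. Poly_Mapping.single m (Poly_Mapping.lookup p m))"

lemma lookup_poly_filter:
  "Poly_Mapping.lookup (poly_filter P p) m = (if P m then Poly_Mapping.lookup p m else 0)"
  by (auto simp: poly_filter_def lookup_sum lookup_single when_def in_keys_iff sum.delta)

lemma keys_poly_filter: "Poly_Mapping.keys (poly_filter P p) = {m \<in> Poly_Mapping.keys p. P m}"
  by (auto simp: in_keys_iff lookup_poly_filter split: if_splits)

lemma poly_filter_add: "poly_filter P (p + q) = poly_filter P p + poly_filter P q"
  and poly_filter_diff: "poly_filter P (p - q) = poly_filter P p - poly_filter P q"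
  and poly_filter_0 [simp]: "poly_filter P 0 = 0"
  by (rule poly_mapping_eqI; simp add: lookup_poly_filter lookup_add lookup_minus)+

lemma poly_filter_sum: "poly_filter P (sum f A) = (\<Sum>x\<in>A. poly_filter P (f x))"
  by (induction A rule: infinite_finite_induct) (simp_all add: poly_filter_add)

lemma poly_filter_id: "(\<And>m. m \<in> Poly_Mapping.keys p \<Longrightarrow> P m) \<Longrightarrow> poly_filter P p = p"
  by (rule poly_mapping_eqI) (auto simp: lookup_poly_filter in_keys_iff)

lemma polys_poly_filter [intro]: "p \<in> polys V \<Longrightarrow> poly_filter P p \<in> polys V"
  by (auto simp: in_polys_iff keys_poly_filter)

text \<open>By linearity a single monomial \<open>m\<close> of \<open>p\<close> suffices: a multiple
  \<open>m + l\<close> is selected exactly when \<open>l\<close> is, and at exponents that are not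
  multiples of \<open>m\<close> both sides vanish. For homogeneous \<open>p\<close> this is the
  degree shift.\<close>

lemma poly_filter_mult:
  assumes "\<And>m l. m \<in> Poly_Mapping.keys p \<Longrightarrow> P (m + l) \<longleftrightarrow> Q l"
  shows "poly_filter P (p * q) = p * poly_filter Q q"
proof -
  have *: "poly_filter P (Poly_Mapping.single m c * q) = Poly_Mapping.single m c * poly_filter Q q"
    (is "?l = ?r") if m: "m \<in> Poly_Mapping.keys p" for m c
  proof (rule poly_mapping_eqI)
    fix k
    show "Poly_Mapping.lookup ?l k = Poly_Mapping.lookup ?r k"
    proof (cases "\<exists>l. k = m + l")
      case True
      then show ?thesis using assms[OF m]
        by (auto simp: lookup_poly_filter lookup_monomial_mult)
    next
      case False
      then show ?thesis
        by (metis in_keys_iff keys_monomial_mult lookup_poly_filter)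
    qed
  qed
  have "p * q = (\<Sum>m\<in>Poly_Mapping.keys p. Poly_Mapping.single m (Poly_Mapping.lookup p m) * q)" for q
    by (subst poly_mapping_sum_single[of p]) (simp add: sum_distrib_right)
  then show ?thesis by (simp add: poly_filter_sum *)
qed

subsection \<open>Graded matrices\<close>

lemma in_free_elems_iff:
  "f \<in> free_elems V \<delta> \<longleftrightarrow> f \<in> carrier_vec (length \<delta>) \<and> (\<forall>b<length \<delta>. f $ b \<in> polys V)"
  by (auto simp: free_elems_def)

lemma graded_mats_carrier: "A \<in> graded_mats V \<delta> \<delta>' \<Longrightarrow> A \<in> carrier_mat (length \<delta>) (length \<delta>')"
  by (simp add: graded_mats_def)

lemma graded_matsD:
  assumes "A \<in> graded_mats V \<delta> \<delta>'" "a < length \<delta>" "b < length \<delta>'"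
  shows "A $$ (a, b) \<in> polys V"
    "m \<in> Poly_Mapping.keys (A $$ (a, b)) \<Longrightarrow> mono_deg m + \<delta> ! a = \<delta>' ! b"
  using assms by (auto simp: graded_mats_def)

lemma index_mult_mat_sum:
  assumes "A \<in> carrier_mat r s" "B \<in> carrier_mat s t" "a < r" "b < t"
  shows "(A * B) $$ (a, b) = (\<Sum>c<s. A $$ (a, c) * B $$ (c, b))"
  using assms by (auto simp: scalar_prod_def atLeast0LessThan intro!: sum.cong)

lemma index_mult_mat_vec_sum:
  assumes "A \<in> carrier_mat r s" "f \<in> carrier_vec s" "a < r"
  shows "(A *\<^sub>v f) $ a = (\<Sum>c<s. A $$ (a, c) * f $ c)"
  using assms by (auto simp: scalar_prod_def atLeast0LessThan intro!: sum.cong)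

lemma graded_mats_mult:
  assumes A: "A \<in> graded_mats V \<delta> \<delta>'" and B: "B \<in> graded_mats V \<delta>' \<delta>''"
  shows "A * B \<in> graded_mats V \<delta> \<delta>''"
proof -
  note car = graded_mats_carrier[OF A] graded_mats_carrier[OF B]
  have "(A * B) $$ (a, b) \<in> polys V \<and>
      (\<forall>m\<in>Poly_Mapping.keys ((A * B) $$ (a, b)). mono_deg m + \<delta> ! a = \<delta>'' ! b)"
    if ab: "a < length \<delta>" "b < length \<delta>''" for a b
  proof (intro conjI ballI)
    show "(A * B) $$ (a, b) \<in> polys V"
      unfolding index_mult_mat_sum[OF car ab]
      using ab by (intro polys_sum polys_mult) (auto intro: graded_matsD[OF A] graded_matsD[OF B])
    fix m assume "m \<in> Poly_Mapping.keys ((A * B) $$ (a, b))"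
    then have "m \<in> (\<Union>c<length \<delta>'. Poly_Mapping.keys (A $$ (a, c) * B $$ (c, b)))"
      unfolding index_mult_mat_sum[OF car ab] by (rule subsetD[OF keys_sum])
    then obtain c where c: "c < length \<delta>'" "m \<in> Poly_Mapping.keys (A $$ (a, c) * B $$ (c, b))"
      by auto
    then obtain m1 m2 where "m = m1 + m2" "m1 \<in> Poly_Mapping.keys (A $$ (a, c))"
      "m2 \<in> Poly_Mapping.keys (B $$ (c, b))"
      using keys_mult[of "A $$ (a, c)" "B $$ (c, b)"] by blast
    then show "mono_deg m + \<delta> ! a = \<delta>'' ! b"
      using graded_matsD(2)[OF A ab(1) c(1)] graded_matsD(2)[OF B c(1) ab(2)]
      by (fastforce simp: mono_deg_add)
  qed
  then show ?thesis using car by (auto simp: graded_mats_def)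
qed

lemma graded_mats_minus:
  assumes A: "A \<in> graded_mats V \<delta> \<delta>'" and B: "B \<in> graded_mats V \<delta> \<delta>'"
  shows "A - B \<in> graded_mats V \<delta> \<delta>'"
proof -
  note car = graded_mats_carrier[OF A] graded_mats_carrier[OF B]
  have "mono_deg m + \<delta> ! a = \<delta>' ! b" if "a < length \<delta>" "b < length \<delta>'"
    "m \<in> Poly_Mapping.keys (A $$ (a, b) - B $$ (a, b))" for a b m
    using that graded_matsD(2)[OF A that(1,2), of m] graded_matsD(2)[OF B that(1,2), of m]
    by (force simp: in_keys_iff lookup_minus)
  then show ?thesis
    using car graded_matsD(1)[OF A] graded_matsD(1)[OF B] by (auto simp: graded_mats_def)
qed

lemma graded_mats_one: "1\<^sub>m (length \<delta>) \<in> graded_mats V \<delta> \<delta>"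
  by (auto simp: graded_mats_def split: if_splits)

lemma graded_mats_mult_vec:
  assumes A: "A \<in> graded_mats V \<delta> \<delta>'" and f: "f \<in> free_elems V \<delta>'"
  shows "A *\<^sub>v f \<in> free_elems V \<delta>"
proof -
  have "(A *\<^sub>v f) $ a \<in> polys V" if "a < length \<delta>" for a
  proof -
    have "f \<in> carrier_vec (length \<delta>')" using f by (simp add: in_free_elems_iff)
    note * = index_mult_mat_vec_sum[OF graded_mats_carrier[OF A] this that]
    show ?thesis unfolding *
      using that f by (intro polys_sum polys_mult) (auto intro: graded_matsD[OF A] simp: in_free_elems_iff)
  qed
  then show ?thesis
    using mult_mat_vec_carrier[OF graded_mats_carrier[OF A], of f] f by (simp add: in_free_elems_iff)
qed

lemma col_graded_mats:
  assumes "A \<in> graded_mats V \<delta> \<delta>'" "b < length \<delta>'"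
  shows "col A b \<in> free_elems V \<delta>"
  using graded_mats_carrier[OF assms(1)] graded_matsD(1)[OF assms(1) _ assms(2)] assms(2)
  by (auto simp: in_free_elems_iff)

text \<open>The component of degree \<open>d\<close> in the free module with basis degrees
  \<open>\<delta>\<close>. The condition is additive because \<open>d - \<delta> ! a\<close> would
  be truncated.\<close>

definition graded_part :: "nat list \<Rightarrow> nat \<Rightarrow> 'k::comm_ring_1 mpoly vec \<Rightarrow> 'k mpoly vec" where
  "graded_part \<delta> d f = vec (length \<delta>) (\<lambda>a. poly_filter (\<lambda>m. mono_deg m + \<delta> ! a = d) (f $ a))"

lemma graded_part_carrier: "graded_part \<delta> d f \<in> carrier_vec (length \<delta>)"
  and index_graded_part:
    "a < length \<delta> \<Longrightarrow> graded_part \<delta> d f $ a = poly_filter (\<lambda>m. mono_deg m + \<delta> ! a = d) (f $ a)"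
  by (simp_all add: graded_part_def)

text \<open>A monomial in the entry at \<open>(a, c)\<close> has degree
  \<open>\<delta>' ! c - \<delta> ! a\<close>, which is exactly the difference between the shifts of
  the two coordinates.\<close>

lemma mult_graded_part:
  assumes A: "A \<in> graded_mats V \<delta> \<delta>'" and f: "f \<in> carrier_vec (length \<delta>')"
  shows "A *\<^sub>v graded_part \<delta>' d f = graded_part \<delta> d (A *\<^sub>v f)"
proof (rule eq_vecI)
  note car = graded_mats_carrier[OF A]
  show "dim_vec (A *\<^sub>v graded_part \<delta>' d f) = dim_vec (graded_part \<delta> d (A *\<^sub>v f))"
    using car by (simp add: graded_part_def)
  fix a assume "a < dim_vec (graded_part \<delta> d (A *\<^sub>v f))"
  then have a: "a < length \<delta>" by (simp add: graded_part_def)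
  have "poly_filter (\<lambda>m. mono_deg m + \<delta> ! a = d) (A $$ (a, c) * f $ c)
      = A $$ (a, c) * poly_filter (\<lambda>m. mono_deg m + \<delta>' ! c = d) (f $ c)" if "c < length \<delta>'" for c
    using graded_matsD(2)[OF A a that] by (intro poly_filter_mult) (fastforce simp: mono_deg_add)
  then show "(A *\<^sub>v graded_part \<delta>' d f) $ a = graded_part \<delta> d (A *\<^sub>v f) $ a"
    unfolding index_mult_mat_vec_sum[OF car graded_part_carrier a] index_graded_part[OF a]
      index_mult_mat_vec_sum[OF car f a] poly_filter_sum
    by (intro sum.cong) (simp_all add: index_graded_part)
qed

lemma mat_of_graded_columns:
  assumes "\<And>b. b < length \<epsilon> \<Longrightarrow> y b \<in> free_elems V \<delta>"
  shows "mat (length \<delta>) (length \<epsilon>) (\<lambda>(a, b). graded_part \<delta> (\<epsilon> ! b) (y b) $ a) \<in> graded_mats V \<delta> \<epsilon>"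
  using assms by (auto simp: graded_mats_def graded_part_def keys_poly_filter in_free_elems_iff)

text \<open>Arbitrary preimages of the columns need not be homogeneous. Since column
  \<open>b\<close> of \<open>X\<close> is homogeneous of degree \<open>\<epsilon> ! b\<close>, the
  component of that degree of any preimage is again a preimage.\<close>

lemma lift_graded_mat:
  assumes E: "E \<in> graded_mats V \<delta> \<delta>'" and X: "X \<in> graded_mats V \<delta> \<epsilon>"
    and lift: "\<And>b. b < length \<epsilon> \<Longrightarrow> \<exists>y\<in>free_elems V \<delta>'. E *\<^sub>v y = col X b"
  obtains Y where "Y \<in> graded_mats V \<delta>' \<epsilon>" "E * Y = X"
proof -
  obtain y where y: "\<And>b. b < length \<epsilon> \<Longrightarrow> y b \<in> free_elems V \<delta>'"
    "\<And>b. b < length \<epsilon> \<Longrightarrow> E *\<^sub>v y b = col X b"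
    using lift by metis
  define Y where "Y = mat (length \<delta>') (length \<epsilon>) (\<lambda>(a, b). graded_part \<delta>' (\<epsilon> ! b) (y b) $ a)"
  have Yg: "Y \<in> graded_mats V \<delta>' \<epsilon>" unfolding Y_def by (rule mat_of_graded_columns) (rule y)
  note car = graded_mats_carrier[OF E] graded_mats_carrier[OF X] graded_mats_carrier[OF Yg]
  have col_eq: "E *\<^sub>v col Y b = col X b" if b: "b < length \<epsilon>" for b
  proof -
    have "col Y b = graded_part \<delta>' (\<epsilon> ! b) (y b)"
      using b by (auto simp: Y_def graded_part_def)
    then have "E *\<^sub>v col Y b = graded_part \<delta> (\<epsilon> ! b) (col X b)"
      using mult_graded_part[OF E, of "y b"] y[OF b] by (simp add: in_free_elems_iff)
    also have "\<dots> = col X b"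
      using car(2) b graded_matsD(2)[OF X _ b]
      by (intro eq_vecI) (auto simp: graded_part_def intro!: poly_filter_id)
    finally show ?thesis .
  qed
  have "E * Y = X"
  proof (rule eq_matI)
    fix a b assume "a < dim_row X" "b < dim_col X"
    then have ab: "a < length \<delta>" "b < length \<epsilon>" using car by auto
    have "col (E * Y) b = col X b" using col_eq[OF ab(2)] car ab by simp
    then show "(E * Y) $$ (a, b) = X $$ (a, b)"
      using car ab by (metis carrier_matD index_col index_mult_mat(2,3))
  qed (use car in auto)
  with Yg show ?thesis by (rule that)
qed

lemma index_mult_unit_vec:
  fixes A :: "'k::comm_ring_1 mpoly mat"
  assumes "A \<in> carrier_mat r s" "a < r" "b < s"
  shows "(A *\<^sub>v unit_vec s b) $ a = A $$ (a, b)"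
proof -
  have "(A *\<^sub>v unit_vec s b) $ a = (\<Sum>c<s. A $$ (a, c) * unit_vec s b $ c)"
    using assms by (intro index_mult_mat_vec_sum) auto
  then show ?thesis
    using assms by (simp add: unit_vec_def if_distrib[of "\<lambda>x. _ * x"] sum.delta cong: if_cong)
qed

lemma mult_mat_eq_0:
  assumes A: "A \<in> graded_mats V \<delta> \<delta>'" and B: "B \<in> graded_mats V \<delta>' \<delta>''"
    and 0: "\<And>y. y \<in> free_elems V \<delta>'' \<Longrightarrow> A *\<^sub>v (B *\<^sub>v y) = 0\<^sub>v (length \<delta>)"
  shows "A * B = 0\<^sub>m (length \<delta>) (length \<delta>'')"
proof (rule eq_matI)
  note car = graded_mats_carrier[OF A] graded_mats_carrier[OF B]
  fix a b assume "a < dim_row (0\<^sub>m (length \<delta>) (length \<delta>''))" "b < dim_col (0\<^sub>m (length \<delta>) (length \<delta>''))"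
  then have ab: "a < length \<delta>" "b < length \<delta>''" by auto
  let ?e = "unit_vec (length \<delta>'') b"
  have "?e \<in> free_elems V \<delta>''" by (auto simp: in_free_elems_iff unit_vec_def)
  from 0[OF this] have "(A * B) *\<^sub>v ?e = 0\<^sub>v (length \<delta>)"
    using car by simp
  moreover have "((A * B) *\<^sub>v ?e) $ a = (A * B) $$ (a, b)"
    using car ab by (intro index_mult_unit_vec) auto
  ultimately show "(A * B) $$ (a, b) = 0\<^sub>m (length \<delta>) (length \<delta>'') $$ (a, b)"
    using ab by simp
qed (use graded_mats_carrier[OF A] graded_mats_carrier[OF B] in auto)

subsection \<open>Comparison of minimal resolutions\<close>

text \<open>If \<open>s < r\<close>, padding with zeros to square matrices keeps the product. Over a
  field the inverse would then be two-sided, but row \<open>s\<close> of \<open>Y'\<close> is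
  zero.\<close>

lemma right_inverse_dim_le:
  fixes X Y :: "'k::field mat"
  assumes X: "X \<in> carrier_mat r s" and Y: "Y \<in> carrier_mat s r" and XY: "X * Y = 1\<^sub>m r"
  shows "r \<le> s"
proof (rule ccontr)
  assume "\<not> r \<le> s"
  then have sr: "s < r" by simp
  define X' where "X' = mat r r (\<lambda>(i, j). if j < s then X $$ (i, j) else 0)"
  define Y' where "Y' = mat r r (\<lambda>(i, j). if i < s then Y $$ (i, j) else 0)"
  have car: "X' \<in> carrier_mat r r" "Y' \<in> carrier_mat r r" by (auto simp: X'_def Y'_def)
  have "X' * Y' = X * Y"
  proof (rule eq_matI)
    fix i j assume "i < dim_row (X * Y)" "j < dim_col (X * Y)"
    then have ij: "i < r" "j < r" using X Y by auto
    have "(\<Sum>c<r. X' $$ (i, c) * Y' $$ (c, j)) = (\<Sum>c<s. X $$ (i, c) * Y $$ (c, j))"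
      using sr ij by (intro sum.mono_neutral_cong_right) (auto simp: X'_def Y'_def)
    then show "(X' * Y') $$ (i, j) = (X * Y) $$ (i, j)"
      using ij by (simp only: index_mult_mat_sum[OF car] index_mult_mat_sum[OF X Y])
  qed (use X Y car in auto)
  with XY have "Y' * X' = 1\<^sub>m r" using mat_mult_left_right_inverse[OF car] by simp
  then have "(Y' * X') $$ (s, s) = 1" using sr by simp
  moreover have "(Y' * X') $$ (s, s) = 0"
    using sr by (simp only: index_mult_mat_sum[OF car(2,1)]) (simp add: Y'_def)
  ultimately show False by simp
qed

text \<open>Stated for arbitrary finite index sets, because the basis elements of one degree need
  not occupy consecutive positions in the list of degrees.\<close>

lemma left_inverse_card_le:
  fixes \<beta> :: "'a \<Rightarrow> 'b \<Rightarrow> 'k::field"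
  assumes fin: "finite J" "finite J'"
    and inv: "\<And>a b. a \<in> J \<Longrightarrow> b \<in> J \<Longrightarrow> (\<Sum>c\<in>J'. \<beta> a c * \<alpha> c b) = (if a = b then 1 else 0)"
  shows "card J \<le> card J'"
proof -
  obtain h where h: "bij_betw h {..<card J} J"
    using ex_bij_betw_nat_finite[OF fin(1)] by (auto simp: atLeast0LessThan)
  obtain h' where h': "bij_betw h' {..<card J'} J'"
    using ex_bij_betw_nat_finite[OF fin(2)] by (auto simp: atLeast0LessThan)
  define X where "X = mat (card J) (card J') (\<lambda>(i, j). \<beta> (h i) (h' j))"
  define Y where "Y = mat (card J') (card J) (\<lambda>(i, j). \<alpha> (h' i) (h j))"
  have car: "X \<in> carrier_mat (card J) (card J')" "Y \<in> carrier_mat (card J') (card J)"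
    by (auto simp: X_def Y_def)
  have "X * Y = 1\<^sub>m (card J)"
  proof (rule eq_matI)
    fix i j assume "i < dim_row (1\<^sub>m (card J))" "j < dim_col (1\<^sub>m (card J))"
    then have ij: "i < card J" "j < card J" by auto
    have "(X * Y) $$ (i, j) = (\<Sum>c<card J'. \<beta> (h i) (h' c) * \<alpha> (h' c) (h j))"
      using ij by (simp only: index_mult_mat_sum[OF car]) (simp add: X_def Y_def)
    also have "\<dots> = (\<Sum>c\<in>J'. \<beta> (h i) c * \<alpha> c (h j))"
      by (rule sum.reindex_bij_betw[OF h'])
    also have "\<dots> = (if h i = h j then 1 else 0)"
      using ij bij_betwE[OF h] by (intro inv) auto
    also have "h i = h j \<longleftrightarrow> i = j"
      using h ij by (auto simp: bij_betw_def inj_on_def)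
    finally show "(X * Y) $$ (i, j) = 1\<^sub>m (card J) $$ (i, j)" using ij by simp
  qed (auto simp: X_def Y_def)
  then show ?thesis by (rule right_inverse_dim_le[OF car])
qed

section \<open>Ranks in a fixed degree\<close>

lemma count_list_eq_card: "count_list xs x = card {i. i < length xs \<and> xs ! i = x}"
  by (simp add: count_list_eq_length_filter length_filter_conv_card eq_commute)

text \<open>A graded entry has a constant term only where the degrees of its row and column agree.
  So the constant terms split into one block for each degree, and the blocks of degree
  \<open>j\<close> still multiply to the identity.\<close>

lemma count_list_le_of_left_inverse:
  fixes A B :: "'k::field mpoly mat"
  assumes A: "A \<in> graded_mats V \<delta>' \<delta>" and B: "B \<in> graded_mats V \<delta> \<delta>'"
    and inv: "\<And>a b. a < length \<delta> \<Longrightarrow> b < length \<delta> \<Longrightarrow>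
      const_term ((B * A) $$ (a, b)) = (if a = b then 1 else 0)"
  shows "count_list \<delta> j \<le> count_list \<delta>' j"
  unfolding count_list_eq_card
proof (rule left_inverse_card_le)
  fix a b assume "a \<in> {i. i < length \<delta> \<and> \<delta> ! i = j}" "b \<in> {i. i < length \<delta> \<and> \<delta> ! i = j}"
  then have ab: "a < length \<delta>" "b < length \<delta>" "\<delta> ! a = j" by auto
  have 0: "const_term (B $$ (a, c)) = 0" if "c < length \<delta>'" "\<delta>' ! c \<noteq> j" for c
    using graded_matsD(2)[OF B ab(1) that(1), of 0] that ab by (auto simp: in_keys_iff)
  have "const_term ((B * A) $$ (a, b)) = (\<Sum>c<length \<delta>'. const_term (B $$ (a, c)) * const_term (A $$ (c, b)))"
    using ab by (simp add: index_mult_mat_sum[OF graded_mats_carrier[OF B] graded_mats_carrier[OF A]]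
        lookup_sum const_term_mult)
  also have "\<dots> = (\<Sum>c | c < length \<delta>' \<and> \<delta>' ! c = j. const_term (B $$ (a, c)) * const_term (A $$ (c, b)))"
    using 0 by (intro sum.mono_neutral_right) auto
  finally show "(\<Sum>c | c < length \<delta>' \<and> \<delta>' ! c = j. const_term (B $$ (a, c)) * const_term (A $$ (c, b)))
      = (if a = b then 1 else 0)"
    using inv[OF ab(1,2)] by simp
qed auto

text \<open>Exactness in position 0 is left out: it involves the resolved module and enters the
  comparison through its initial data.\<close>

definition exact_min_complex :: "nat set \<Rightarrow> (nat \<Rightarrow> nat list) \<Rightarrow> (nat \<Rightarrow> 'k::comm_ring_1 mpoly mat) \<Rightarrow> bool" where
  "exact_min_complex V \<delta> D \<longleftrightarrow>
     (\<forall>i. D i \<in> graded_mats V (\<delta> i) (\<delta> (Suc i))) \<and>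
     (\<forall>i. {f \<in> free_elems V (\<delta> (Suc i)). D i *\<^sub>v f = 0\<^sub>v (length (\<delta> i))}
            = (\<lambda>f. D (Suc i) *\<^sub>v f) ` free_elems V (\<delta> (Suc (Suc i)))) \<and>
     (\<forall>i. \<forall>a < length (\<delta> i). \<forall>b < length (\<delta> (Suc i)). const_term (D i $$ (a, b)) = 0)"

lemma exact_min_complexD:
  assumes "exact_min_complex V \<delta> D"
  shows "D i \<in> graded_mats V (\<delta> i) (\<delta> (Suc i))"
    "f \<in> free_elems V (\<delta> (Suc i)) \<Longrightarrow> D i *\<^sub>v f = 0\<^sub>v (length (\<delta> i)) \<Longrightarrow>
       \<exists>y\<in>free_elems V (\<delta> (Suc (Suc i))). D (Suc i) *\<^sub>v y = f"
    "D i * D (Suc i) = 0\<^sub>m (length (\<delta> i)) (length (\<delta> (Suc (Suc i))))"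
    "a < length (\<delta> i) \<Longrightarrow> b < length (\<delta> (Suc i)) \<Longrightarrow> const_term (D i $$ (a, b)) = 0"
proof -
  show gr: "D i \<in> graded_mats V (\<delta> i) (\<delta> (Suc i))" for i
    using assms by (simp add: exact_min_complex_def)
  have ex: "{f \<in> free_elems V (\<delta> (Suc i)). D i *\<^sub>v f = 0\<^sub>v (length (\<delta> i))}
            = (\<lambda>f. D (Suc i) *\<^sub>v f) ` free_elems V (\<delta> (Suc (Suc i)))" for i
    using assms by (simp add: exact_min_complex_def)
  show "f \<in> free_elems V (\<delta> (Suc i)) \<Longrightarrow> D i *\<^sub>v f = 0\<^sub>v (length (\<delta> i)) \<Longrightarrow>
       \<exists>y\<in>free_elems V (\<delta> (Suc (Suc i))). D (Suc i) *\<^sub>v y = f"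
    using equalityD1[OF ex[of i]] by blast
  show "D i * D (Suc i) = 0\<^sub>m (length (\<delta> i)) (length (\<delta> (Suc (Suc i))))"
    by (rule mult_mat_eq_0[OF gr gr]) (use equalityD2[OF ex[of i]] in blast)
  show "a < length (\<delta> i) \<Longrightarrow> b < length (\<delta> (Suc i)) \<Longrightarrow> const_term (D i $$ (a, b)) = 0"
    using assms by (simp add: exact_min_complex_def)
qed

text \<open>The columns of \<open>X\<close> are cycles, so exactness provides preimages. This is the
  lifting property of free modules that builds chain maps and homotopies.\<close>

lemma lift_cycle:
  assumes D: "exact_min_complex V \<delta> D" and X: "X \<in> graded_mats V (\<delta> (Suc i)) \<epsilon>"
    and 0: "D i * X = 0\<^sub>m (length (\<delta> i)) (length \<epsilon>)"
  obtains Y where "Y \<in> graded_mats V (\<delta> (Suc (Suc i))) \<epsilon>" "D (Suc i) * Y = X"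
proof (rule lift_graded_mat[OF exact_min_complexD(1)[OF D] X])
  fix b assume b: "b < length \<epsilon>"
  have "D i *\<^sub>v col X b = col (D i * X) b"
    using graded_mats_carrier[OF exact_min_complexD(1)[OF D, of i]] graded_mats_carrier[OF X] b by simp
  also have "\<dots> = 0\<^sub>v (length (\<delta> i))" using b unfolding 0 by simp
  finally show "\<exists>y\<in>free_elems V (\<delta> (Suc (Suc i))). D (Suc i) *\<^sub>v y = col X b"
    by (intro exact_min_complexD(2)[OF D] col_graded_mats[OF X b])
qed

lemma const_term_mult_mat_eq_0:
  assumes "A \<in> carrier_mat r s" "B \<in> carrier_mat s t" "a < r" "b < t"
    and "(\<forall>c<s. const_term (A $$ (a, c)) = 0) \<or> (\<forall>c<s. const_term (B $$ (c, b)) = 0)"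
  shows "const_term ((A * B) $$ (a, b)) = 0"
  unfolding index_mult_mat_sum[OF assms(1-4)]
  using assms(5) by (auto simp: lookup_sum const_term_mult intro!: sum.neutral)

text \<open>The induction carries along a homotopy \<open>h\<close> between \<open>B * A\<close> and the identity. By minimality it
  contributes nothing to the constant terms.\<close>

lemma comparison:
  fixes D D' :: "nat \<Rightarrow> 'k::comm_ring_1 mpoly mat"
  assumes D: "exact_min_complex V \<delta> D" and D': "exact_min_complex V \<delta>' D'"
    and A0: "A0 \<in> graded_mats V (\<delta>' 0) (\<delta> 0)" and B0: "B0 \<in> graded_mats V (\<delta> 0) (\<delta>' 0)"
    and A1: "A1 \<in> graded_mats V (\<delta>' (Suc 0)) (\<delta> (Suc 0))" and B1: "B1 \<in> graded_mats V (\<delta> (Suc 0)) (\<delta>' (Suc 0))"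
    and h0: "h0 \<in> graded_mats V (\<delta> (Suc 0)) (\<delta> 0)"
    and A01: "A0 * D 0 = D' 0 * A1" and B01: "B0 * D' 0 = D 0 * B1"
    and BA: "B0 * A0 - 1\<^sub>m (length (\<delta> 0)) = D 0 * h0"
  shows "\<exists>A\<in>graded_mats V (\<delta>' i) (\<delta> i) :: 'k mpoly mat set. \<exists>B\<in>graded_mats V (\<delta> i) (\<delta>' i).
    \<forall>a<length (\<delta> i). \<forall>b<length (\<delta> i). const_term ((B * A) $$ (a, b)) = (if a = b then 1 else 0)"
proof -
  note gr = exact_min_complexD(1)[OF D] and gr' = exact_min_complexD(1)[OF D']
  note gc = graded_mats_carrier[OF gr] and gc' = graded_mats_carrier[OF gr']
  \<comment> \<open>Maps in two adjacent positions are kept, as the next lift starts from their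
    commuting square. The homotopy identity is multiplied by \<open>D i\<close>, because then the
    summand from the position below vanishes and position 0 has the same form as all others.\<close>
  have "\<exists>A\<in>graded_mats V (\<delta>' i) (\<delta> i). \<exists>B\<in>graded_mats V (\<delta> i) (\<delta>' i).
      \<exists>A'\<in>graded_mats V (\<delta>' (Suc i)) (\<delta> (Suc i)). \<exists>B'\<in>graded_mats V (\<delta> (Suc i)) (\<delta>' (Suc i)).
      \<exists>h\<in>graded_mats V (\<delta> (Suc i)) (\<delta> i).
        A * D i = D' i * A' \<and> B * D' i = D i * B' \<and>
        (B * A - 1\<^sub>m (length (\<delta> i))) * D i = D i * (h * D i) \<and>
        (\<forall>a<length (\<delta> i). \<forall>b<length (\<delta> i). const_term ((B * A - 1\<^sub>m (length (\<delta> i))) $$ (a, b)) = 0)" for i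
  proof (induction i)
    case 0
    note c = graded_mats_carrier[OF A0] graded_mats_carrier[OF B0] graded_mats_carrier[OF h0]
    have "(B0 * A0 - 1\<^sub>m (length (\<delta> 0))) * D 0 = D 0 * (h0 * D 0)"
      unfolding BA using c gc[of 0] by simp
    moreover have "const_term ((B0 * A0 - 1\<^sub>m (length (\<delta> 0))) $$ (a, b)) = 0"
      if "a < length (\<delta> 0)" "b < length (\<delta> 0)" for a b
      unfolding BA using that exact_min_complexD(4)[OF D, of a 0]
      by (intro const_term_mult_mat_eq_0[OF gc[of 0] c(3)]) auto
    ultimately show ?case using A01 B01
      by (intro bexI[OF _ A0] bexI[OF _ B0] bexI[OF _ A1] bexI[OF _ B1] bexI[OF _ h0]) blast
  next
    case (Suc i)
    let ?I = "1\<^sub>m (length (\<delta> (Suc i)))"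
    obtain A B A' B' h where
      A: "A \<in> graded_mats V (\<delta>' i) (\<delta> i)" and B: "B \<in> graded_mats V (\<delta> i) (\<delta>' i)"
      and A': "A' \<in> graded_mats V (\<delta>' (Suc i)) (\<delta> (Suc i))"
      and B': "B' \<in> graded_mats V (\<delta> (Suc i)) (\<delta>' (Suc i))"
      and h: "h \<in> graded_mats V (\<delta> (Suc i)) (\<delta> i)"
      and AA': "A * D i = D' i * A'" and BB': "B * D' i = D i * B'"
      and hD: "(B * A - 1\<^sub>m (length (\<delta> i))) * D i = D i * (h * D i)"
      using Suc.IH by (elim bexE conjE) (rule that; assumption)
    note c = graded_mats_carrier[OF A] graded_mats_carrier[OF B] graded_mats_carrier[OF A']
      graded_mats_carrier[OF B'] graded_mats_carrier[OF h]
    have "D' i * (A' * D (Suc i)) = A * (D i * D (Suc i))"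
      using assoc_mult_mat[OF gc'[of i] c(3) gc[of "Suc i"]] assoc_mult_mat[OF c(1) gc[of i] gc[of "Suc i"]] AA'
      by argo
    then obtain A'' where A'': "A'' \<in> graded_mats V (\<delta>' (Suc (Suc i))) (\<delta> (Suc (Suc i)))"
      "D' (Suc i) * A'' = A' * D (Suc i)"
      using lift_cycle[OF D' graded_mats_mult[OF A' gr]] right_mult_zero_mat[OF c(1)]
      unfolding exact_min_complexD(3)[OF D, of i] by metis
    have "D i * (B' * D' (Suc i)) = B * (D' i * D' (Suc i))"
      using assoc_mult_mat[OF gc[of i] c(4) gc'[of "Suc i"]] assoc_mult_mat[OF c(2) gc'[of i] gc'[of "Suc i"]] BB'
      by argo
    then obtain B'' where B'': "B'' \<in> graded_mats V (\<delta> (Suc (Suc i))) (\<delta>' (Suc (Suc i)))"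
      "D (Suc i) * B'' = B' * D' (Suc i)"
      using lift_cycle[OF D graded_mats_mult[OF B' gr']] right_mult_zero_mat[OF c(2)]
      unfolding exact_min_complexD(3)[OF D', of i] by metis
    define Y where "Y = B' * A' - ?I"
    \<comment> \<open>Subtracting the part of the homotopy already known leaves a cycle. Its lift is
      the next homotopy map.\<close>
    define X where "X = Y - h * D i"
    have Yg: "Y \<in> graded_mats V (\<delta> (Suc i)) (\<delta> (Suc i))"
      unfolding Y_def by (intro graded_mats_minus graded_mats_mult[OF B' A'] graded_mats_one)
    have Xg: "X \<in> graded_mats V (\<delta> (Suc i)) (\<delta> (Suc i))"
      unfolding X_def by (intro graded_mats_minus Yg graded_mats_mult[OF h gr])
    note cY = graded_mats_carrier[OF Yg] and cX = graded_mats_carrier[OF Xg]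
    have hDc: "h * D i \<in> carrier_mat (length (\<delta> (Suc i))) (length (\<delta> (Suc i)))"
      using c gc[of i] by simp
    have "D i * (B' * A') = (B * A) * D i"
      using assoc_mult_mat[OF gc[of i] c(4) c(3)] assoc_mult_mat[OF c(2) gc'[of i] c(3)]
        assoc_mult_mat[OF c(2) c(1) gc[of i]] AA' BB' by argo
    then have DY: "D i * Y = D i * (h * D i)"
      unfolding Y_def hD[symmetric] using c gc[of i]
      by (simp add: mult_minus_distrib_mat[of _ "length (\<delta> i)" "length (\<delta> (Suc i))" _ "length (\<delta> (Suc i))"]
          minus_mult_distrib_mat[of _ "length (\<delta> i)" "length (\<delta> i)" _ _ "length (\<delta> (Suc i))"])
    then have "D i * X = 0\<^sub>m (length (\<delta> i)) (length (\<delta> (Suc i)))"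
      unfolding X_def using mult_minus_distrib_mat[OF gc[of i] cY hDc] hDc gc[of i]
      by (simp add: minus_r_inv_mat[of _ "length (\<delta> i)" "length (\<delta> (Suc i))"])
    then obtain h' where h': "h' \<in> graded_mats V (\<delta> (Suc (Suc i))) (\<delta> (Suc i))" "D (Suc i) * h' = X"
      using lift_cycle[OF D Xg] by blast
    note c' = graded_mats_carrier[OF h'(1)]
    have Y_eq: "Y = h * D i + D (Suc i) * h'"
      unfolding h'(2) X_def using cY hDc by (intro eq_matI) auto
    have "Y * D (Suc i) = h * D i * D (Suc i) + D (Suc i) * h' * D (Suc i)"
      unfolding Y_eq by (rule add_mult_distrib_mat[OF hDc _ gc]) (use c' gc[of "Suc i"] in simp)
    also have "h * D i * D (Suc i) = 0\<^sub>m (length (\<delta> (Suc i))) (length (\<delta> (Suc (Suc i))))"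
      unfolding assoc_mult_mat[OF c(5) gc[of i] gc[of "Suc i"]] exact_min_complexD(3)[OF D, of i]
      by (rule right_mult_zero_mat[OF c(5)])
    finally have YD: "Y * D (Suc i) = D (Suc i) * (h' * D (Suc i))"
      using c' gc[of "Suc i"] by simp
    have "const_term (Y $$ (a, b)) = 0" if "a < length (\<delta> (Suc i))" "b < length (\<delta> (Suc i))" for a b
    proof -
      have "const_term ((h * D i) $$ (a, b)) = 0"
        using that exact_min_complexD(4)[OF D, of _ i b]
        by (intro const_term_mult_mat_eq_0[OF c(5) gc]) auto
      moreover have "const_term ((D (Suc i) * h') $$ (a, b)) = 0"
        using that exact_min_complexD(4)[OF D, of a "Suc i"]
        by (intro const_term_mult_mat_eq_0[OF gc c']) auto
      ultimately show ?thesis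
        unfolding Y_eq using that hDc c' gc[of "Suc i"] by (simp add: lookup_add del: index_mult_mat(1))
    qed
    then show ?case
      using A' B' A'' B'' h'(1) YD unfolding Y_def by (intro bexI[OF _ A'] bexI[OF _ B'] bexI[OF _ A''(1)]
          bexI[OF _ B''(1)] bexI[OF _ h'(1)]) simp
  qed
  from this[of i] have "\<exists>A\<in>graded_mats V (\<delta>' i) (\<delta> i) :: 'k mpoly mat set. \<exists>B\<in>graded_mats V (\<delta> i) (\<delta>' i).
      \<forall>a<length (\<delta> i). \<forall>b<length (\<delta> i). const_term ((B * A - 1\<^sub>m (length (\<delta> i))) $$ (a, b)) = 0"
    by fast
  then obtain A B :: "'k mpoly mat" where A: "A \<in> graded_mats V (\<delta>' i) (\<delta> i)" and B: "B \<in> graded_mats V (\<delta> i) (\<delta>' i)"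
    and c0: "\<forall>a<length (\<delta> i). \<forall>b<length (\<delta> i). const_term ((B * A - 1\<^sub>m (length (\<delta> i))) $$ (a, b)) = 0"
    by blast
  have "const_term ((B * A) $$ (a, b)) = (if a = b then 1 else 0)"
    if ab: "a < length (\<delta> i)" "b < length (\<delta> i)" for a b
    using c0[rule_format, OF ab] ab graded_mats_carrier[OF A] graded_mats_carrier[OF B]
    by (auto simp: lookup_minus simp del: index_mult_mat(1) split: if_splits)
  then show ?thesis using A B by blast
qed

subsection \<open>Quotients by homogeneous ideals\<close>

lemma coset_eq_iff:
  fixes I :: "'k::comm_ring_1 mpoly set"
  assumes "ideal I (poly_ring V)"
  shows "I +>\<^bsub>poly_ring V\<^esub> p = I +>\<^bsub>poly_ring V\<^esub> q \<longleftrightarrow> p - q \<in> I"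
proof -
  note I = ideal_polys[OF assms]
  have coset: "I +>\<^bsub>poly_ring V\<^esub> p = (\<lambda>i. i + p) ` I" for p
    by (auto simp: a_r_coset_def')
  show ?thesis
  proof
    assume "I +>\<^bsub>poly_ring V\<^esub> p = I +>\<^bsub>poly_ring V\<^esub> q"
    then have "0 + p \<in> (\<lambda>i. i + q) ` I" unfolding coset using I(2) by blast
    then show "p - q \<in> I" by auto
  next
    assume pq: "p - q \<in> I"
    have "i + p = (i + (p - q)) + q" "i + q = (i - (p - q)) + p" for i by simp_all
    then show "I +>\<^bsub>poly_ring V\<^esub> p = I +>\<^bsub>poly_ring V\<^esub> q"
      unfolding coset using I(3,6) pq by (metis (no_types, lifting) image_eqI image_subsetI subset_antisym)
  qed
qed

lemma quotient_module_simps: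
  "carrier (quotient_module R I) = a_rcosets\<^bsub>R\<^esub> I" "\<zero>\<^bsub>quotient_module R I\<^esub> = I"
  "x \<oplus>\<^bsub>quotient_module R I\<^esub> y = x <+>\<^bsub>R\<^esub> y"
  "r \<odot>\<^bsub>quotient_module R I\<^esub> x = (I +>\<^bsub>R\<^esub> r) \<otimes>\<^bsub>R Quot I\<^esub> x"
  by (simp_all add: quotient_module_def FactRing_def)

lemma abelian_monoid_quotient_module:
  fixes I :: "'k::comm_ring_1 mpoly set"
  assumes "ideal I (poly_ring V)"
  shows "abelian_monoid (quotient_module (poly_ring V) I)"
proof -
  interpret ideal I "poly_ring V" by fact
  interpret Q: ring "poly_ring V Quot I" by (rule quotient_is_ring)
  have eqs: "carrier (poly_ring V Quot I) = a_rcosets\<^bsub>poly_ring V\<^esub> I" "\<zero>\<^bsub>poly_ring V Quot I\<^esub> = I"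
    "\<And>x y. x \<oplus>\<^bsub>poly_ring V Quot I\<^esub> y = x <+>\<^bsub>poly_ring V\<^esub> y"
    by (simp_all add: FactRing_def)
  show ?thesis
    using Q.a_assoc Q.a_comm Q.l_zero Q.zero_closed Q.a_closed
    by (intro abelian_monoidI) (auto simp: quotient_module_simps eqs)
qed

text \<open>Replaces a \<open>finsum\<close> of cosets by the coset of an ordinary sum, so that
  kernel and image of the augmentation become conditions on polynomials modulo
  \<open>I\<close>.\<close>

lemma augmentation_quotient:
  fixes I :: "'k::comm_ring_1 mpoly set"
  assumes I: "ideal I (poly_ring V)"
    and p: "\<And>b. b < length ps \<Longrightarrow> ps ! b \<in> polys V"
    and f: "\<And>b. b < length ps \<Longrightarrow> f $ b \<in> polys V"
  shows "augmentation (quotient_module (poly_ring V) I) (map (\<lambda>p. I +>\<^bsub>poly_ring V\<^esub> p) ps) f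
    = I +>\<^bsub>poly_ring V\<^esub> (\<Sum>b<length ps. f $ b * ps ! b)"
proof -
  interpret ideal I "poly_ring V" by fact
  interpret M: abelian_monoid "quotient_module (poly_ring V) I"
    by (rule abelian_monoid_quotient_module[OF I])
  let ?M = "quotient_module (poly_ring V) I" and ?c = "\<lambda>p. I +>\<^bsub>poly_ring V\<^esub> p"
  have car: "?c p \<in> carrier ?M" if "p \<in> polys V" for p
    using a_rcosetsI[OF a_subset that] by (simp add: quotient_module_simps)
  have smult: "f $ b \<odot>\<^bsub>?M\<^esub> (map ?c ps ! b) = ?c (f $ b * ps ! b)" if "b < length ps" for b
    using that p[OF that] f[OF that] rcoset_mult_add[of "f $ b" "ps ! b"]
    by (simp add: quotient_module_simps FactRing_def)
  have "finsum ?M (\<lambda>b. f $ b \<odot>\<^bsub>?M\<^esub> (map ?c ps ! b)) {..<k} = ?c (\<Sum>b<k. f $ b * ps ! b)"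
    if "k \<le> length ps" for k
    using that
  proof (induction k)
    case 0
    have "?c 0 = I" using a_coset_add_zero[OF a_subset] by simp
    then show ?case by (simp add: quotient_module_simps)
  next
    case (Suc k)
    have 1: "f $ b \<odot>\<^bsub>?M\<^esub> (map ?c ps ! b) \<in> carrier ?M" if "b < length ps" for b
      unfolding smult[OF that] using f[OF that] p[OF that] by (intro car polys_mult)
    have 2: "f $ k * ps ! k \<in> polys V" "(\<Sum>b<k. f $ b * ps ! b) \<in> polys V"
      using Suc.prems f p by (auto intro!: polys_sum polys_mult)
    have "finsum ?M (\<lambda>b. f $ b \<odot>\<^bsub>?M\<^esub> (map ?c ps ! b)) {..<Suc k}
        = f $ k \<odot>\<^bsub>?M\<^esub> (map ?c ps ! k) \<oplus>\<^bsub>?M\<^esub> finsum ?M (\<lambda>b. f $ b \<odot>\<^bsub>?M\<^esub> (map ?c ps ! b)) {..<k}"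
      unfolding lessThan_Suc using Suc.prems 1 by (intro M.finsum_insert) (auto simp del: nth_map)
    also have "\<dots> = ?c (f $ k * ps ! k) \<oplus>\<^bsub>?M\<^esub> ?c (\<Sum>b<k. f $ b * ps ! b)"
      using Suc smult[of k] by simp
    also have "\<dots> = ?c (f $ k * ps ! k + (\<Sum>b<k. f $ b * ps ! b))"
      using a_rcos_sum[OF 2] by (simp add: quotient_module_simps)
    finally show ?case by (simp add: add.commute)
  qed
  then show ?thesis by (simp add: augmentation_def)
qed

text \<open>The row matrix \<open>P\<close> lists homogeneous representatives of the chosen generators.\<close>

lemma resolution_of_quotientE:
  fixes I :: "'k::comm_ring_1 mpoly set"
  assumes I: "ideal I (poly_ring V)"
    and res: "minimal_graded_free_resolution V (quotient_module (poly_ring V) I) (quotient_component V I) \<delta> g D"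
  obtains P where "exact_min_complex V \<delta> D" "P \<in> graded_mats V [0] (\<delta> 0)"
    "\<And>p. p \<in> polys V \<Longrightarrow> \<exists>f\<in>free_elems V (\<delta> 0). (P *\<^sub>v f) $ 0 - p \<in> I"
    "\<And>f. f \<in> free_elems V (\<delta> 0) \<Longrightarrow> (P *\<^sub>v f) $ 0 \<in> I \<Longrightarrow> \<exists>y\<in>free_elems V (\<delta> 1). D 0 *\<^sub>v y = f"
    "\<And>b. b < length (\<delta> 1) \<Longrightarrow> (P * D 0) $$ (0, b) \<in> I"
proof -
  let ?R = "poly_ring V :: 'k mpoly ring" and ?M = "quotient_module (poly_ring V) I"
  interpret ideal I ?R by fact
  have len: "length g = length (\<delta> 0)" and G: "\<And>b. b < length g \<Longrightarrow> g ! b \<in> quotient_component V I (\<delta> 0 ! b)"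
    and surj: "augmentation ?M g ` free_elems V (\<delta> 0) = carrier ?M"
    and ker: "{f \<in> free_elems V (\<delta> 0). augmentation ?M g f = \<zero>\<^bsub>?M\<^esub>} = (\<lambda>f. D 0 *\<^sub>v f) ` free_elems V (\<delta> 1)"
    and D: "\<And>i. D i \<in> graded_mats V (\<delta> i) (\<delta> (Suc i))"
    using res by (auto simp: minimal_graded_free_resolution_def)
  have min: "D i $$ (a, b) \<in> irrelevant_ideal V" if "a < length (\<delta> i)" "b < length (\<delta> (Suc i))" for i a b
    using res that by (auto simp: minimal_graded_free_resolution_def)
  have emc: "exact_min_complex V \<delta> D"
    unfolding exact_min_complex_def using const_term_irrelevant_ideal[OF min] D res
    by (simp add: minimal_graded_free_resolution_def)
  have "\<exists>p. g ! b = I +>\<^bsub>?R\<^esub> p \<and> p \<in> polys V \<and> homogeneous (\<delta> 0 ! b) p" if "b < length g" for b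
    using G[OF that] by (auto simp: quotient_component_def)
  then obtain q where q: "\<And>b. b < length g \<Longrightarrow>
      g ! b = I +>\<^bsub>?R\<^esub> q b \<and> q b \<in> polys V \<and> homogeneous (\<delta> 0 ! b) (q b)"
    by metis
  define ps where "ps = map q [0..<length g]"
  have g_eq: "g = map (\<lambda>p. I +>\<^bsub>?R\<^esub> p) ps"
    using q by (auto simp: ps_def intro: nth_equalityI)
  define P where "P = mat 1 (length (\<delta> 0)) (\<lambda>(a, b). q b)"
  have P: "P \<in> graded_mats V [0] (\<delta> 0)"
    using q len by (auto simp: graded_mats_def P_def homogeneous_def)
  have Pc: "P \<in> carrier_mat (Suc 0) (length (\<delta> 0))" by (simp add: P_def)
  have aug: "augmentation ?M g f = I +>\<^bsub>?R\<^esub> ((P *\<^sub>v f) $ 0)" if "f \<in> free_elems V (\<delta> 0)" for f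
  proof -
    have "f \<in> carrier_vec (length (\<delta> 0))" using that by (simp add: in_free_elems_iff)
    then have "(P *\<^sub>v f) $ 0 = (\<Sum>b<length ps. f $ b * ps ! b)"
      using len by (simp only: index_mult_mat_vec_sum[OF Pc _ lessI])
        (auto simp: P_def ps_def mult.commute intro!: sum.cong)
    moreover have "ps ! b \<in> polys V" "f $ b \<in> polys V" if "b < length ps" for b
      using that q len \<open>f \<in> free_elems V (\<delta> 0)\<close> by (auto simp: ps_def in_free_elems_iff)
    ultimately show ?thesis
      unfolding g_eq by (simp add: augmentation_quotient[OF I])
  qed
  have zero: "\<zero>\<^bsub>?M\<^esub> = I +>\<^bsub>?R\<^esub> 0"
    using a_coset_add_zero[OF a_subset] by (simp add: quotient_module_simps)
  have ker_iff: "augmentation ?M g f = \<zero>\<^bsub>?M\<^esub> \<longleftrightarrow> (P *\<^sub>v f) $ 0 \<in> I" if "f \<in> free_elems V (\<delta> 0)" for f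
    unfolding aug[OF that] zero coset_eq_iff[OF I] by simp
  show ?thesis
  proof (rule that[OF emc P])
    fix p :: "'k mpoly" assume p: "p \<in> polys V"
    then have "I +>\<^bsub>?R\<^esub> p \<in> augmentation ?M g ` free_elems V (\<delta> 0)"
      unfolding surj using a_rcosetsI[OF a_subset p] by (simp add: quotient_module_simps)
    then obtain f where f: "f \<in> free_elems V (\<delta> 0)" "augmentation ?M g f = I +>\<^bsub>?R\<^esub> p" by auto
    then show "\<exists>f\<in>free_elems V (\<delta> 0). (P *\<^sub>v f) $ 0 - p \<in> I"
      using aug[OF f(1)] coset_eq_iff[OF I] by metis
  next
    fix f assume "f \<in> free_elems V (\<delta> 0)" "(P *\<^sub>v f) $ 0 \<in> I"
    then show "\<exists>y\<in>free_elems V (\<delta> 1). D 0 *\<^sub>v y = f"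
      using ker_iff equalityD1[OF ker] by blast
  next
    fix b assume b: "b < length (\<delta> 1)"
    let ?e = "unit_vec (length (\<delta> 1)) b"
    have e: "?e \<in> free_elems V (\<delta> 1)" by (auto simp: in_free_elems_iff unit_vec_def)
    have D0: "D 0 \<in> carrier_mat (length (\<delta> 0)) (length (\<delta> 1))"
      using graded_mats_carrier[OF D[of 0]] by simp
    have "(P *\<^sub>v (D 0 *\<^sub>v ?e)) $ 0 \<in> I"
      using equalityD2[OF ker] e ker_iff by blast
    also have "P *\<^sub>v (D 0 *\<^sub>v ?e) = (P * D 0) *\<^sub>v ?e"
      using assoc_mult_mat_vec[OF Pc D0, of ?e] by simp
    also have "\<dots> $ 0 = (P * D 0) $$ (0, b)"
      using Pc D0 b by (intro index_mult_unit_vec) auto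
    finally show "(P * D 0) $$ (0, b) \<in> I" .
  qed
qed

text \<open>The counterpart of \<open>lift_graded_mat\<close> at the resolved module. The equations
  hold only modulo \<open>I\<close>, so passing to components uses the homogeneity of
  \<open>I\<close>, which is the hypothesis \<open>hom\<close>.\<close>

lemma lift_mod_ideal:
  fixes I :: "'k::comm_ring_1 mpoly set"
  assumes I: "ideal I (poly_ring V)"
    and hom: "\<And>p d. p \<in> I \<Longrightarrow> poly_filter (\<lambda>m. mono_deg m = d) p \<in> I"
    and P: "P \<in> graded_mats V [0] \<delta>" and Q: "Q \<in> graded_mats V [0] \<epsilon>"
    and surj: "\<And>p. p \<in> polys V \<Longrightarrow> \<exists>f\<in>free_elems V \<delta>. (P *\<^sub>v f) $ 0 - p \<in> I"
  obtains A where "A \<in> graded_mats V \<delta> \<epsilon>" "\<And>b. b < length \<epsilon> \<Longrightarrow> (P * A - Q) $$ (0, b) \<in> I"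
proof -
  have "\<exists>f\<in>free_elems V \<delta>. (P *\<^sub>v f) $ 0 - Q $$ (0, b) \<in> I" if "b < length \<epsilon>" for b
    using that by (intro surj graded_matsD(1)[OF Q]) auto
  then obtain y where y: "\<And>b. b < length \<epsilon> \<Longrightarrow> y b \<in> free_elems V \<delta>"
    "\<And>b. b < length \<epsilon> \<Longrightarrow> (P *\<^sub>v y b) $ 0 - Q $$ (0, b) \<in> I"
    by metis
  define A where "A = mat (length \<delta>) (length \<epsilon>) (\<lambda>(a, b). graded_part \<delta> (\<epsilon> ! b) (y b) $ a)"
  have Ag: "A \<in> graded_mats V \<delta> \<epsilon>" unfolding A_def by (rule mat_of_graded_columns) (rule y)
  note car = graded_mats_carrier[OF P] graded_mats_carrier[OF Q] graded_mats_carrier[OF Ag]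
  have "(P * A - Q) $$ (0, b) \<in> I" if b: "b < length \<epsilon>" for b
  proof -
    have "col A b = graded_part \<delta> (\<epsilon> ! b) (y b)"
      using b by (auto simp: A_def graded_part_def)
    then have "P *\<^sub>v col A b = graded_part [0] (\<epsilon> ! b) (P *\<^sub>v y b)"
      using mult_graded_part[OF P, of "y b"] y[OF b] by (simp add: in_free_elems_iff)
    moreover have "(P * A) $$ (0, b) = (P *\<^sub>v col A b) $ 0"
      using car b by simp
    ultimately have "(P * A) $$ (0, b) = poly_filter (\<lambda>m. mono_deg m = \<epsilon> ! b) ((P *\<^sub>v y b) $ 0)"
      by (simp add: index_graded_part)
    moreover have "poly_filter (\<lambda>m. mono_deg m = \<epsilon> ! b) (Q $$ (0, b)) = Q $$ (0, b)"
      using graded_matsD(2)[OF Q _ b, of 0] by (intro poly_filter_id) simp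
    ultimately have "(P * A - Q) $$ (0, b) =
        poly_filter (\<lambda>m. mono_deg m = \<epsilon> ! b) ((P *\<^sub>v y b) $ 0 - Q $$ (0, b))"
      using car b by (simp add: poly_filter_diff del: index_mult_mat(1))
    then show ?thesis using hom[OF y(2)[OF b]] by simp
  qed
  with Ag show ?thesis by (rule that)
qed

lemma row_mult_in_ideal:
  fixes I :: "'k::comm_ring_1 mpoly set"
  assumes I: "ideal I (poly_ring V)" and X: "X \<in> carrier_mat (Suc 0) (length \<delta>)"
    and "\<And>c. c < length \<delta> \<Longrightarrow> X $$ (0, c) \<in> I" and Z: "Z \<in> graded_mats V \<delta> \<epsilon>" and b: "b < length \<epsilon>"
  shows "(X * Z) $$ (0, b) \<in> I"
  unfolding index_mult_mat_sum[OF X graded_mats_carrier[OF Z] lessI b]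
proof (rule ideal_polys(7)[OF I])
  fix c assume "c \<in> {..<length \<delta>}"
  then show "X $$ (0, c) * Z $$ (c, b) \<in> I"
    using ideal_polys(4)[OF I assms(3) graded_matsD(1)[OF Z _ b], of c] by (simp add: mult.commute)
qed

text \<open>The identity of the quotient lifts to maps in both directions between the free modules
  in position 0. The image of \<open>B * A - 1\<close> lies in the kernel of \<open>P\<close> modulo
  \<open>I\<close>, so this matrix factors through \<open>D 0\<close>. These are the initial data of
  \<open>comparison\<close>. One inequality suffices, as the roles are symmetric.\<close>

lemma minimal_resolution_count_le:
  fixes I :: "'k::field mpoly set"
  assumes I: "ideal I (poly_ring V)"
    and hom: "\<And>p d. p \<in> I \<Longrightarrow> poly_filter (\<lambda>m. mono_deg m = d) p \<in> I"
    and res: "minimal_graded_free_resolution V (quotient_module (poly_ring V) I) (quotient_component V I) \<delta> g D"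
    and res': "minimal_graded_free_resolution V (quotient_module (poly_ring V) I) (quotient_component V I) \<delta>' g' D'"
  shows "count_list (\<delta> i) j \<le> count_list (\<delta>' i) j"
proof -
  obtain P where emc: "exact_min_complex V \<delta> D" and P: "P \<in> graded_mats V [0] (\<delta> 0)"
    and surj: "\<And>p. p \<in> polys V \<Longrightarrow> \<exists>f\<in>free_elems V (\<delta> 0). (P *\<^sub>v f) $ 0 - p \<in> I"
    and ker: "\<And>f. f \<in> free_elems V (\<delta> 0) \<Longrightarrow> (P *\<^sub>v f) $ 0 \<in> I \<Longrightarrow> \<exists>y\<in>free_elems V (\<delta> 1). D 0 *\<^sub>v y = f"
    and PD: "\<And>b. b < length (\<delta> 1) \<Longrightarrow> (P * D 0) $$ (0, b) \<in> I"
    using resolution_of_quotientE[OF I res] by blast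
  obtain P' where emc': "exact_min_complex V \<delta>' D'" and P': "P' \<in> graded_mats V [0] (\<delta>' 0)"
    and surj': "\<And>p. p \<in> polys V \<Longrightarrow> \<exists>f\<in>free_elems V (\<delta>' 0). (P' *\<^sub>v f) $ 0 - p \<in> I"
    and ker': "\<And>f. f \<in> free_elems V (\<delta>' 0) \<Longrightarrow> (P' *\<^sub>v f) $ 0 \<in> I \<Longrightarrow> \<exists>y\<in>free_elems V (\<delta>' 1). D' 0 *\<^sub>v y = f"
    and PD': "\<And>b. b < length (\<delta>' 1) \<Longrightarrow> (P' * D' 0) $$ (0, b) \<in> I"
    using resolution_of_quotientE[OF I res'] by blast
  note D = exact_min_complexD(1)[OF emc, of 0] and D' = exact_min_complexD(1)[OF emc', of 0]
  note PD = PD[unfolded One_nat_def] and PD' = PD'[unfolded One_nat_def]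
    and ker = ker[unfolded One_nat_def] and ker' = ker'[unfolded One_nat_def]
  obtain A where A: "A \<in> graded_mats V (\<delta>' 0) (\<delta> 0)"
    and PA: "\<And>b. b < length (\<delta> 0) \<Longrightarrow> (P' * A - P) $$ (0, b) \<in> I"
    using lift_mod_ideal[OF I hom P' P surj'] by blast
  obtain B where B: "B \<in> graded_mats V (\<delta> 0) (\<delta>' 0)"
    and PB: "\<And>b. b < length (\<delta>' 0) \<Longrightarrow> (P * B - P') $$ (0, b) \<in> I"
    using lift_mod_ideal[OF I hom P P' surj] by blast
  have lift: "\<exists>Y\<in>graded_mats V (\<epsilon>' (Suc 0)) \<epsilon>. E 0 * Y = X"
    if E: "E 0 \<in> graded_mats V (\<epsilon>' 0) (\<epsilon>' (Suc 0))" and Q: "Q \<in> graded_mats V [0] (\<epsilon>' 0)"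
      and X: "X \<in> graded_mats V (\<epsilon>' 0) \<epsilon>"
      and k: "\<And>f. f \<in> free_elems V (\<epsilon>' 0) \<Longrightarrow> (Q *\<^sub>v f) $ 0 \<in> I \<Longrightarrow> \<exists>y\<in>free_elems V (\<epsilon>' (Suc 0)). E 0 *\<^sub>v y = f"
      and QX: "\<And>b. b < length \<epsilon> \<Longrightarrow> (Q * X) $$ (0, b) \<in> I"
    for E Q X \<epsilon> and \<epsilon>' :: "nat \<Rightarrow> nat list"
  proof -
    have "\<exists>y\<in>free_elems V (\<epsilon>' (Suc 0)). E 0 *\<^sub>v y = col X b" if b: "b < length \<epsilon>" for b
      using QX[OF b] b graded_mats_carrier[OF Q] graded_mats_carrier[OF X]
      by (intro k col_graded_mats[OF X b]) simp
    then show ?thesis using lift_graded_mat[OF E X] by metis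
  qed
  \<comment> \<open>Here \<open>Q' * (C * E) = (Q' * C - Q) * E + Q * E\<close>, and both summands
    have their entry \<open>(0, b)\<close> in \<open>I\<close>.\<close>
  have small: "(Q' * (C * E)) $$ (0, b) \<in> I"
    if "Q \<in> graded_mats V [0] \<epsilon>" "Q' \<in> graded_mats V [0] \<epsilon>'" "C \<in> graded_mats V \<epsilon>' \<epsilon>" "E \<in> graded_mats V \<epsilon> \<epsilon>''"
      "\<And>b. b < length \<epsilon> \<Longrightarrow> (Q' * C - Q) $$ (0, b) \<in> I"
      "(Q * E) $$ (0, b) \<in> I" "b < length \<epsilon>''"
    for Q Q' C E b and \<epsilon> \<epsilon>' \<epsilon>'' :: "nat list"
  proof -
    note c = that(1-4)[THEN graded_mats_carrier]
    have Q'C: "Q' * C \<in> carrier_mat (length [0]) (length \<epsilon>)" using c by simp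
    have "(Q' * C - Q) * E = Q' * (C * E) - Q * E"
      using minus_mult_distrib_mat[OF Q'C c(1) c(4)] c by simp
    moreover have "((Q' * C - Q) * E) $$ (0, b) \<in> I"
      using that(5,7) c by (intro row_mult_in_ideal[OF I _ _ that(4)]) auto
    moreover have "(Q' * (C * E) - Q * E) $$ (0, b) = (Q' * (C * E)) $$ (0, b) - (Q * E) $$ (0, b)"
      using c that(7) by simp
    ultimately show ?thesis using ideal_polys(3)[OF I _ that(6)] by fastforce
  qed
  obtain A1 where A1: "A1 \<in> graded_mats V (\<delta>' (Suc 0)) (\<delta> (Suc 0))" "D' 0 * A1 = A * D 0"
    using lift[of D' \<delta>', OF D' P' graded_mats_mult[OF A D] ker' small[OF P P' A D PA PD]] by blast
  obtain B1 where B1: "B1 \<in> graded_mats V (\<delta> (Suc 0)) (\<delta>' (Suc 0))" "D 0 * B1 = B * D' 0"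
    using lift[of D \<delta>, OF D P graded_mats_mult[OF B D'] ker small[OF P' P B D' PB PD']] by blast
  let ?X = "B * A - 1\<^sub>m (length (\<delta> 0))"
  have X: "?X \<in> graded_mats V (\<delta> 0) (\<delta> 0)"
    by (intro graded_mats_minus graded_mats_mult[OF B A] graded_mats_one)
  have "(P * ?X) $$ (0, b) \<in> I" if b: "b < length (\<delta> 0)" for b
  proof -
    note c = graded_mats_carrier[OF P] graded_mats_carrier[OF P'] graded_mats_carrier[OF A] graded_mats_carrier[OF B]
    have PBc: "P * B \<in> carrier_mat (length [0]) (length (\<delta>' 0))"
      and BAc: "B * A \<in> carrier_mat (length (\<delta> 0)) (length (\<delta> 0))" using c by auto
    have "(P * B - P') * A = P * (B * A) - P' * A"
      using minus_mult_distrib_mat[OF PBc c(2) c(3)] c by simp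
    moreover have "P * ?X = P * (B * A) - P"
      using mult_minus_distrib_mat[OF c(1) BAc one_carrier_mat] c by simp
    ultimately have "(P * ?X) $$ (0, b) = ((P * B - P') * A) $$ (0, b) + (P' * A - P) $$ (0, b)"
      using c b by simp
    moreover have "((P * B - P') * A) $$ (0, b) \<in> I"
      using PB c b by (intro row_mult_in_ideal[OF I _ _ A]) auto
    ultimately show ?thesis using ideal_polys(3)[OF I] PA[OF b] by simp
  qed
  from lift[of D \<delta>, OF D P X ker this]
  obtain h0 where h0: "h0 \<in> graded_mats V (\<delta> (Suc 0)) (\<delta> 0)" "D 0 * h0 = ?X" by blast
  obtain A' B' :: "'k mpoly mat" where "A' \<in> graded_mats V (\<delta>' i) (\<delta> i)" "B' \<in> graded_mats V (\<delta> i) (\<delta>' i)"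
    "\<forall>a<length (\<delta> i). \<forall>b<length (\<delta> i). const_term ((B' * A') $$ (a, b)) = (if a = b then 1 else 0)"
    using comparison[OF emc emc' A B A1(1) B1(1) h0(1) A1(2)[symmetric] B1(2)[symmetric] h0(2)[symmetric], of i]
    by blast
  then show ?thesis by (intro count_list_le_of_left_inverse) auto
qed

text \<open>The given resolution yields existence, and \<open>minimal_resolution_count_le\<close> in
  both directions yields uniqueness for the definite description.\<close>

lemma graded_betti_quotient_eqI:
  fixes I :: "'k::field mpoly set"
  assumes I: "ideal I (poly_ring V)"
    and hom: "\<And>p d. p \<in> I \<Longrightarrow> poly_filter (\<lambda>m. mono_deg m = d) p \<in> I"
    and res: "minimal_graded_free_resolution V (quotient_module (poly_ring V) I) (quotient_component V I) \<delta> g D"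
  shows "graded_betti V (quotient_module (poly_ring V) I) (quotient_component V I) i j = count_list (\<delta> i) j"
  unfolding graded_betti_def
proof (rule the_equality)
  show "\<exists>\<delta>' g D. minimal_graded_free_resolution V (quotient_module (poly_ring V) I) (quotient_component V I) \<delta>' g D
      \<and> count_list (\<delta> i) j = count_list (\<delta>' i) j"
    using res by blast
qed (use minimal_resolution_count_le[OF I hom] res in \<open>blast intro: antisym\<close>)

subsection \<open>Cells and their incidence signs\<close>

text \<open>For \<open>s\<close> outside \<open>c\<close>, the sign of the facet \<open>c\<close> of
  the simplex on \<open>insert s c\<close>. On tagged pairs the order is lexicographic, so the first
  factor precedes the second.\<close>

definition incidence_sign :: "'a::linorder \<Rightarrow> 'a set \<Rightarrow> 'k::comm_ring_1" where
  "incidence_sign s c = (- 1) ^ card {t \<in> c. t < s}"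

lemma incidence_sign_square [simp]: "incidence_sign s c * incidence_sign s c = 1"
  by (simp add: incidence_sign_def flip: power_mult_distrib)

lemma incidence_sign_insert:
  assumes "finite c" "t \<notin> c"
  shows "incidence_sign s (insert t c) = (if t < s then - incidence_sign s c else incidence_sign s c)"
proof -
  have "{x \<in> insert t c. x < s} = (if t < s then insert t {x \<in> c. x < s} else {x \<in> c. x < s})"
    by auto
  then show ?thesis using assms by (simp add: incidence_sign_def)
qed

text \<open>Inserting a smaller element flips the sign, and exactly one of \<open>s < t\<close> and
  \<open>t < s\<close> holds.\<close>

lemma incidence_sign_anticommute:
  assumes "finite c" "s \<notin> c" "t \<notin> c" "s \<noteq> t"
  shows "incidence_sign s c * incidence_sign t (insert s c)
    = - (incidence_sign t c * incidence_sign s (insert t c) :: 'k::comm_ring_1)"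
  using assms by (auto simp: incidence_sign_insert mult.commute)

text \<open>The coefficient at \<open>c\<close> of the boundary of the chain with coefficients
  \<open>f\<close>. Sets outside \<open>P\<close> count as zero, as in a relative chain complex;
  this discards the sets with an empty factor.\<close>

definition boundary :: "('a::linorder set \<Rightarrow> bool) \<Rightarrow> 'a set \<Rightarrow> ('a set \<Rightarrow> 'k::comm_ring_1) \<Rightarrow> 'a set \<Rightarrow> 'k" where
  "boundary P S f c = (\<Sum>s | s \<in> S - c \<and> P (insert s c). incidence_sign s c * f (insert s c))"

lemma boundary_add: "boundary P S (\<lambda>c. f c + g c) c = boundary P S f c + boundary P S g c"
  and boundary_diff: "boundary P S (\<lambda>c. f c - g c) c = boundary P S f c - boundary P S g c"
  by (simp_all add: boundary_def algebra_simps sum.distrib sum_subtractf)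

text \<open>The terms at \<open>(s, t)\<close> and \<open>(t, s)\<close> cancel. The diagonal is
  treated separately, since in characteristic 2 antisymmetry does not make it vanish.\<close>

lemma sum_alternating_eq_0:
  fixes q :: "'a \<Rightarrow> 'a \<Rightarrow> 'k::ab_group_add"
  assumes "finite S" "\<And>s t. s \<in> S \<Longrightarrow> t \<in> S \<Longrightarrow> q s t = - q t s" "\<And>s. s \<in> S \<Longrightarrow> q s s = 0"
  shows "(\<Sum>s\<in>S. \<Sum>t\<in>S. q s t) = 0"
  using assms
proof (induction S rule: finite_induct)
  case (insert x S)
  have "(\<Sum>s\<in>insert x S. \<Sum>t\<in>insert x S. q s t)
      = q x x + (\<Sum>t\<in>S. q x t) + ((\<Sum>s\<in>S. q s x) + (\<Sum>s\<in>S. \<Sum>t\<in>S. q s t))"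
    using insert.hyps by (simp add: sum.distrib)
  also have "(\<Sum>s\<in>S. q s x) = - (\<Sum>t\<in>S. q x t)"
    unfolding sum_negf[symmetric] by (rule sum.cong[OF refl], rule insert.prems(1)) auto
  also have "(\<Sum>s\<in>S. \<Sum>t\<in>S. q s t) = 0"
    by (rule insert.IH; rule insert.prems; simp)
  finally show ?case using insert.prems(2)[of x] by simp
qed simp

text \<open>By convexity a set in \<open>P\<close> with two more elements \<open>s\<close> and
  \<open>t\<close> is reached from \<open>c\<close> both through \<open>insert s c\<close> and
  through \<open>insert t c\<close>, and the two contributions cancel by anticommutation of the
  signs.\<close>

lemma boundary_boundary:
  fixes f :: "'a::linorder set \<Rightarrow> 'k::comm_ring_1"
  assumes S: "finite S" and c: "finite c" "P c"
    and convex: "\<And>s t. P (insert t (insert s c)) \<Longrightarrow> P (insert s c)"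
  shows "boundary P S (boundary P S f) c = 0"
proof -
  \<comment> \<open>Extension by zero lets \<open>s\<close> and \<open>t\<close> run independently
    over \<open>S - c\<close>.\<close>
  define q where "q s t = (if s \<noteq> t \<and> P (insert t (insert s c)) then
      incidence_sign s c * incidence_sign t (insert s c) * f (insert t (insert s c)) else 0)" for s t
  have "incidence_sign s c * boundary P S f (insert s c) = (\<Sum>t\<in>S - c. q s t)"
    if "s \<in> S - c" for s
  proof -
    have "(\<Sum>t\<in>S - c. q s t) = (\<Sum>t | t \<in> S - insert s c \<and> P (insert t (insert s c)).
        incidence_sign s c * (incidence_sign t (insert s c) * f (insert t (insert s c))))"
      using S by (intro sum.mono_neutral_cong_right) (auto simp: q_def mult.assoc)
    then show ?thesis by (simp add: boundary_def sum_distrib_left)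
  qed
  moreover have "(\<Sum>t\<in>S - c. q s t) = 0" if "\<not> P (insert s c)" for s
    using that convex by (intro sum.neutral) (auto simp: q_def)
  ultimately have "boundary P S (boundary P S f) c = (\<Sum>s\<in>S - c. \<Sum>t\<in>S - c. q s t)"
    unfolding boundary_def[of P S "boundary P S f"] using S
    by (intro sum.mono_neutral_cong_left) auto
  also have "\<dots> = 0"
  proof (rule sum_alternating_eq_0)
    fix s t assume "s \<in> S - c" "t \<in> S - c"
    then have "incidence_sign s c * incidence_sign t (insert s c)
        = - (incidence_sign t c * incidence_sign s (insert t c) :: 'k)" if "s \<noteq> t"
      using incidence_sign_anticommute[of c s t] c(1) that by blast
    then show "q s t = - q t s" by (simp add: q_def insert_commute)
  qed (use S in \<open>auto simp: q_def\<close>)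
  finally show ?thesis .
qed

text \<open>Contraction towards the vertex \<open>a\<close>: a cycle is a boundary except on the cells that cease to be
  cells when \<open>a\<close> is removed.\<close>

lemma boundary_cone:
  fixes f :: "'a::linorder set \<Rightarrow> 'k::comm_ring_1"
  assumes S: "finite S" "a \<in> S" and fin: "\<And>c. P c \<Longrightarrow> finite c"
    and cone: "\<And>c. P c \<Longrightarrow> a \<notin> c \<Longrightarrow> P (insert a c)"
    and cycle: "\<And>c. P c \<Longrightarrow> card c = k \<Longrightarrow> boundary P S f c = 0"
  defines "g \<equiv> \<lambda>c. if a \<in> c \<and> P (c - {a}) then incidence_sign a (c - {a}) * f (c - {a}) else 0"
  assumes c: "P c" "card c = Suc k" "a \<notin> c \<or> P (c - {a})"
  shows "boundary P S g c = f c"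
proof (cases "a \<in> c")
  case False
  have "boundary P S g c = (\<Sum>s\<in>{a}. incidence_sign s c * g (insert s c))"
    unfolding boundary_def using S cone[OF c(1)] False
    by (intro sum.mono_neutral_right) (auto simp: g_def)
  also have "\<dots> = f c"
    using False c(1) by (simp add: g_def flip: mult.assoc)
  finally show ?thesis .
next
  case True
  define d where "d = c - {a}"
  have d: "P d" "a \<notin> d" "c = insert a d" "card d = k" "finite d"
    using True c fin[of c] by (auto simp: d_def)
  let ?T = "{s \<in> S - c. P (insert s d)}"
  \<comment> \<open>In the cycle condition at \<open>d\<close>, the term at \<open>a\<close> is
    \<open>f c\<close> up to sign, and the other terms are those met by the boundary of
    \<open>g\<close> at \<open>c\<close>.\<close>
  have "boundary P S f d = (\<Sum>s\<in>insert a ?T. incidence_sign s d * f (insert s d))"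
    unfolding boundary_def using S d c(1) by (intro sum.cong) auto
  also have "\<dots> = incidence_sign a d * f c + (\<Sum>s\<in>?T. incidence_sign s d * f (insert s d))"
    using S d by (subst sum.insert) auto
  finally have sum0: "(\<Sum>s\<in>?T. incidence_sign s d * f (insert s d)) = - (incidence_sign a d * f c)"
    using cycle[OF d(1,4)] by (metis add_eq_0_iff)
  have "boundary P S g c = (\<Sum>s\<in>?T. incidence_sign s c * (incidence_sign a (insert s d) * f (insert s d)))"
    unfolding boundary_def
  proof (rule sum.mono_neutral_cong_right)
    have ins: "insert s c - {a} = insert s d" if "s \<notin> c" for s
      using that d by auto
    show "?T \<subseteq> {s \<in> S - c. P (insert s c)}"
      using cone[of "insert s d" for s] d(2,3) by (auto simp: insert_commute)
    show "\<forall>s\<in>{s \<in> S - c. P (insert s c)} - ?T. incidence_sign s c * g (insert s c) = 0"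
      using ins by (auto simp: g_def)
    show "incidence_sign s c * g (insert s c) = incidence_sign s c * (incidence_sign a (insert s d) * f (insert s d))"
      if "s \<in> ?T" for s
      using that ins[of s] True by (auto simp: g_def)
  qed (use S in auto)
  also have "\<dots> = (\<Sum>s\<in>?T. - incidence_sign a d * (incidence_sign s d * f (insert s d)))"
    using d by (intro sum.cong) (auto simp: incidence_sign_insert mult.assoc mult.left_commute)
  also have "\<dots> = - incidence_sign a d * - (incidence_sign a d * f c)"
    unfolding sum0[symmetric] sum_distrib_left ..
  also have "\<dots> = f c" by (simp flip: mult.assoc)
  finally show ?thesis .
qed

text \<open>The cell with first factor \<open>A\<close> and second factor \<open>B\<close>, where all elements of \<open>A\<close> are smaller than
  all elements of \<open>B\<close>, is encoded as \<open>{False} \<times> A \<union> {True} \<times> B\<close>; it is the product of the simplices on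
  \<open>A\<close> and \<open>B\<close>.\<close>

definition cell :: "nat set \<Rightarrow> (bool \<times> nat) set \<Rightarrow> bool" where
  "cell \<sigma> c \<longleftrightarrow> finite c \<and> (\<exists>u. (False, u) \<in> c) \<and> (\<exists>v. (True, v) \<in> c) \<and>
     (\<forall>u v. (False, u) \<in> c \<longrightarrow> (True, v) \<in> c \<longrightarrow> u < v) \<and> (\<forall>v. (True, v) \<in> c \<longrightarrow> v \<in> \<sigma>)"

lemma cellD:
  assumes "cell \<sigma> c"
  shows "finite c" "\<exists>u. (False, u) \<in> c" "\<exists>v. (True, v) \<in> c"
    "(False, u) \<in> c \<Longrightarrow> (True, v) \<in> c \<Longrightarrow> u < v" "(True, v) \<in> c \<Longrightarrow> v \<in> \<sigma>"
  using assms by (simp_all add: cell_def)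

lemma cellI:
  assumes "finite c" "(False, u) \<in> c" "(True, v) \<in> c"
    "\<And>u v. (False, u) \<in> c \<Longrightarrow> (True, v) \<in> c \<Longrightarrow> u < v" "\<And>v. (True, v) \<in> c \<Longrightarrow> v \<in> \<sigma>"
  shows "cell \<sigma> c"
  unfolding cell_def using assms by metis

lemma cell_insert_False:
  assumes c: "cell \<sigma> c" and w: "\<And>v. (True, v) \<in> c \<Longrightarrow> w < v"
  shows "cell \<sigma> (insert (False, w) c)"
proof -
  obtain v where "(True, v) \<in> c" using cellD(3)[OF c] by blast
  then show ?thesis
    using cellD(1)[OF c] cellD(4)[OF c] cellD(5)[OF c] w by (intro cellI[of _ w v]) auto
qed

lemma cell_insert_True:
  assumes c: "cell \<sigma> c" and w: "w \<in> \<sigma>" "\<And>u. (False, u) \<in> c \<Longrightarrow> u < w"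
  shows "cell \<sigma> (insert (True, w) c)"
proof -
  obtain u where "(False, u) \<in> c" using cellD(2)[OF c] by blast
  then show ?thesis
    using cellD(1)[OF c] cellD(4)[OF c] cellD(5)[OF c] w by (intro cellI[of _ u w]) auto
qed

text \<open>Non-emptiness of the factors is inherited from the smaller set, the order condition and
  membership in \<sigma> from the larger one.\<close>

lemma cell_convex: "cell \<sigma> c \<Longrightarrow> cell \<sigma> (insert t (insert s c)) \<Longrightarrow> cell \<sigma> (insert s c)"
  unfolding cell_def by blast

lemma card_cell_ge: "cell \<sigma> c \<Longrightarrow> 2 \<le> card c"
proof -
  assume c: "cell \<sigma> c"
  then obtain u v where "{(False, u), (True, v)} \<subseteq> c" by (auto simp: cell_def)
  then show ?thesis using c card_mono[of c "{(False, u), (True, v)}"] by (simp add: cell_def)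
qed

lemma cell_card_2E:
  assumes "cell \<sigma> c" "card c = 2"
  obtains u v where "c = {(False, u), (True, v)}" "u < v" "v \<in> \<sigma>"
proof -
  obtain u v where uv: "(False, u) \<in> c" "(True, v) \<in> c" using assms by (auto simp: cell_def)
  have "{(False, u), (True, v)} = c"
    using assms uv by (intro card_subset_eq) (auto simp: cell_def)
  then show ?thesis using that[of u v] assms uv by (auto simp: cell_def)
qed

lemma cell_card_3E:
  assumes "cell \<sigma> c" "card c = 3"
  obtains (left) u u' v where "c = {(False, u), (False, u'), (True, v)}" "u < u'" "u' < v" "v \<in> \<sigma>"
  | (right) u v v' where "c = {(False, u), (True, v), (True, v')}" "u < v" "v < v'" "v \<in> \<sigma>" "v' \<in> \<sigma>"
proof -
  obtain u v where uv: "(False, u) \<in> c" "(True, v) \<in> c" using assms by (auto simp: cell_def)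
  have fin: "finite c" using assms by (simp add: cell_def)
  have "c - {(False, u), (True, v)} \<noteq> {}"
    using assms(2) card_mono[of "{(False, u), (True, v)}" c] by auto
  then obtain b x where x: "(b, x) \<in> c" "(b, x) \<noteq> (False, u)" "(b, x) \<noteq> (True, v)" by auto
  then have c: "{(False, u), (True, v), (b, x)} = c"
    using assms uv fin by (intro card_subset_eq) auto
  show ?thesis
  proof (cases b)
    case True
    then show ?thesis
      using right[of u "min v x" "max v x"] c assms(1) x uv
      by (cases "v < x") (auto simp: cell_def min_def max_def insert_commute)
  next
    case False
    then show ?thesis
      using left[of "min u x" "max u x" v] c assms(1) x uv
      by (cases "u < x") (auto simp: cell_def min_def max_def insert_commute)
  qed
qed

text \<open>Cells of size 3 are edges. Just two of their facets are cells, the end points, and these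
  get opposite signs. This is why all coefficients of the augmentation can be 1.\<close>

lemma sum_incidence_sign_card_3:
  assumes "cell \<sigma> c" "card c = 3"
  shows "(\<Sum>s | s \<in> c \<and> cell \<sigma> (c - {s}). incidence_sign s (c - {s})) = (0 :: 'k::comm_ring_1)"
  using assms
proof (cases rule: cell_card_3E)
  case (left u u' v)
  have "{s. s \<in> c \<and> cell \<sigma> (c - {s})} = {(False, u), (False, u')}"
    using left by (auto simp: cell_def)
  moreover have "c - {(False, u)} = {(False, u'), (True, v)}" "c - {(False, u')} = {(False, u), (True, v)}"
    using left by auto
  ultimately show ?thesis using left by (simp add: incidence_sign_insert) (simp add: incidence_sign_def)
next
  case (right u v v')
  have "{s. s \<in> c \<and> cell \<sigma> (c - {s})} = {(True, v), (True, v')}"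
    using right by (auto simp: cell_def)
  moreover have "c - {(True, v)} = {(False, u), (True, v')}" "c - {(True, v')} = {(False, u), (True, v)}"
    using right by auto
  ultimately show ?thesis using right by (simp add: incidence_sign_insert) (simp add: incidence_sign_def)
qed

text \<open>\<open>W\<close> will be the support of a multidegree.\<close>

abbreviation cell_in :: "nat set \<Rightarrow> nat set \<Rightarrow> (bool \<times> nat) set \<Rightarrow> bool" where
  "cell_in \<sigma> W c \<equiv> cell \<sigma> c \<and> snd ` c \<subseteq> W"

section \<open>Acyclicity of the cells inside a finite vertex set\<close>

lemma finite_cells: "finite W \<Longrightarrow> finite {c. cell_in \<sigma> W c \<and> card c = k}"
  by (rule finite_subset[of _ "Pow (UNIV \<times> W)"]) auto

text \<open>The pairs of an end point and an edge are summed by edges instead of end points; each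
  edge then contributes zero.\<close>

lemma sum_boundary_card_2:
  fixes f :: "(bool \<times> nat) set \<Rightarrow> 'k::comm_ring_1"
  assumes W: "finite W"
  shows "(\<Sum>c | cell_in \<sigma> W c \<and> card c = 2. boundary (cell_in \<sigma> W) (UNIV \<times> W) f c) = 0"
proof -
  let ?P = "cell_in \<sigma> W"
  have "(\<Sum>c | ?P c \<and> card c = 2. boundary ?P (UNIV \<times> W) f c)
      = (\<Sum>(c, s)\<in>(SIGMA c:{c. ?P c \<and> card c = 2}. {s. s \<in> UNIV \<times> W - c \<and> ?P (insert s c)}).
          incidence_sign s c * f (insert s c))"
    unfolding boundary_def using W finite_cells[OF W, of \<sigma> 2]
    by (subst sum.Sigma) (auto simp: conj_assoc)
  also have "\<dots> = (\<Sum>(c, s)\<in>(SIGMA c:{c. ?P c \<and> card c = 3}. {s. s \<in> c \<and> cell \<sigma> (c - {s})}).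
          incidence_sign s (c - {s}) * f c)"
  proof (rule sum.reindex_bij_witness[of _ "\<lambda>(c, s). (c - {s}, s)" "\<lambda>(c, s). (insert s c, s)"])
    fix x assume "x \<in> (SIGMA c:{c. ?P c \<and> card c = 2}. {s. s \<in> UNIV \<times> W - c \<and> ?P (insert s c)})"
    then obtain c s where x: "x = (c, s)" "?P c" "card c = 2" "s \<notin> c" "?P (insert s c)" by auto
    moreover from this have "finite c" "insert s c - {s} = c" by (auto simp: cell_def)
    ultimately show "(case (case x of (c, s) \<Rightarrow> (insert s c, s)) of (c, s) \<Rightarrow> (c - {s}, s)) = x"
      "(case x of (c, s) \<Rightarrow> (insert s c, s)) \<in> (SIGMA c:{c. ?P c \<and> card c = 3}. {s. s \<in> c \<and> cell \<sigma> (c - {s})})"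
      "(case (case x of (c, s) \<Rightarrow> (insert s c, s)) of (c, s) \<Rightarrow> incidence_sign s (c - {s}) * f c)
        = (case x of (c, s) \<Rightarrow> incidence_sign s c * f (insert s c))"
      by simp_all
  next
    fix x assume "x \<in> (SIGMA c:{c. ?P c \<and> card c = 3}. {s. s \<in> c \<and> cell \<sigma> (c - {s})})"
    then obtain c s where x: "x = (c, s)" "?P c" "card c = 3" "s \<in> c" "cell \<sigma> (c - {s})" by auto
    moreover from this have "finite c" "insert s (c - {s}) = c" "snd s \<in> W" "card (c - {s}) = 2"
      by (auto simp: cell_def)
    ultimately show "(case (case x of (c, s) \<Rightarrow> (c - {s}, s)) of (c, s) \<Rightarrow> (insert s c, s)) = x"
      "(case x of (c, s) \<Rightarrow> (c - {s}, s)) \<in> (SIGMA c:{c. ?P c \<and> card c = 2}. {s. s \<in> UNIV \<times> W - c \<and> ?P (insert s c)})"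
      by (auto simp: mem_Times_iff)
  qed
  also have "\<dots> = (\<Sum>c | ?P c \<and> card c = 3. \<Sum>s | s \<in> c \<and> cell \<sigma> (c - {s}). incidence_sign s (c - {s}) * f c)"
    using finite_cells[OF W, of \<sigma> 3] by (subst sum.Sigma) (auto simp: cell_def conj_assoc)
  also have "\<dots> = 0"
    by (intro sum.neutral) (auto simp: sum_incidence_sign_card_3 simp flip: sum_distrib_right)
  finally show ?thesis .
qed

lemma boundary_boundary_cells:
  fixes f :: "(bool \<times> nat) set \<Rightarrow> 'k::comm_ring_1"
  assumes W: "finite W" and c: "cell_in \<sigma> W c"
  shows "boundary (cell_in \<sigma> W) (UNIV \<times> W) (boundary (cell_in \<sigma> W) (UNIV \<times> W) f) c = 0"
proof (rule boundary_boundary[where P = "cell_in \<sigma> W", OF _ _ c])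
  fix s t assume "cell_in \<sigma> W (insert t (insert s c))"
  then show "cell_in \<sigma> W (insert s c)" using c cell_convex[of \<sigma> c t s] by auto
qed (use W c in \<open>auto simp: cellD\<close>)

text \<open>Inserting the least vertex of \<open>W\<close> into the first factor always gives a
  cell, and removing it fails only when it is the whole first factor. The cells of that kind
  correspond to the faces of a simplex of second factors, which is contracted next. For
  \<open>k = 1\<close> the condition \<open>cycle\<close> is empty, since cells have at least two
  elements, and \<open>aug\<close> takes its place.\<close>

lemma cells_exact:
  fixes f :: "(bool \<times> nat) set \<Rightarrow> 'k::comm_ring_1"
  assumes W: "finite W" and k: "1 \<le> k"
    and cycle: "\<And>c. cell_in \<sigma> W c \<Longrightarrow> card c = k \<Longrightarrow> boundary (cell_in \<sigma> W) (UNIV \<times> W) f c = 0"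
    and aug: "k = 1 \<Longrightarrow> (\<Sum>c | cell_in \<sigma> W c \<and> card c = 2. f c) = 0"
  obtains g where "\<And>c. cell_in \<sigma> W c \<Longrightarrow> card c = Suc k \<Longrightarrow> boundary (cell_in \<sigma> W) (UNIV \<times> W) g c = f c"
proof (cases "\<exists>c. cell_in \<sigma> W c")
  case False
  then show ?thesis using that by blast
next
  case True
  let ?P = "cell_in \<sigma> W" and ?S = "(UNIV :: bool set) \<times> W"
  have S: "finite ?S" using W by simp
  obtain c0 where c0: "?P c0" using True by blast
  then obtain u0 v0 where uv0: "(False, u0) \<in> c0" "(True, v0) \<in> c0" "u0 < v0" "v0 \<in> \<sigma>"
    by (auto simp: cell_def)
  then have mem: "u0 \<in> W" "v0 \<in> W" using c0 by (metis image_eqI snd_conv subsetD)+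
  \<comment> \<open>The least vertex is below the second factor of every cell in \<open>W\<close>,
    because it does not exceed the elements of the first factor.\<close>
  define w where "w = Min W"
  have w: "w \<in> W" "\<And>x. x \<in> W \<Longrightarrow> w \<le> x" using W mem by (auto simp: w_def intro: Min_in)
  have wv: "w < v0" using w(2)[OF mem(1)] uv0(3) by simp
  define a where "a = (False, w)"
  \<comment> \<open>Any vertex of a second factor serves as the second apex: once the first factor
    is \<open>{w}\<close>, the order condition only asks for \<open>w < v0\<close>.\<close>
  define b where "b = (True, v0)"
  have W_mem: "x \<in> W" if "?P c" "(i, x) \<in> c" for c i x
    using that by (metis image_eqI snd_conv subsetD)
  have coneP: "?P (insert a c)" if "?P c" for c
  proof -
    have "w < v" if "(True, v) \<in> c" for v
    proof -
      obtain u where u: "(False, u) \<in> c" using cellD(2)[of \<sigma> c] \<open>?P c\<close> by auto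
      then have "u < v" using cellD(4)[of \<sigma> c u v] \<open>?P c\<close> that by simp
      then show ?thesis using w(2)[OF W_mem[OF \<open>?P c\<close> u]] by simp
    qed
    then have "cell \<sigma> (insert a c)"
      using that unfolding a_def by (intro cell_insert_False) auto
    then show ?thesis using that w(1) by (simp add: a_def)
  qed
  have finP: "finite c" if "?P c" for c using that by (simp add: cell_def)
  obtain g1 where g1: "\<And>c. ?P c \<Longrightarrow> card c = Suc k \<Longrightarrow> a \<notin> c \<or> ?P (c - {a}) \<Longrightarrow> boundary ?P ?S g1 c = f c"
    using boundary_cone[of ?S a ?P k f] S w(1) finP coneP cycle by (auto simp: a_def)
  define f1 where "f1 = (\<lambda>c. f c - boundary ?P ?S g1 c)"
  define P1 where "P1 c \<longleftrightarrow> ?P c \<and> (\<forall>u. (False, u) \<in> c \<longleftrightarrow> u = w)" for c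
  have P1P: "P1 c \<Longrightarrow> ?P c" for c by (simp add: P1_def)
  have f1_0: "f1 c = 0" if c: "?P c" "card c = Suc k" "\<not> P1 c" for c
  proof -
    have "a \<notin> c \<or> ?P (c - {a})"
    proof (rule ccontr)
      assume *: "\<not> (a \<notin> c \<or> ?P (c - {a}))"
      then obtain u where u: "(False, u) \<in> c" "u \<noteq> w" using c(1,3) by (auto simp: P1_def a_def)
      moreover obtain v where "(True, v) \<in> c" using cellD(3) c(1) by blast
      ultimately have "cell \<sigma> (c - {a})"
        using c(1) by (intro cellI[of _ u v]) (auto simp: a_def dest: cellD)
      then show False using * c(1) by auto
    qed
    then show ?thesis using g1[OF that(1,2)] by (simp add: f1_def)
  qed
  have f1_cycle: "boundary ?P ?S f1 c = 0" if "?P c" "card c = k" for c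
  proof -
    have "boundary ?P ?S (boundary ?P ?S g1) c = 0"
      using boundary_boundary_cells[OF W] that(1) by blast
    then show ?thesis by (simp add: f1_def boundary_diff cycle[OF that])
  qed
  have b_P1: "boundary ?P ?S h c = boundary P1 ?S h c"
    if "\<And>s. s \<in> ?S - c \<Longrightarrow> ?P (insert s c) \<Longrightarrow> \<not> P1 (insert s c) \<Longrightarrow> h (insert s c) = 0" for h :: "_ \<Rightarrow> 'k" and c
    unfolding boundary_def
  proof (rule sum.mono_neutral_right)
    show "{s \<in> ?S - c. P1 (insert s c)} \<subseteq> {s \<in> ?S - c. ?P (insert s c)}"
      using P1P by blast
    show "\<forall>s\<in>{s \<in> ?S - c. ?P (insert s c)} - {s \<in> ?S - c. P1 (insert s c)}.
        incidence_sign s c * h (insert s c) = 0"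
    proof
      fix s assume "s \<in> {s \<in> ?S - c. ?P (insert s c)} - {s \<in> ?S - c. P1 (insert s c)}"
      then have "h (insert s c) = 0" by (intro that) blast+
      then show "incidence_sign s c * h (insert s c) = 0" by simp
    qed
  qed (use S in simp)
  have f1_cycle1: "boundary P1 ?S f1 c = 0" if "P1 c" "card c = k" for c
  proof -
    have "boundary P1 ?S f1 c = boundary ?P ?S f1 c"
      using f1_0 that finP[OF P1P[OF that(1)]] by (intro b_P1[symmetric]) auto
    then show ?thesis using f1_cycle P1P that by simp
  qed
  have coneP1: "P1 (insert b c)" if "P1 c" for c
    using that wv uv0(4) mem(2) cell_insert_True[of \<sigma> c v0] by (auto simp: P1_def b_def)
  obtain g2 where g2: "\<And>c. P1 c \<Longrightarrow> card c = Suc k \<Longrightarrow> b \<notin> c \<or> P1 (c - {b}) \<Longrightarrow> boundary P1 ?S g2 c = f1 c"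
    using boundary_cone[of ?S b P1 k f1] S mem(2) finP P1P coneP1 f1_cycle1 by (auto simp: b_def)
  \<comment> \<open>Extension by zero turns a chain on \<open>P1\<close> into one on all cells with
    the same boundary.\<close>
  define g3 where "g3 c = (if P1 c then g2 c else 0)" for c
  define f2 where "f2 c = f1 c - boundary ?P ?S g3 c" for c
  have g3: "boundary ?P ?S g3 c = boundary P1 ?S g2 c" for c
  proof -
    have "boundary ?P ?S g3 c = boundary P1 ?S g3 c" by (rule b_P1) (simp add: g3_def)
    also have "\<dots> = boundary P1 ?S g2 c"
      unfolding boundary_def by (intro sum.cong) (auto simp: g3_def)
    finally show ?thesis .
  qed
  have f2_0: "f2 c = 0" if c: "?P c" "card c = Suc k" "c \<noteq> {a, b}" for c
  proof (cases "P1 c")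
    case True
    have "b \<notin> c \<or> P1 (c - {b})"
    proof (rule ccontr)
      assume *: "\<not> (b \<notin> c \<or> P1 (c - {b}))"
      have "v = v0" if v: "(True, v) \<in> c" for v
      proof (rule ccontr)
        assume "v \<noteq> v0"
        then have "cell \<sigma> (c - {b})"
          using c(1) True v by (intro cellI[of _ w v]) (auto simp: P1_def b_def dest: cellD)
        then have "P1 (c - {b})" using c(1) True by (auto simp: P1_def b_def)
        then show False using * by simp
      qed
      moreover have "u = w" if "(False, u) \<in> c" for u using True that by (simp add: P1_def)
      ultimately have "x \<in> {a, b}" if "x \<in> c" for x
        using that by (cases x; cases "fst x") (auto simp: a_def b_def)
      then have "c \<subseteq> {a, b}" by blast
      moreover have "a \<in> c" using True by (simp add: P1_def a_def)
      ultimately show False using * c(3) by blast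
    qed
    then show ?thesis using g2[OF True c(2)] by (simp add: f2_def g3)
  next
    case False
    \<comment> \<open>A non-empty subset of \<open>{w}\<close> equals \<open>{w}\<close>, so a cell
      with a coface in \<open>P1\<close> lies in \<open>P1\<close> itself.\<close>
    have "\<not> P1 (insert s c)" for s
    proof
      assume s: "P1 (insert s c)"
      obtain u where u: "(False, u) \<in> c" using cellD(2) c(1) by blast
      have *: "x = w" if "(False, x) \<in> c" for x using s that unfolding P1_def by blast
      have "P1 c" unfolding P1_def using *[OF u] * u c(1) by blast
      then show False using False by simp
    qed
    then have "boundary P1 ?S g2 c = 0" by (simp add: boundary_def)
    then show ?thesis using f1_0[OF c(1,2) False] by (simp add: f2_def g3)
  qed
  have "f2 {a, b} = 0" if ab: "?P {a, b}" "card {a, b} = Suc k"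
  proof -
    have k1: "k = 1" using ab(2) by (simp add: a_def b_def)
    \<comment> \<open>Boundaries have augmentation zero, so \<open>f2\<close> inherits this from
      \<open>f\<close>. All other terms of the sum vanish by \<open>f2_0\<close>.\<close>
    have "(\<Sum>c | ?P c \<and> card c = 2. f2 c) = 0"
      unfolding f2_def f1_def sum_subtractf sum_boundary_card_2[OF W] aug[OF k1] by simp
    also have "(\<Sum>c | ?P c \<and> card c = 2. f2 c) = (\<Sum>c\<in>{{a, b}}. f2 c)"
      using f2_0 ab k1 finite_cells[OF W, of \<sigma> 2] by (intro sum.mono_neutral_right) auto
    finally show ?thesis by simp
  qed
  then have "f2 c = 0" if "?P c" "card c = Suc k" for c
    using f2_0 that by (cases "c = {a, b}") auto
  then have "boundary ?P ?S (\<lambda>c. g1 c + g3 c) c = f c" if "?P c" "card c = Suc k" for c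
    using that by (simp add: boundary_add f2_def f1_def algebra_simps)
  then show ?thesis by (rule that)
qed

subsection \<open>The cellular complex over the polynomial ring\<close>

definition cell_monomial :: "(bool \<times> nat) set \<Rightarrow> nat \<Rightarrow>\<^sub>0 nat" where
  "cell_monomial c = (\<Sum>s\<in>c. Poly_Mapping.single (snd s) 1)"

lemma cell_monomial_insert:
  "finite c \<Longrightarrow> s \<notin> c \<Longrightarrow> cell_monomial (insert s c) = Poly_Mapping.single (snd s) 1 + cell_monomial c"
  by (simp add: cell_monomial_def)

lemma mono_deg_cell_monomial: "finite c \<Longrightarrow> mono_deg (cell_monomial c) = card c"
  by (induction c rule: finite_induct) (simp_all add: cell_monomial_insert mono_deg_add, simp add: cell_monomial_def)

lemma keys_cell_monomial: "finite c \<Longrightarrow> Poly_Mapping.keys (cell_monomial c) = snd ` c"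
  by (induction c rule: finite_induct) (simp_all add: cell_monomial_insert keys_plus_nat, simp add: cell_monomial_def)

text \<open>The order condition makes the factors of a cell disjoint. Hence its monomial is
  squarefree, although an element of \<sigma> may occur in either factor.\<close>

lemma cell_snd_unique:
  assumes "cell \<sigma> c" "s \<in> c" "t \<in> c" "snd s = snd t"
  shows "s = t"
  using assms cellD(4)[OF assms(1), of "snd s" "snd s"] by (cases s; cases t; cases "fst s"; cases "fst t") auto

lemma lookup_cell_monomial:
  assumes "cell \<sigma> c"
  shows "Poly_Mapping.lookup (cell_monomial c) v = (if v \<in> snd ` c then 1 else 0)"
proof (cases "v \<in> snd ` c")
  case True
  then obtain s where s: "s \<in> c" "v = snd s" by blast
  have "Poly_Mapping.lookup (cell_monomial c) v = (\<Sum>t\<in>c. if t = s then 1 else 0)"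
    unfolding cell_monomial_def lookup_sum
    using cell_snd_unique[OF assms] s by (intro sum.cong) (auto simp: lookup_single when_def)
  then show ?thesis using True s cellD(1)[OF assms] by simp
next
  case False
  then show ?thesis using keys_cell_monomial[OF cellD(1)[OF assms]] by (metis in_keys_iff)
qed

text \<open>Subtraction of exponents is truncated at 0. As the cell monomial is squarefree, it
  divides \<mu> as soon as its vertices lie in the support.\<close>

lemma cell_monomial_diff_add:
  assumes "cell \<sigma> c" "snd ` c \<subseteq> Poly_Mapping.keys \<mu>"
  shows "\<mu> - cell_monomial c + cell_monomial c = \<mu>"
proof (rule poly_mapping_eqI)
  fix v
  have "v \<in> snd ` c \<Longrightarrow> 1 \<le> Poly_Mapping.lookup \<mu> v"
    using assms(2) by (auto simp: in_keys_iff Suc_le_eq)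
  then show "Poly_Mapping.lookup (\<mu> - cell_monomial c + cell_monomial c) v = Poly_Mapping.lookup \<mu> v"
    by (simp add: lookup_add lookup_minus lookup_cell_monomial[OF assms(1)])
qed

lemma lookup_incidence_sign_mult:
  "Poly_Mapping.lookup (incidence_sign s c * p) m = incidence_sign s c * Poly_Mapping.lookup (p :: 'k::comm_ring_1 mpoly) m"
  by (cases "even (card {t \<in> c. t < s})") (simp_all add: incidence_sign_def)

text \<open>The coefficient of \<open>F c\<close> that contributes to the multidegree \<open>\<mu>\<close>, where the basis element \<open>c\<close> has
  multidegree \<open>cell_monomial c\<close>.\<close>

definition strand :: "(nat \<Rightarrow>\<^sub>0 nat) \<Rightarrow> ((bool \<times> nat) set \<Rightarrow> 'k::comm_ring_1 mpoly) \<Rightarrow> (bool \<times> nat) set \<Rightarrow> 'k" where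
  "strand \<mu> F c = Poly_Mapping.lookup (F c) (\<mu> - cell_monomial c)"

lemma lookup_eq_strand: "Poly_Mapping.lookup (F c) m = strand (m + cell_monomial c) F c"
  by (simp add: strand_def)

lemma lookup_var_mult:
  fixes p :: "'k::comm_ring_1 mpoly"
  shows "Poly_Mapping.lookup (var v * p) (Poly_Mapping.single v 1 + m) = Poly_Mapping.lookup p m"
    "v \<notin> Poly_Mapping.keys m \<Longrightarrow> Poly_Mapping.lookup (var v * p) m = 0"
proof -
  show "Poly_Mapping.lookup (var v * p) (Poly_Mapping.single v 1 + m) = Poly_Mapping.lookup p m"
    unfolding var_def lookup_monomial_mult by simp
  assume v: "v \<notin> Poly_Mapping.keys m"
  have "m \<notin> Poly_Mapping.keys (var v * p)"
  proof
    assume "m \<in> Poly_Mapping.keys (var v * p)"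
    then obtain l where "m = Poly_Mapping.single v 1 + l"
      unfolding var_def by (rule keys_monomial_mult)
    then show False using v by (simp add: keys_plus_nat)
  qed
  then show "Poly_Mapping.lookup (var v * p) m = 0" by (simp add: in_keys_iff)
qed

lemma single_diff_add:
  assumes "v \<in> Poly_Mapping.keys m"
  shows "Poly_Mapping.single v 1 + (m - Poly_Mapping.single v 1) = (m :: nat \<Rightarrow>\<^sub>0 nat)"
  using assms by (intro poly_mapping_eqI) (auto simp: lookup_add lookup_minus lookup_single when_def in_keys_iff)

context
  fixes n :: nat and \<sigma> :: "nat set"
  assumes \<sigma>: "\<sigma> \<subseteq> {1..n}"
begin

lemma cell_snd_le: "cell \<sigma> c \<Longrightarrow> snd ` c \<subseteq> {0..n}"
proof
  fix x assume c: "cell \<sigma> c" and "x \<in> snd ` c"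
  then obtain b where x: "(b, x) \<in> c" by force
  obtain v where v: "(True, v) \<in> c" using cellD(3)[OF c] by blast
  have le: "y \<le> n" if "(True, y) \<in> c" for y using cellD(5)[OF c that] \<sigma> by auto
  show "x \<in> {0..n}"
    using cellD(4)[OF c _ v, of x] le[OF v] x le[of x] by (cases b) auto
qed

lemma finite_cells_card: "finite {c. cell \<sigma> c \<and> card c = k}"
  by (rule finite_subset[OF _ finite_cells[of "{0..n}" \<sigma> k]]) (use cell_snd_le in auto)

text \<open>The variable is the quotient of the monomials of \<open>insert s c\<close> and
  \<open>c\<close>, which makes the boundary multigraded. Chains are functions on all sets of pairs,
  of which the values on cells matter.\<close>

definition cell_map :: "((bool \<times> nat) set \<Rightarrow> 'k::comm_ring_1 mpoly) \<Rightarrow> (bool \<times> nat) set \<Rightarrow> 'k mpoly" where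
  "cell_map F c = (\<Sum>s | s \<in> UNIV \<times> {0..n} - c \<and> cell \<sigma> (insert s c).
     incidence_sign s c * (var (snd s) * F (insert s c)))"

definition cell_augmentation :: "((bool \<times> nat) set \<Rightarrow> 'k::comm_ring_1 mpoly) \<Rightarrow> 'k mpoly" where
  "cell_augmentation F = (\<Sum>c | cell \<sigma> c \<and> card c = 2. Poly_Mapping.single (cell_monomial c) 1 * F c)"

text \<open>Multiplication by the variable matches the shift between the two cell monomials. A
  coface with a vertex outside the support of \<mu> contributes nothing, because its variable does
  not divide the relevant monomial. This reduces exactness to \<open>cells_exact\<close>.\<close>

lemma strand_cell_map:
  fixes F :: "(bool \<times> nat) set \<Rightarrow> 'k::comm_ring_1 mpoly"
  assumes c: "cell_in \<sigma> (Poly_Mapping.keys \<mu>) c"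
  shows "strand \<mu> (cell_map F) c
    = boundary (cell_in \<sigma> (Poly_Mapping.keys \<mu>)) (UNIV \<times> Poly_Mapping.keys \<mu>) (strand \<mu> F) c"
proof -
  let ?K = "Poly_Mapping.keys \<mu>"
  define m where "m = \<mu> - cell_monomial c"
  have fin: "finite c" using c cellD(1) by blast
  have \<mu>: "\<mu> = m + cell_monomial c"
    using cell_monomial_diff_add[of \<sigma> c \<mu>] c by (simp add: m_def)
  have key: "Poly_Mapping.lookup (var (snd s) * F (insert s c)) m = (if snd s \<in> ?K then strand \<mu> F (insert s c) else 0)"
    if s: "s \<notin> c" "cell \<sigma> (insert s c)" for s
  proof (cases "snd s \<in> ?K")
    case True
    \<comment> \<open>The vertex is not yet used by \<open>c\<close>, so its occurrence in \<mu>
      must come from the cofactor \<open>m\<close>.\<close>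
    have "snd s \<notin> snd ` c"
      using cell_snd_unique[OF s(2), of s] s(1) by force
    then have "snd s \<in> Poly_Mapping.keys m"
      using True keys_cell_monomial[OF fin] unfolding \<mu> by (simp add: keys_plus_nat)
    then obtain m' where m': "m = Poly_Mapping.single (snd s) 1 + m'"
      using single_diff_add by metis
    have "\<mu> - cell_monomial (insert s c) = m'"
      unfolding \<mu> m' cell_monomial_insert[OF fin s(1)] by (simp add: add.commute add.left_commute)
    then show ?thesis
      using True lookup_var_mult(1)[of "snd s" "F (insert s c)" m'] by (simp add: m' strand_def)
  next
    case False
    then have "snd s \<notin> Poly_Mapping.keys m" unfolding \<mu> by (simp add: keys_plus_nat)
    then show ?thesis using False by (simp add: lookup_var_mult)
  qed
  have "strand \<mu> (cell_map F) c = (\<Sum>s | s \<in> UNIV \<times> {0..n} - c \<and> cell \<sigma> (insert s c).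
      incidence_sign s c * (if snd s \<in> ?K then strand \<mu> F (insert s c) else 0))"
    unfolding strand_def[of \<mu> "cell_map F"] m_def[symmetric] cell_map_def lookup_sum lookup_incidence_sign_mult
    by (intro sum.cong) (auto simp: key)
  also have "\<dots> = boundary (cell_in \<sigma> ?K) (UNIV \<times> ?K) (strand \<mu> F) c"
    unfolding boundary_def
  proof (rule sum.mono_neutral_cong_right)
    show "finite {s \<in> UNIV \<times> {0..n} - c. cell \<sigma> (insert s c)}"
      by (rule finite_subset[of _ "UNIV \<times> {0..n}"]) auto
    show "{s \<in> UNIV \<times> ?K - c. cell_in \<sigma> ?K (insert s c)} \<subseteq> {s \<in> UNIV \<times> {0..n} - c. cell \<sigma> (insert s c)}"
    proof
      fix s assume "s \<in> {s \<in> UNIV \<times> ?K - c. cell_in \<sigma> ?K (insert s c)}"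
      then show "s \<in> {s \<in> UNIV \<times> {0..n} - c. cell \<sigma> (insert s c)}"
        using cell_snd_le[of "insert s c"] by (auto simp: mem_Times_iff)
    qed
  qed (use c in \<open>auto simp: mem_Times_iff\<close>)
  finally show ?thesis .
qed

text \<open>An exponent \<open>m\<close> of \<open>F c\<close> belongs to the multidegree
  \<open>m + cell_monomial c\<close>, whose support contains the vertices of
  \<open>c\<close>.\<close>

lemma cell_map_eqI:
  assumes "cell \<sigma> c" "\<And>\<mu>. snd ` c \<subseteq> Poly_Mapping.keys \<mu> \<Longrightarrow> strand \<mu> F c = strand \<mu> G c"
  shows "F c = G c"
proof (rule poly_mapping_eqI)
  fix m
  show "Poly_Mapping.lookup (F c) m = Poly_Mapping.lookup (G c) m"
    unfolding lookup_eq_strand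
    using keys_cell_monomial[OF cellD(1)[OF assms(1)]] by (intro assms(2)) (simp add: keys_plus_nat)
qed

lemma lookup_cell_augmentation:
  "Poly_Mapping.lookup (cell_augmentation F) \<mu>
    = (\<Sum>c | cell_in \<sigma> (Poly_Mapping.keys \<mu>) c \<and> card c = 2. strand \<mu> F c)"
  unfolding cell_augmentation_def lookup_sum
proof (rule sum.mono_neutral_cong_right[OF finite_cells_card])
  show "\<forall>c\<in>{c. cell \<sigma> c \<and> card c = 2} - {c. cell_in \<sigma> (Poly_Mapping.keys \<mu>) c \<and> card c = 2}.
      Poly_Mapping.lookup (Poly_Mapping.single (cell_monomial c) 1 * F c) \<mu> = 0"
  proof
    fix c assume "c \<in> {c. cell \<sigma> c \<and> card c = 2} - {c. cell_in \<sigma> (Poly_Mapping.keys \<mu>) c \<and> card c = 2}"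
    then have "finite c" "\<not> snd ` c \<subseteq> Poly_Mapping.keys \<mu>" by (auto dest: cellD)
    have "\<mu> \<notin> Poly_Mapping.keys (Poly_Mapping.single (cell_monomial c) 1 * F c)"
    proof
      assume "\<mu> \<in> Poly_Mapping.keys (Poly_Mapping.single (cell_monomial c) 1 * F c)"
      then obtain l where "\<mu> = cell_monomial c + l" by (rule keys_monomial_mult)
      then show False
        using \<open>finite c\<close> \<open>\<not> snd ` c \<subseteq> Poly_Mapping.keys \<mu>\<close> by (simp add: keys_plus_nat keys_cell_monomial)
    qed
    then show "Poly_Mapping.lookup (Poly_Mapping.single (cell_monomial c) 1 * F c) \<mu> = 0"
      by (simp add: in_keys_iff)
  qed
  fix c assume "c \<in> {c. cell_in \<sigma> (Poly_Mapping.keys \<mu>) c \<and> card c = 2}"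
  then have "\<mu> - cell_monomial c + cell_monomial c = \<mu>"
    by (intro cell_monomial_diff_add) auto
  then show "Poly_Mapping.lookup (Poly_Mapping.single (cell_monomial c) 1 * F c) \<mu> = strand \<mu> F c"
    using lookup_monomial_mult[of "cell_monomial c" 1 "F c" "\<mu> - cell_monomial c"]
    by (simp add: strand_def add.commute)
qed auto

section \<open>Exactness over the polynomial ring, multidegree by multidegree\<close>

lemma cell_map_cell_map:
  assumes "cell \<sigma> c"
  shows "cell_map (cell_map F) c = 0"
proof -
  have "cell_map (cell_map F) c = (\<lambda>_. 0) c"
  proof (rule cell_map_eqI[OF assms])
    fix \<mu> :: "nat \<Rightarrow>\<^sub>0 nat" assume "snd ` c \<subseteq> Poly_Mapping.keys \<mu>"
    then have c: "cell_in \<sigma> (Poly_Mapping.keys \<mu>) c" using assms by simp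
    let ?b = "boundary (cell_in \<sigma> (Poly_Mapping.keys \<mu>)) (UNIV \<times> Poly_Mapping.keys \<mu>)"
    have "strand \<mu> (cell_map (cell_map F)) c = ?b (?b (strand \<mu> F)) c"
      unfolding strand_cell_map[OF c] unfolding boundary_def[of _ _ "strand \<mu> (cell_map F)"]
        boundary_def[of _ _ "?b (strand \<mu> F)"]
      by (intro sum.cong) (simp_all add: strand_cell_map)
    also have "\<dots> = 0" using c by (intro boundary_boundary_cells) auto
    finally show "strand \<mu> (cell_map (cell_map F)) c = strand \<mu> (\<lambda>_. 0) c" by (simp add: strand_def)
  qed
  then show ?thesis .
qed

lemma cell_augmentation_cell_map: "cell_augmentation (cell_map F) = 0"
proof (rule poly_mapping_eqI)
  fix \<mu>
  have "Poly_Mapping.lookup (cell_augmentation (cell_map F)) \<mu>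
      = (\<Sum>c | cell_in \<sigma> (Poly_Mapping.keys \<mu>) c \<and> card c = 2.
          boundary (cell_in \<sigma> (Poly_Mapping.keys \<mu>)) (UNIV \<times> Poly_Mapping.keys \<mu>) (strand \<mu> F) c)"
    unfolding lookup_cell_augmentation by (intro sum.cong) (auto simp: strand_cell_map)
  also have "\<dots> = 0" by (rule sum_boundary_card_2) simp
  finally show "Poly_Mapping.lookup (cell_augmentation (cell_map F)) \<mu> = Poly_Mapping.lookup 0 \<mu>"
    by simp
qed

text \<open>Reverses the passage to strands. Finiteness of \<open>M\<close> makes the assembled
  coefficients polynomials, and a multidegree whose support contains the cell is recovered from its
  difference with the cell monomial.\<close>

lemma assemble_strands:
  fixes g :: "(nat \<Rightarrow>\<^sub>0 nat) \<Rightarrow> (bool \<times> nat) set \<Rightarrow> 'k::comm_ring_1"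
  assumes M: "finite M" "\<And>\<mu>. \<mu> \<in> M \<Longrightarrow> Poly_Mapping.keys \<mu> \<subseteq> V"
  obtains G where "\<And>c \<mu>. cell_in \<sigma> (Poly_Mapping.keys \<mu>) c \<Longrightarrow> strand \<mu> G c = (if \<mu> \<in> M then g \<mu> c else 0)"
    "\<And>c. G c \<in> polys V"
proof -
  define G where "G c = (\<Sum>\<mu> | \<mu> \<in> M \<and> snd ` c \<subseteq> Poly_Mapping.keys \<mu>.
      Poly_Mapping.single (\<mu> - cell_monomial c) (g \<mu> c))" for c
  have "strand \<mu> G c = (if \<mu> \<in> M then g \<mu> c else 0)" if c: "cell_in \<sigma> (Poly_Mapping.keys \<mu>) c" for c \<mu>
  proof -
    have inj: "\<nu> - cell_monomial c = \<mu> - cell_monomial c \<longleftrightarrow> \<nu> = \<mu>" if "snd ` c \<subseteq> Poly_Mapping.keys \<nu>" for \<nu>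
      using that c cell_monomial_diff_add[of \<sigma> c] by metis
    have "strand \<mu> G c = (\<Sum>\<nu> | \<nu> \<in> M \<and> snd ` c \<subseteq> Poly_Mapping.keys \<nu>. if \<nu> = \<mu> then g \<nu> c else 0)"
      unfolding strand_def G_def lookup_sum
      by (intro sum.cong) (auto simp: lookup_single when_def inj)
    then show ?thesis using M(1) c by (simp add: sum.delta)
  qed
  moreover have "G c \<in> polys V" for c
    unfolding G_def
  proof (intro polys_sum polys_single)
    fix \<mu> assume "\<mu> \<in> {\<mu> \<in> M. snd ` c \<subseteq> Poly_Mapping.keys \<mu>}"
    then have "Poly_Mapping.keys \<mu> \<subseteq> V" using M(2) by blast
    moreover have "Poly_Mapping.keys (\<mu> - cell_monomial c) \<subseteq> Poly_Mapping.keys \<mu>"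
      by (auto simp: in_keys_iff lookup_minus)
    ultimately show "Poly_Mapping.keys (\<mu> - cell_monomial c) \<subseteq> V" by simp
  qed
  ultimately show ?thesis by (rule that)
qed

lemma cell_map_exact:
  fixes F :: "(bool \<times> nat) set \<Rightarrow> 'k::comm_ring_1 mpoly"
  assumes k: "1 \<le> k" and F: "\<And>c. cell \<sigma> c \<Longrightarrow> card c = Suc k \<Longrightarrow> F c \<in> polys {0..n}"
    and cycle: "\<And>c. cell \<sigma> c \<Longrightarrow> card c = k \<Longrightarrow> cell_map F c = 0"
    and aug: "k = 1 \<Longrightarrow> cell_augmentation F = 0"
  obtains G where "\<And>c. cell \<sigma> c \<Longrightarrow> card c = Suc k \<Longrightarrow> cell_map G c = F c" "\<And>c. G c \<in> polys {0..n}"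
proof -
  \<comment> \<open>The multidegrees in which \<open>F\<close> has a nonzero coefficient on cells of
    size \<open>Suc k\<close>. Elsewhere the preimage is taken to be zero, which leaves finitely
    many strands to assemble.\<close>
  define M where "M = (\<Union>c\<in>{c. cell \<sigma> c \<and> card c = Suc k}. (\<lambda>m. m + cell_monomial c) ` Poly_Mapping.keys (F c))"
  have M: "finite M" unfolding M_def by (intro finite_UN_I finite_cells_card finite_imageI finite_keys)
  have MV: "Poly_Mapping.keys \<mu> \<subseteq> {0..n}" if \<mu>: "\<mu> \<in> M" for \<mu>
  proof -
    obtain c m where c: "cell \<sigma> c" "card c = Suc k" "m \<in> Poly_Mapping.keys (F c)" "\<mu> = m + cell_monomial c"
      using \<mu> by (auto simp: M_def)
    then show ?thesis
      using F[OF c(1,2)] cell_snd_le[OF c(1)] keys_cell_monomial[OF cellD(1)[OF c(1)]]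
      by (auto simp: keys_plus_nat in_polys_iff)
  qed
  have "\<exists>g. \<forall>c. cell_in \<sigma> (Poly_Mapping.keys \<mu>) c \<longrightarrow> card c = Suc k \<longrightarrow>
      boundary (cell_in \<sigma> (Poly_Mapping.keys \<mu>)) (UNIV \<times> Poly_Mapping.keys \<mu>) g c = strand \<mu> F c" for \<mu>
  proof -
    have cyc: "boundary (cell_in \<sigma> (Poly_Mapping.keys \<mu>)) (UNIV \<times> Poly_Mapping.keys \<mu>) (strand \<mu> F) c = 0"
      if "cell_in \<sigma> (Poly_Mapping.keys \<mu>) c" "card c = k" for c
      using cycle[of c] that by (simp add: strand_cell_map[symmetric]) (simp add: strand_def)
    have aug': "(\<Sum>c | cell_in \<sigma> (Poly_Mapping.keys \<mu>) c \<and> card c = 2. strand \<mu> F c) = 0" if "k = 1"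
      unfolding lookup_cell_augmentation[symmetric] aug[OF that] by simp
    show ?thesis by (rule cells_exact[OF finite_keys k cyc aug']) blast+
  qed
  then have "\<exists>g. \<forall>\<mu> c. cell_in \<sigma> (Poly_Mapping.keys \<mu>) c \<longrightarrow> card c = Suc k \<longrightarrow>
      boundary (cell_in \<sigma> (Poly_Mapping.keys \<mu>)) (UNIV \<times> Poly_Mapping.keys \<mu>) (g \<mu>) c = strand \<mu> F c"
    by (rule choice[OF allI])
  then obtain g where g: "\<And>\<mu> c. cell_in \<sigma> (Poly_Mapping.keys \<mu>) c \<Longrightarrow> card c = Suc k \<Longrightarrow>
      boundary (cell_in \<sigma> (Poly_Mapping.keys \<mu>)) (UNIV \<times> Poly_Mapping.keys \<mu>) (g \<mu>) c = strand \<mu> F c"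
    by auto
  obtain G where G: "\<And>c \<mu>. cell_in \<sigma> (Poly_Mapping.keys \<mu>) c \<Longrightarrow> strand \<mu> G c = (if \<mu> \<in> M then g \<mu> c else 0)"
    and GV: "\<And>c. G c \<in> polys {0..n}"
    using assemble_strands[OF M MV, where g = g] by blast
  have "cell_map G c = F c" if c: "cell \<sigma> c" "card c = Suc k" for c
  proof (rule cell_map_eqI[OF c(1)])
    fix \<mu> :: "nat \<Rightarrow>\<^sub>0 nat" assume "snd ` c \<subseteq> Poly_Mapping.keys \<mu>"
    then have c': "cell_in \<sigma> (Poly_Mapping.keys \<mu>) c" using c by simp
    have *: "strand \<mu> (cell_map G) c = (\<Sum>s | s \<in> UNIV \<times> Poly_Mapping.keys \<mu> - c \<and> cell_in \<sigma> (Poly_Mapping.keys \<mu>) (insert s c).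
        incidence_sign s c * (if \<mu> \<in> M then g \<mu> (insert s c) else 0))"
      unfolding strand_cell_map[OF c'] boundary_def by (intro sum.cong) (auto simp: G)
    show "strand \<mu> (cell_map G) c = strand \<mu> F c"
    proof (cases "\<mu> \<in> M")
      case True
      then show ?thesis using g[OF c' c(2)] * by (simp add: boundary_def)
    next
      case False
      have "\<mu> - cell_monomial c \<notin> Poly_Mapping.keys (F c)"
        using False c c' cell_monomial_diff_add[of \<sigma> c \<mu>] unfolding M_def by force
      then show ?thesis using False * by (simp add: strand_def in_keys_iff)
    qed
  qed
  then show ?thesis using GV by (rule that)
qed

text \<open>Each monomial of \<open>p\<close> is divisible by the monomial of a chosen point
  \<open>ch\<close>, and its whole coefficient is placed there.\<close>

lemma cell_augmentation_surj:
  fixes p :: "'k::comm_ring_1 mpoly"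
  assumes p: "p \<in> polys {0..n}"
    and cells: "\<And>m. m \<in> Poly_Mapping.keys p \<Longrightarrow> \<exists>c. cell_in \<sigma> (Poly_Mapping.keys m) c \<and> card c = 2"
  obtains F where "cell_augmentation F = p" "\<And>c. F c \<in> polys {0..n}"
proof -
  obtain ch where ch: "\<And>m. m \<in> Poly_Mapping.keys p \<Longrightarrow> cell_in \<sigma> (Poly_Mapping.keys m) (ch m) \<and> card (ch m) = 2"
    using cells by metis
  have V: "Poly_Mapping.keys \<mu> \<subseteq> {0..n}" if "\<mu> \<in> Poly_Mapping.keys p" for \<mu>
    using p that by (auto simp: in_polys_iff)
  obtain F :: "_ \<Rightarrow> 'k mpoly" where F: "\<And>c \<mu>. cell_in \<sigma> (Poly_Mapping.keys \<mu>) c \<Longrightarrow>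
      strand \<mu> F c = (if \<mu> \<in> Poly_Mapping.keys p then if c = ch \<mu> then Poly_Mapping.lookup p \<mu> else 0 else 0)"
    and FV: "\<And>c. F c \<in> polys {0..n}"
    using assemble_strands[OF finite_keys V, of p "\<lambda>\<mu> c. if c = ch \<mu> then Poly_Mapping.lookup p \<mu> else 0"]
    by metis
  have "cell_augmentation F = p"
  proof (rule poly_mapping_eqI)
    fix \<mu>
    have "Poly_Mapping.lookup (cell_augmentation F) \<mu> = (\<Sum>c | cell_in \<sigma> (Poly_Mapping.keys \<mu>) c \<and> card c = 2.
        if \<mu> \<in> Poly_Mapping.keys p then if c = ch \<mu> then Poly_Mapping.lookup p \<mu> else 0 else 0)"
      unfolding lookup_cell_augmentation by (intro sum.cong) (auto simp: F)
    also have "\<dots> = Poly_Mapping.lookup p \<mu>"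
    proof (cases "\<mu> \<in> Poly_Mapping.keys p")
      case True
      then show ?thesis using ch[OF True] finite_cells[of "Poly_Mapping.keys \<mu>" \<sigma> 2] by (simp add: sum.delta)
    next
      case False
      then show ?thesis by (simp add: in_keys_iff)
    qed
    finally show "Poly_Mapping.lookup (cell_augmentation F) \<mu> = Poly_Mapping.lookup p \<mu>" .
  qed
  then show ?thesis using FV by (rule that)
qed

end

subsection \<open>Ideals of threshold graphs\<close>

lemma verts_threshold_graph [simp]: "verts (threshold_graph n \<sigma>) = {0..n}"
  by (simp add: threshold_graph_def)

lemma edge_threshold_graph_iff:
  "u < v \<Longrightarrow> {u, v} \<in> edges (threshold_graph n \<sigma>) \<longleftrightarrow> v \<le> n \<and> v \<notin> \<sigma>"
  by (auto simp: threshold_graph_def doubleton_eq_iff)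

text \<open>A monomial ideal contains with a polynomial all its monomials, so membership means that
  a generator divides each of them. Homogeneity of the ideal is read off from this form.\<close>

lemma nonedge_ideal_threshold_graph:
  assumes \<sigma>: "\<sigma> \<subseteq> {1..n}"
  shows "(nonedge_ideal (threshold_graph n \<sigma>) :: 'k::comm_ring_1 mpoly set) =
    {p \<in> polys {0..n}. \<forall>m\<in>Poly_Mapping.keys p. \<exists>u v. u < v \<and> v \<in> \<sigma> \<and> u \<in> Poly_Mapping.keys m \<and> v \<in> Poly_Mapping.keys m}"
    (is "?I = ?J")
proof
  let ?R = "poly_ring {0..n} :: 'k mpoly ring"
  let ?gens = "{var u * var v :: 'k mpoly | u v. u \<in> {0..n} \<and> v \<in> {0..n} \<and> u \<noteq> v \<and> {u, v} \<notin> edges (threshold_graph n \<sigma>)}"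
  have I: "?I = genideal ?R ?gens"
    by (simp add: nonedge_ideal_def)
  have gens_polys: "?gens \<subseteq> polys {0..n}" by (auto intro!: polys_mult polys_var)
  have vv: "var u * var v = (Poly_Mapping.single (Poly_Mapping.single u 1 + Poly_Mapping.single v 1) 1 :: 'k mpoly)" for u v
    by (simp add: var_def mult_single)
  show "?I \<subseteq> ?J"
    unfolding I
  proof (rule ring.genideal_minimal[OF ring_poly_ring])
    show "ideal ?J ?R"
    proof (rule idealI_polys)
      fix p q :: "'k mpoly" assume "p \<in> ?J" "q \<in> ?J"
      then show "p + q \<in> ?J" using keys_add[of p q] by (auto intro: polys_add)
    next
      fix p q :: "'k mpoly" assume p: "p \<in> ?J" and q: "q \<in> polys {0..n}"
      have "\<exists>u v. u < v \<and> v \<in> \<sigma> \<and> u \<in> Poly_Mapping.keys m \<and> v \<in> Poly_Mapping.keys m"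
        if "m \<in> Poly_Mapping.keys (q * p)" for m
      proof -
        obtain a b where "m = a + b" "b \<in> Poly_Mapping.keys p"
          using subsetD[OF keys_mult \<open>m \<in> Poly_Mapping.keys (q * p)\<close>] by blast
        then show ?thesis using p by (fastforce simp: keys_plus_nat)
      qed
      then show "q * p \<in> ?J" using p q by (simp add: polys_mult)
    qed auto
    have "var u * var v \<in> ?J" if "u < v" "v \<le> n" "{u, v} \<notin> edges (threshold_graph n \<sigma>)" for u v
    proof -
      have v: "v \<in> \<sigma>" using edge_threshold_graph_iff[OF that(1)] that by blast
      have "var u * var v \<in> polys {0..n}" using that by (intro polys_mult polys_var) auto
      moreover have "Poly_Mapping.keys (var u * var v :: 'k mpoly) = {Poly_Mapping.single u 1 + Poly_Mapping.single v 1}"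
        unfolding vv by simp
      moreover have "Poly_Mapping.keys (Poly_Mapping.single u 1 + Poly_Mapping.single v 1 :: nat \<Rightarrow>\<^sub>0 nat) = {u, v}"
        by (auto simp: keys_plus_nat)
      ultimately show ?thesis using v that(1) by auto
    qed
    note * = this
    show "?gens \<subseteq> ?J"
    proof
      fix p assume "p \<in> ?gens"
      then obtain u v where uv: "p = var u * var v" "u \<le> n" "v \<le> n" "u \<noteq> v" "{u, v} \<notin> edges (threshold_graph n \<sigma>)"
        by auto
      show "p \<in> ?J"
      proof (cases "u < v")
        case True
        then show ?thesis using *[of u v] uv by simp
      next
        case False
        then have "v < u" using uv(4) by simp
        moreover have "{v, u} \<notin> edges (threshold_graph n \<sigma>)" using uv(5) by (metis insert_commute)
        ultimately have "var v * var u \<in> ?J" using *[of v u] uv(2) by blast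
        then show ?thesis by (subst uv(1), subst mult.commute)
      qed
    qed
  qed
  show "?J \<subseteq> ?I"
  proof
    fix p assume p: "p \<in> ?J"
    have id: "ideal ?I ?R" unfolding I by (rule ring.genideal_ideal[OF ring_poly_ring gens_polys])
    have "Poly_Mapping.single m (Poly_Mapping.lookup p m) \<in> ?I" if m: "m \<in> Poly_Mapping.keys p" for m
    proof -
      obtain u v where uv: "u < v" "v \<in> \<sigma>" "u \<in> Poly_Mapping.keys m" "v \<in> Poly_Mapping.keys m"
        using p m by blast
      have mn: "Poly_Mapping.keys m \<subseteq> {0..n}" using p m by (auto simp: in_polys_iff)
      define l where "l = m - Poly_Mapping.single u 1 - Poly_Mapping.single v 1"
      have "v \<in> Poly_Mapping.keys (m - Poly_Mapping.single u 1)"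
        using uv by (auto simp: in_keys_iff lookup_minus lookup_single when_def)
      then have ml: "m = l + (Poly_Mapping.single u 1 + Poly_Mapping.single v 1)"
        using single_diff_add[OF uv(3)] single_diff_add[of v "m - Poly_Mapping.single u 1"]
        unfolding l_def by (metis add.assoc add.commute)
      have "Poly_Mapping.single m (Poly_Mapping.lookup p m) = Poly_Mapping.single l (Poly_Mapping.lookup p m) * (var u * var v)"
        unfolding vv mult_single ml[symmetric] by simp
      moreover have "var u * var v \<in> ?I"
      proof -
        have "{u, v} \<notin> edges (threshold_graph n \<sigma>)" using edge_threshold_graph_iff[OF uv(1)] uv(2) by blast
        moreover have "u \<in> {0..n}" "v \<in> {0..n}" "u \<noteq> v" using uv mn by auto
        ultimately have "var u * var v \<in> ?gens" by blast
        then show ?thesis unfolding I using ring.genideal_self[OF ring_poly_ring gens_polys] by blast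
      qed
      moreover have "Poly_Mapping.single l (Poly_Mapping.lookup p m) \<in> polys {0..n}"
        using mn by (intro polys_single) (subst (asm) ml, simp add: keys_plus_nat)
      ultimately show ?thesis using ideal_polys(4)[OF id] by simp
    qed
    then show "p \<in> ?I"
      by (subst poly_mapping_sum_single[of p]) (rule ideal_polys(7)[OF id])
  qed
qed

lemma nonedge_ideal_threshold_graph_cells:
  assumes \<sigma>: "\<sigma> \<subseteq> {1..n}"
  shows "(nonedge_ideal (threshold_graph n \<sigma>) :: 'k::comm_ring_1 mpoly set) =
    {p \<in> polys {0..n}. \<forall>m\<in>Poly_Mapping.keys p. \<exists>c. cell_in \<sigma> (Poly_Mapping.keys m) c \<and> card c = 2}"
proof -
  have "(\<exists>u v. u < v \<and> v \<in> \<sigma> \<and> u \<in> W \<and> v \<in> W) \<longleftrightarrow> (\<exists>c. cell_in \<sigma> W c \<and> card c = 2)" for W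
  proof
    assume "\<exists>u v. u < v \<and> v \<in> \<sigma> \<and> u \<in> W \<and> v \<in> W"
    then obtain u v where uv: "u < v" "v \<in> \<sigma>" "u \<in> W" "v \<in> W" by blast
    then have "cell \<sigma> {(False, u), (True, v)}" by (intro cellI[of _ u v]) auto
    then show "\<exists>c. cell_in \<sigma> W c \<and> card c = 2"
      using uv by (intro exI[of _ "{(False, u), (True, v)}"]) auto
  next
    assume "\<exists>c. cell_in \<sigma> W c \<and> card c = 2"
    then obtain c where c: "cell \<sigma> c" "snd ` c \<subseteq> W" "card c = 2" by blast
    obtain u v where "c = {(False, u), (True, v)}" "u < v" "v \<in> \<sigma>" by (rule cell_card_2E[OF c(1,3)])
    then show "\<exists>u v. u < v \<and> v \<in> \<sigma> \<and> u \<in> W \<and> v \<in> W" using c(2) by auto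
  qed
  then show ?thesis by (simp add: nonedge_ideal_threshold_graph[OF \<sigma>])
qed

subsection \<open>The minimal resolution\<close>

text \<open>Any enumeration will do; it only fixes the positions of rows and columns in the
  matrices.\<close>

definition cell_list :: "nat set \<Rightarrow> nat \<Rightarrow> (bool \<times> nat) set list" where
  "cell_list \<sigma> k = (SOME cs. distinct cs \<and> set cs = {c. cell \<sigma> c \<and> card c = k})"

definition cell_vec :: "nat set \<Rightarrow> nat \<Rightarrow> ((bool \<times> nat) set \<Rightarrow> 'a) \<Rightarrow> 'a vec" where
  "cell_vec \<sigma> k F = vec (length (cell_list \<sigma> k)) (\<lambda>b. F (cell_list \<sigma> k ! b))"

text \<open>At most one \<open>s\<close> qualifies. The sum serves as a case distinction with value
  0 when \<open>c'\<close> does not arise from \<open>c\<close> by one insertion.\<close>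

definition cell_entry :: "nat \<Rightarrow> (bool \<times> nat) set \<Rightarrow> (bool \<times> nat) set \<Rightarrow> 'k::comm_ring_1 mpoly" where
  "cell_entry n c c' = (\<Sum>s | s \<in> UNIV \<times> {0..n} - c \<and> insert s c = c'. incidence_sign s c * var (snd s))"

text \<open>For positive \<open>i\<close>, position \<open>i\<close> is spanned by the cells of size
  \<open>Suc i\<close>, all in degree \<open>Suc i\<close>. Position 0 is the ring itself, since
  there are no cells of size 1.\<close>

definition resolution_degrees :: "nat set \<Rightarrow> nat \<Rightarrow> nat list" where
  "resolution_degrees \<sigma> i = (if i = 0 then [0] else replicate (length (cell_list \<sigma> (Suc i))) (Suc i))"

definition resolution_map :: "nat \<Rightarrow> nat set \<Rightarrow> nat \<Rightarrow> 'k::comm_ring_1 mpoly mat" where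
  "resolution_map n \<sigma> i =
     (if i = 0 then mat 1 (length (cell_list \<sigma> 2)) (\<lambda>(a, b). Poly_Mapping.single (cell_monomial (cell_list \<sigma> 2 ! b)) 1)
      else mat (length (cell_list \<sigma> (Suc i))) (length (cell_list \<sigma> (Suc (Suc i))))
        (\<lambda>(a, b). cell_entry n (cell_list \<sigma> (Suc i) ! a) (cell_list \<sigma> (Suc (Suc i)) ! b)))"

context
  fixes n :: nat and \<sigma> :: "nat set"
  assumes \<sigma>: "\<sigma> \<subseteq> {1..n}"
begin

lemma cell_list: "distinct (cell_list \<sigma> k)" "set (cell_list \<sigma> k) = {c. cell \<sigma> c \<and> card c = k}"
proof -
  have "\<exists>cs. distinct cs \<and> set cs = {c. cell \<sigma> c \<and> card c = k}"
    using finite_distinct_list[OF finite_cells_card[OF \<sigma>]] by blast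
  from someI_ex[OF this] show "distinct (cell_list \<sigma> k)" "set (cell_list \<sigma> k) = {c. cell \<sigma> c \<and> card c = k}"
    by (simp_all add: cell_list_def)
qed

lemma cell_list_nth: "b < length (cell_list \<sigma> k) \<Longrightarrow> cell \<sigma> (cell_list \<sigma> k ! b) \<and> card (cell_list \<sigma> k ! b) = k"
  using cell_list(2)[of k] nth_mem by blast

lemma sum_cell_list:
  "(\<Sum>b<length (cell_list \<sigma> k). h (cell_list \<sigma> k ! b)) = (\<Sum>c | cell \<sigma> c \<and> card c = k. h c)"
  using sum.reindex_bij_betw[OF bij_betw_nth[OF cell_list(1) refl refl], of h k] cell_list(2) by simp

lemma cell_vec_eq_iff: "cell_vec \<sigma> k F = cell_vec \<sigma> k G \<longleftrightarrow> (\<forall>c. cell \<sigma> c \<longrightarrow> card c = k \<longrightarrow> F c = G c)"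
proof
  assume eq: "cell_vec \<sigma> k F = cell_vec \<sigma> k G"
  have "F c = G c" if c: "cell \<sigma> c" "card c = k" for c
  proof -
    have "c \<in> set (cell_list \<sigma> k)" using c cell_list(2) by blast
    then obtain b where "b < length (cell_list \<sigma> k)" "cell_list \<sigma> k ! b = c" by (auto simp: in_set_conv_nth)
    then show ?thesis using arg_cong[OF eq, of "\<lambda>v. v $ b"] by (simp add: cell_vec_def)
  qed
  then show "\<forall>c. cell \<sigma> c \<longrightarrow> card c = k \<longrightarrow> F c = G c" by blast
next
  assume "\<forall>c. cell \<sigma> c \<longrightarrow> card c = k \<longrightarrow> F c = G c"
  then show "cell_vec \<sigma> k F = cell_vec \<sigma> k G"
    using cell_list_nth by (intro eq_vecI) (auto simp: cell_vec_def)
qed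

lemma cell_vec_zero: "0\<^sub>v (length (cell_list \<sigma> k)) = cell_vec \<sigma> k (\<lambda>_. 0)"
  by (auto simp: cell_vec_def)

lemma free_elems_resolution_degrees:
  "free_elems V (resolution_degrees \<sigma> (Suc i)) = {cell_vec \<sigma> (Suc (Suc i)) F | F. \<forall>c. F c \<in> polys V}" (is "?l = ?r")
proof
  let ?cs = "cell_list \<sigma> (Suc (Suc i))"
  show "?l \<subseteq> ?r"
  proof
    fix f assume "f \<in> ?l"
    then have f: "f \<in> carrier_vec (length ?cs)" "\<And>b. b < length ?cs \<Longrightarrow> f $ b \<in> polys V"
      by (auto simp: in_free_elems_iff resolution_degrees_def)
    \<comment> \<open>The value 0 off the list keeps all values in the polynomial ring.\<close>
    define F where "F c = (if c \<in> set ?cs then f $ the_inv_into {..<length ?cs} (nth ?cs) c else 0)" for c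
    have inj: "inj_on (nth ?cs) {..<length ?cs}" using cell_list(1) by (simp add: inj_on_nth)
    have "the_inv_into {..<length ?cs} (nth ?cs) c < length ?cs" if "c \<in> set ?cs" for c
      using the_inv_into_into[OF inj, of c "{..<length ?cs}"] that by (auto simp: in_set_conv_nth)
    then have "F c \<in> polys V" for c using f(2) by (simp add: F_def)
    moreover have "f = cell_vec \<sigma> (Suc (Suc i)) F"
      using f(1) the_inv_into_f_f[OF inj] by (intro eq_vecI) (auto simp: cell_vec_def F_def)
    ultimately show "f \<in> ?r" by blast
  qed
qed (auto simp: in_free_elems_iff resolution_degrees_def cell_vec_def)

lemma cell_map_eq_sum:
  assumes c: "cell \<sigma> c" "card c = k"
  shows "cell_map n \<sigma> F c = (\<Sum>c' | cell \<sigma> c' \<and> card c' = Suc k. cell_entry n c c' * F c')"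
proof -
  let ?S = "UNIV \<times> {0..n} - c" and ?C = "{c'. cell \<sigma> c' \<and> card c' = Suc k}"
  have S: "finite ?S" by simp
  have "(\<Sum>c'\<in>?C. cell_entry n c c' * F c')
      = (\<Sum>c'\<in>?C. \<Sum>s\<in>?S. if insert s c = c' then incidence_sign s c * (var (snd s) * F (insert s c)) else 0)"
    unfolding cell_entry_def sum_distrib_right using S
    by (intro sum.cong refl sum.mono_neutral_cong_left) (auto simp: mult.assoc)
  also have "\<dots> = (\<Sum>s\<in>?S. \<Sum>c'\<in>?C. if insert s c = c' then incidence_sign s c * (var (snd s) * F (insert s c)) else 0)"
    by (rule sum.swap)
  also have "\<dots> = (\<Sum>s\<in>?S. if insert s c \<in> ?C then incidence_sign s c * (var (snd s) * F (insert s c)) else 0)"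
    using finite_cells_card[OF \<sigma>, of "Suc k"] by (intro sum.cong refl) (simp add: sum.delta')
  also have "\<dots> = cell_map n \<sigma> F c"
    unfolding cell_map_def[OF \<sigma>] using S cellD(1)[OF c(1)] c(2)
    by (intro sum.mono_neutral_cong_right) auto
  finally show ?thesis by simp
qed

lemma resolution_map_Suc_mult:
  "resolution_map n \<sigma> (Suc i) *\<^sub>v cell_vec \<sigma> (Suc (Suc (Suc i))) F = cell_vec \<sigma> (Suc (Suc i)) (cell_map n \<sigma> F)"
proof (rule eq_vecI)
  let ?cs = "cell_list \<sigma> (Suc (Suc i))" and ?ds = "cell_list \<sigma> (Suc (Suc (Suc i)))"
  fix a assume "a < dim_vec (cell_vec \<sigma> (Suc (Suc i)) (cell_map n \<sigma> F))"
  then have a: "a < length ?cs" by (simp add: cell_vec_def)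
  have M: "resolution_map n \<sigma> (Suc i) \<in> carrier_mat (length ?cs) (length ?ds)"
    by (simp add: resolution_map_def)
  have "cell_vec \<sigma> (Suc (Suc (Suc i))) F \<in> carrier_vec (length ?ds)" by (simp add: cell_vec_def)
  from index_mult_mat_vec_sum[OF M this a]
  have "(resolution_map n \<sigma> (Suc i) *\<^sub>v cell_vec \<sigma> (Suc (Suc (Suc i))) F) $ a
      = (\<Sum>b<length ?ds. cell_entry n (?cs ! a) (?ds ! b) * F (?ds ! b))"
    using a by (simp add: resolution_map_def cell_vec_def)
  also have "\<dots> = cell_map n \<sigma> F (?cs ! a)"
    using cell_list_nth[OF a] by (simp add: sum_cell_list[of "\<lambda>c. cell_entry n (?cs ! a) c * F c"] cell_map_eq_sum)
  finally show "(resolution_map n \<sigma> (Suc i) *\<^sub>v cell_vec \<sigma> (Suc (Suc (Suc i))) F) $ a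
      = cell_vec \<sigma> (Suc (Suc i)) (cell_map n \<sigma> F) $ a"
    using a by (simp add: cell_vec_def)
qed (simp add: resolution_map_def cell_vec_def)

lemma resolution_map_0_mult:
  "resolution_map n \<sigma> 0 *\<^sub>v cell_vec \<sigma> (Suc (Suc 0)) F = vec 1 (\<lambda>_. cell_augmentation \<sigma> F)"
proof (rule eq_vecI)
  let ?ds = "cell_list \<sigma> 2"
  fix a assume "a < dim_vec (vec 1 (\<lambda>_. cell_augmentation \<sigma> F))"
  then have a: "a = 0" by simp
  have M: "resolution_map n \<sigma> 0 \<in> carrier_mat (Suc 0) (length ?ds)"
    by (simp add: resolution_map_def)
  have "cell_vec \<sigma> (Suc (Suc 0)) F \<in> carrier_vec (length ?ds)" by (simp add: cell_vec_def numeral_2_eq_2)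
  from index_mult_mat_vec_sum[OF M this lessI]
  have "(resolution_map n \<sigma> 0 *\<^sub>v cell_vec \<sigma> (Suc (Suc 0)) F) $ 0
      = (\<Sum>b<length ?ds. Poly_Mapping.single (cell_monomial (?ds ! b)) 1 * F (?ds ! b))"
    by (simp add: resolution_map_def cell_vec_def numeral_2_eq_2)
  also have "\<dots> = cell_augmentation \<sigma> F"
    unfolding sum_cell_list[of "\<lambda>c. Poly_Mapping.single (cell_monomial c) 1 * F c"] cell_augmentation_def[OF \<sigma>] ..
  finally show "(resolution_map n \<sigma> 0 *\<^sub>v cell_vec \<sigma> (Suc (Suc 0)) F) $ a = vec 1 (\<lambda>_. cell_augmentation \<sigma> F) $ a"
    by (simp add: a)
qed (simp add: resolution_map_def)

lemma resolution_map_graded: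
  "(resolution_map n \<sigma> i :: 'k::comm_ring_1 mpoly mat)
    \<in> graded_mats {0..n} (resolution_degrees \<sigma> i) (resolution_degrees \<sigma> (Suc i))"
proof (cases i)
  case 0
  have "Poly_Mapping.keys (cell_monomial (cell_list \<sigma> 2 ! b)) \<subseteq> {0..n} \<and> mono_deg (cell_monomial (cell_list \<sigma> 2 ! b)) = 2"
    if "b < length (cell_list \<sigma> 2)" for b
    using cell_list_nth[OF that] keys_cell_monomial mono_deg_cell_monomial cell_snd_le[OF \<sigma>] cellD(1) by metis
  then show ?thesis
    by (auto simp: graded_mats_def resolution_map_def resolution_degrees_def 0 in_polys_iff numeral_2_eq_2)
next
  case (Suc j)
  have "cell_entry n c c' \<in> polys {0..n}" for c c'
    unfolding cell_entry_def incidence_sign_def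
    by (intro polys_sum polys_mult polys_var) (auto simp: minus_one_power_iff intro: polys_uminus)
  moreover have "mono_deg m = 1" if m: "m \<in> Poly_Mapping.keys (cell_entry n c c' :: 'k mpoly)" for c c' m
  proof -
    have "m \<in> (\<Union>s\<in>{s. s \<in> UNIV \<times> {0..n} - c \<and> insert s c = c'}.
        Poly_Mapping.keys (incidence_sign s c * var (snd s) :: 'k mpoly))"
      using m unfolding cell_entry_def by (rule subsetD[OF keys_sum])
    then obtain s where "Poly_Mapping.lookup (incidence_sign s c * var (snd s) :: 'k mpoly) m \<noteq> 0"
      by (auto simp: in_keys_iff)
    then have "Poly_Mapping.lookup (var (snd s) :: 'k mpoly) m \<noteq> 0"
      unfolding lookup_incidence_sign_mult by auto
    then show ?thesis by (auto simp: var_def lookup_single when_def split: if_splits)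
  qed
  ultimately show ?thesis
    by (auto simp: graded_mats_def resolution_map_def resolution_degrees_def Suc)
qed

lemma resolution_map_minimal:
  assumes "a < length (resolution_degrees \<sigma> i)" "b < length (resolution_degrees \<sigma> (Suc i))"
  shows "(resolution_map n \<sigma> i :: 'k::comm_ring_1 mpoly mat) $$ (a, b) \<in> irrelevant_ideal {0..n}"
proof (cases i)
  case 0
  note irr = irrelevant_ideal_ideal[of "{0..n}", where 'k = 'k]
  have b: "b < length (cell_list \<sigma> 2)" using assms 0 by (simp add: resolution_degrees_def numeral_2_eq_2)
  have c: "cell \<sigma> (cell_list \<sigma> 2 ! b)" "card (cell_list \<sigma> 2 ! b) = 2" using cell_list_nth[OF b] by auto
  obtain u v where uv: "cell_list \<sigma> 2 ! b = {(False, u), (True, v)}" "u < v" "v \<in> \<sigma>"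
    by (rule cell_card_2E[OF c])
  have "Poly_Mapping.single (cell_monomial (cell_list \<sigma> 2 ! b)) 1 = (var u * var v :: 'k mpoly)"
    by (simp add: uv(1) cell_monomial_def var_def mult_single)
  moreover have "v \<in> {0..n}" "u \<in> {0..n}" using uv \<sigma> by fastforce+
  ultimately have "Poly_Mapping.single (cell_monomial (cell_list \<sigma> 2 ! b)) (1 :: 'k) \<in> irrelevant_ideal {0..n}"
    using ideal_polys(4)[OF irr var_in_irrelevant_ideal[of v] polys_var[of u]] by simp
  then show ?thesis using assms b 0 by (simp add: resolution_map_def resolution_degrees_def)
next
  case (Suc j)
  have "(cell_entry n c c' :: 'k mpoly) \<in> irrelevant_ideal {0..n}" for c c'
    unfolding cell_entry_def
  proof (rule ideal_polys(7)[OF irrelevant_ideal_ideal])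
    fix s assume "s \<in> {s. s \<in> UNIV \<times> {0..n} - c \<and> insert s c = c'}"
    then have s: "snd s \<in> {0..n}" by (simp add: mem_Times_iff)
    have "(var (snd s) :: 'k mpoly) \<in> irrelevant_ideal {0..n}" by (rule var_in_irrelevant_ideal[OF s])
    then show "(incidence_sign s c * var (snd s) :: 'k mpoly) \<in> irrelevant_ideal {0..n}"
      by (auto simp: incidence_sign_def minus_one_power_iff intro: ideal_polys(5)[OF irrelevant_ideal_ideal])
  qed
  then show ?thesis using assms by (simp add: resolution_map_def resolution_degrees_def Suc)
qed

lemma resolution_exact:
  "{f \<in> free_elems {0..n} (resolution_degrees \<sigma> (Suc i)).
      resolution_map n \<sigma> i *\<^sub>v f = 0\<^sub>v (length (resolution_degrees \<sigma> i))}
    = (\<lambda>f. (resolution_map n \<sigma> (Suc i) :: 'k::comm_ring_1 mpoly mat) *\<^sub>v f) `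
        free_elems {0..n} (resolution_degrees \<sigma> (Suc (Suc i)))"
proof -
  \<comment> \<open>For \<open>i = 0\<close> the first condition is empty, as there are no cells of
    size 1; for larger \<open>i\<close> the second one is. Both kinds of kernel thus get the form
    that \<open>cell_map_exact\<close> takes.\<close>
  have zero_iff: "resolution_map n \<sigma> i *\<^sub>v cell_vec \<sigma> (Suc (Suc i)) F = 0\<^sub>v (length (resolution_degrees \<sigma> i)) \<longleftrightarrow>
      (\<forall>c. cell \<sigma> c \<longrightarrow> card c = Suc i \<longrightarrow> cell_map n \<sigma> F c = 0) \<and> (i = 0 \<longrightarrow> cell_augmentation \<sigma> F = 0)"
    for F :: "_ \<Rightarrow> 'k mpoly"
  proof (cases i)
    case 0
    have "vec 1 (\<lambda>_. cell_augmentation \<sigma> F) = 0\<^sub>v 1 \<longleftrightarrow> cell_augmentation \<sigma> F = 0"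
      by (auto simp: vec_eq_iff)
    then show ?thesis using card_cell_ge by (fastforce simp: 0 resolution_map_0_mult resolution_degrees_def)
  next
    case (Suc j)
    then show ?thesis
      by (simp add: resolution_map_Suc_mult resolution_degrees_def cell_vec_zero cell_vec_eq_iff)
  qed
  show ?thesis
  proof (intro equalityI subsetI)
    fix f :: "'k mpoly vec"
    assume "f \<in> {f \<in> free_elems {0..n} (resolution_degrees \<sigma> (Suc i)).
      resolution_map n \<sigma> i *\<^sub>v f = 0\<^sub>v (length (resolution_degrees \<sigma> i))}"
    then obtain F where f: "f = cell_vec \<sigma> (Suc (Suc i)) F" and F: "\<And>c. F c \<in> polys {0..n}"
      and cyc: "\<And>c. cell \<sigma> c \<Longrightarrow> card c = Suc i \<Longrightarrow> cell_map n \<sigma> F c = 0"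
      and aug: "Suc i = 1 \<Longrightarrow> cell_augmentation \<sigma> F = 0"
      unfolding free_elems_resolution_degrees using zero_iff by auto
    obtain G where G: "\<And>c. cell \<sigma> c \<Longrightarrow> card c = Suc (Suc i) \<Longrightarrow> cell_map n \<sigma> G c = F c" "\<And>c. G c \<in> polys {0..n}"
      by (rule cell_map_exact[OF \<sigma>, of "Suc i" F]) (use F cyc aug in auto)
    have "f = resolution_map n \<sigma> (Suc i) *\<^sub>v cell_vec \<sigma> (Suc (Suc (Suc i))) G"
      unfolding f resolution_map_Suc_mult cell_vec_eq_iff using G(1) by auto
    then show "f \<in> (\<lambda>f. resolution_map n \<sigma> (Suc i) *\<^sub>v f) ` free_elems {0..n} (resolution_degrees \<sigma> (Suc (Suc i)))"
      unfolding free_elems_resolution_degrees using G(2) by blast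
  next
    fix f :: "'k mpoly vec"
    assume "f \<in> (\<lambda>f. resolution_map n \<sigma> (Suc i) *\<^sub>v f) ` free_elems {0..n} (resolution_degrees \<sigma> (Suc (Suc i)))"
    then obtain y where y: "y \<in> free_elems {0..n} (resolution_degrees \<sigma> (Suc (Suc i)))"
      "f = resolution_map n \<sigma> (Suc i) *\<^sub>v y" by blast
    then obtain G where G: "y = cell_vec \<sigma> (Suc (Suc (Suc i))) G"
      unfolding free_elems_resolution_degrees by blast
    have "resolution_map n \<sigma> i *\<^sub>v f = 0\<^sub>v (length (resolution_degrees \<sigma> i))"
      unfolding y(2) G resolution_map_Suc_mult zero_iff
      by (simp add: cell_map_cell_map[OF \<sigma>] cell_augmentation_cell_map[OF \<sigma>])
    moreover have "f \<in> free_elems {0..n} (resolution_degrees \<sigma> (Suc i))"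
      unfolding y(2) by (rule graded_mats_mult_vec[OF resolution_map_graded y(1)])
    ultimately show "f \<in> {f \<in> free_elems {0..n} (resolution_degrees \<sigma> (Suc i)).
        resolution_map n \<sigma> i *\<^sub>v f = 0\<^sub>v (length (resolution_degrees \<sigma> i))}" by simp
  qed
qed

text \<open>The ring maps onto the quotient with kernel \<open>I\<close>, and \<open>I\<close> is
  the image of the augmentation of the cell complex, which therefore becomes the first
  differential.\<close>

lemma minimal_resolution_threshold_graph:
  defines "R \<equiv> poly_ring {0..n} :: 'k::comm_ring_1 mpoly ring"
    and "I \<equiv> nonedge_ideal (threshold_graph n \<sigma>) :: 'k mpoly set"
  shows "ideal I R"
    "minimal_graded_free_resolution {0..n} (quotient_module R I) (quotient_component {0..n} I)
      (resolution_degrees \<sigma>) [I +>\<^bsub>R\<^esub> 1] (resolution_map n \<sigma>)"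
proof -
  show id: "ideal I R"
    unfolding I_def R_def nonedge_ideal_def verts_threshold_graph
    by (rule ring.genideal_ideal[OF ring_poly_ring]) (auto intro!: polys_mult polys_var)
  interpret ideal I R by (rule id)
  let ?M = "quotient_module R I"
  have aug: "augmentation ?M [I +>\<^bsub>R\<^esub> 1] f = I +>\<^bsub>R\<^esub> (f $ 0)" if "f \<in> free_elems {0..n} [0]" for f
    using augmentation_quotient[OF id[unfolded R_def], of "[1]" f] that
    by (simp add: R_def in_free_elems_iff)
  have zero: "\<zero>\<^bsub>?M\<^esub> = I +>\<^bsub>R\<^esub> 0"
    using a_coset_add_zero[OF a_subset] by (simp add: quotient_module_simps R_def)
  have surj: "augmentation ?M [I +>\<^bsub>R\<^esub> 1] ` free_elems {0..n} [0] = carrier ?M"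
  proof -
    have "p \<in> carrier R \<Longrightarrow> \<exists>f\<in>free_elems {0..n} [0]. f $ 0 = p" for p
      by (rule bexI[of _ "vec 1 (\<lambda>_. p)"]) (auto simp: in_free_elems_iff R_def)
    then have "(\<lambda>f. f $ 0) ` free_elems {0..n} [0] = carrier R"
      by (force simp: in_free_elems_iff R_def)
    then have "(\<lambda>f. I +>\<^bsub>R\<^esub> (f $ 0)) ` free_elems {0..n} [0] = (\<lambda>p. I +>\<^bsub>R\<^esub> p) ` carrier R"
      by (metis image_image)
    moreover have "carrier ?M = (\<lambda>p. I +>\<^bsub>R\<^esub> p) ` carrier R"
      by (auto simp: quotient_module_simps A_RCOSETS_def')
    ultimately show ?thesis using aug by (metis (no_types, lifting) image_cong)
  qed
  have ker: "{f \<in> free_elems {0..n} [0]. augmentation ?M [I +>\<^bsub>R\<^esub> 1] f = \<zero>\<^bsub>?M\<^esub>}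
      = (\<lambda>f. resolution_map n \<sigma> 0 *\<^sub>v f) ` free_elems {0..n} (resolution_degrees \<sigma> 1)"
  proof (intro equalityI subsetI)
    fix f assume "f \<in> {f \<in> free_elems {0..n} [0]. augmentation ?M [I +>\<^bsub>R\<^esub> 1] f = \<zero>\<^bsub>?M\<^esub>}"
    then have f: "f \<in> free_elems {0..n} [0]" and "f $ 0 \<in> I"
      using aug zero coset_eq_iff[OF id[unfolded R_def], of "f $ 0" 0] by (auto simp: R_def)
    then obtain F where F: "cell_augmentation \<sigma> F = f $ 0" "\<And>c. F c \<in> polys {0..n}"
      unfolding I_def nonedge_ideal_threshold_graph_cells[OF \<sigma>]
      using cell_augmentation_surj[OF \<sigma>, of "f $ 0"] by auto
    have "f = resolution_map n \<sigma> 0 *\<^sub>v cell_vec \<sigma> (Suc (Suc 0)) F"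
      unfolding resolution_map_0_mult F(1) using f by (intro eq_vecI) (auto simp: in_free_elems_iff)
    then show "f \<in> (\<lambda>f. resolution_map n \<sigma> 0 *\<^sub>v f) ` free_elems {0..n} (resolution_degrees \<sigma> 1)"
      unfolding One_nat_def free_elems_resolution_degrees using F(2) by blast
  next
    fix f assume "f \<in> (\<lambda>f. (resolution_map n \<sigma> 0 :: 'k mpoly mat) *\<^sub>v f) ` free_elems {0..n} (resolution_degrees \<sigma> 1)"
    then obtain y where y: "y \<in> free_elems {0..n} (resolution_degrees \<sigma> 1)" "f = resolution_map n \<sigma> 0 *\<^sub>v y"
      by blast
    then obtain F where F: "y = cell_vec \<sigma> (Suc (Suc 0)) F"
      unfolding One_nat_def free_elems_resolution_degrees by blast
    have f: "f \<in> free_elems {0..n} [0]"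
      using graded_mats_mult_vec[OF resolution_map_graded[of 0], of y] y by (simp add: resolution_degrees_def)
    have f0: "f $ 0 = cell_augmentation \<sigma> F" unfolding y(2) F resolution_map_0_mult by simp
    have "\<exists>c. cell_in \<sigma> (Poly_Mapping.keys m) c \<and> card c = 2" if "m \<in> Poly_Mapping.keys (f $ 0)" for m
    proof -
      \<comment> \<open>A nonzero coefficient rules out an empty sum, so some generator divides the
        monomial \<open>m\<close>.\<close>
      have "(\<Sum>c | cell_in \<sigma> (Poly_Mapping.keys m) c \<and> card c = 2. strand m F c) \<noteq> 0"
        using that unfolding f0 in_keys_iff lookup_cell_augmentation[OF \<sigma>] .
      then show ?thesis by (metis (mono_tags, lifting) mem_Collect_eq sum.neutral)
    qed
    then have "f $ 0 \<in> I"
      unfolding I_def nonedge_ideal_threshold_graph_cells[OF \<sigma>] using f by (simp add: in_free_elems_iff)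
    then have "augmentation ?M [I +>\<^bsub>R\<^esub> 1] f = \<zero>\<^bsub>?M\<^esub>"
      using aug[OF f] zero coset_eq_iff[OF id[unfolded R_def], of "f $ 0" 0] by (simp add: R_def)
    then show "f \<in> {f \<in> free_elems {0..n} [0]. augmentation ?M [I +>\<^bsub>R\<^esub> 1] f = \<zero>\<^bsub>?M\<^esub>}"
      using f by simp
  qed
  have d0: "resolution_degrees \<sigma> 0 = [0]" by (simp add: resolution_degrees_def)
  have "I +>\<^bsub>R\<^esub> 1 \<in> quotient_component {0..n} I 0"
    unfolding quotient_component_def R_def by (auto simp: homogeneous_def intro!: exI[of _ 1])
  then show "minimal_graded_free_resolution {0..n} ?M (quotient_component {0..n} I)
      (resolution_degrees \<sigma>) [I +>\<^bsub>R\<^esub> 1] (resolution_map n \<sigma>)"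
    unfolding minimal_graded_free_resolution_def d0
    using surj ker resolution_map_graded resolution_exact resolution_map_minimal
    by (intro conjI allI impI) (simp_all add: d0)
qed

text \<open>Position \<open>i\<close> is concentrated in degree \<open>Suc i\<close>, so counting
  that degree counts all its basis elements.\<close>

lemma betti_seq_threshold_graph:
  assumes "1 \<le> i"
  shows "betti_seq TYPE('k::field) (threshold_graph n \<sigma>) i = card {c. cell \<sigma> c \<and> card c = Suc i}"
proof -
  have "poly_filter (\<lambda>m. mono_deg m = d) p \<in> nonedge_ideal (threshold_graph n \<sigma>)"
    if "p \<in> nonedge_ideal (threshold_graph n \<sigma>)" for p :: "'k mpoly" and d
    using that unfolding nonedge_ideal_threshold_graph[OF \<sigma>] by (auto simp: keys_poly_filter)
  from graded_betti_quotient_eqI[OF minimal_resolution_threshold_graph(1) this minimal_resolution_threshold_graph(2)]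
  have "betti_seq TYPE('k) (threshold_graph n \<sigma>) i = count_list (resolution_degrees \<sigma> i) (Suc i)"
    by (simp add: betti_seq_def Let_def)
  also have "\<dots> = length (cell_list \<sigma> (Suc i))"
    using assms by (simp add: resolution_degrees_def count_list_eq_length_filter filter_replicate)
  also have "\<dots> = card {c. cell \<sigma> c \<and> card c = Suc i}"
    using cell_list distinct_card by metis
  finally show ?thesis .
qed

end

subsection \<open>Counting cells\<close>

definition nonedges :: "nat set \<Rightarrow> (nat \<times> nat) set" where
  "nonedges \<sigma> = {(u, v). u < v \<and> v \<in> \<sigma>}"

lemma finite_nonedges: "\<sigma> \<subseteq> {1..n} \<Longrightarrow> finite (nonedges \<sigma>)"
  by (rule finite_subset[of _ "{..n} \<times> {..n}"]) (auto simp: nonedges_def)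

text \<open>A cell is determined by the largest element of its first factor, the smallest element of its
  second factor and the set of the remaining elements.\<close>

lemma card_cells:
  assumes \<sigma>: "\<sigma> \<subseteq> {1..n}"
  shows "card {c. cell \<sigma> c \<and> card c = Suc (Suc j)} = (\<Sum>(u, v)\<in>nonedges \<sigma>. (u + isolated_above \<sigma> v) choose j)"
proof -
  \<comment> \<open>The elements that can join the pair \<open>e\<close> without changing the
    maximum of the first factor or the minimum of the second. The tags keep the two parts disjoint,
    so their sizes add.\<close>
  define X where "X e = {False} \<times> {..<fst e} \<union> {True} \<times> {w \<in> \<sigma>. snd e < w}" for e :: "nat \<times> nat"
  define P where "P e = {S. S \<subseteq> X e \<and> card S = j}" for e
  define \<Phi> :: "(nat \<times> nat) \<times> (bool \<times> nat) set \<Rightarrow> (bool \<times> nat) set" where "\<Phi> = (\<lambda>(e, S). insert (False, fst e) (insert (True, snd e) S))"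
  have fin\<sigma>: "finite \<sigma>" using \<sigma> finite_subset by blast
  have finX: "finite (X e)" for e using fin\<sigma> by (simp add: X_def)
  have cardX: "card (X e) = fst e + isolated_above \<sigma> (snd e)" for e
    unfolding X_def isolated_above_def using fin\<sigma>
    by (subst card_Un_disjoint) (auto simp: card_cartesian_product)
  have nin: "(False, fst e) \<notin> X e" "(True, snd e) \<notin> X e" for e by (auto simp: X_def)
  have "bij_betw \<Phi> (Sigma (nonedges \<sigma>) P) {c. cell \<sigma> c \<and> card c = Suc (Suc j)}"
    unfolding bij_betw_def
  proof
    show "inj_on \<Phi> (Sigma (nonedges \<sigma>) P)"
    proof (rule inj_onI)
      fix x y assume xy: "x \<in> Sigma (nonedges \<sigma>) P" "y \<in> Sigma (nonedges \<sigma>) P" "\<Phi> x = \<Phi> y"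
      obtain u v S u' v' S' where x: "x = ((u, v), S)" and y: "y = ((u', v'), S')" by (metis surj_pair)
      have S: "S \<subseteq> X (u, v)" "S' \<subseteq> X (u', v')" using xy by (auto simp: x y P_def)
      have eq: "insert (False, u) (insert (True, v) S) = insert (False, u') (insert (True, v') S')"
        using xy(3) by (simp add: x y \<Phi>_def)
      \<comment> \<open>Both \<open>u\<close> and \<open>u'\<close> are the greatest element of the
        same first factor, so each bounds the other. Dually, \<open>v\<close> and \<open>v'\<close>
        are both the least element of the second factor.\<close>
      have "(False, u) \<in> insert (False, u') (insert (True, v') S')" unfolding eq[symmetric] by simp
      moreover have "(False, u') \<in> insert (False, u) (insert (True, v) S)" unfolding eq by simp
      ultimately have u: "u = u'" using S by (fastforce simp: X_def)
      have "(True, v) \<in> insert (False, u') (insert (True, v') S')" unfolding eq[symmetric] by simp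
      moreover have "(True, v') \<in> insert (False, u) (insert (True, v) S)" unfolding eq by simp
      ultimately have v: "v = v'" using S by (fastforce simp: X_def)
      have "(False, u) \<notin> S" "(True, v) \<notin> S" "(False, u) \<notin> S'" "(True, v) \<notin> S'"
        using S nin[of "(u, v)"] u v by auto
      moreover have "S = insert (False, u) (insert (True, v) S) - {(False, u), (True, v)}"
        "S' = insert (False, u) (insert (True, v) S') - {(False, u), (True, v)}"
        using calculation by auto
      ultimately have "S = S'" using eq unfolding u[symmetric] v[symmetric] by argo
      then show "x = y" by (simp add: x y u v)
    qed
    show "\<Phi> ` Sigma (nonedges \<sigma>) P = {c. cell \<sigma> c \<and> card c = Suc (Suc j)}"
    proof (intro equalityI subsetI)
      fix c assume "c \<in> \<Phi> ` Sigma (nonedges \<sigma>) P"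
      then obtain u v S where c: "c = insert (False, u) (insert (True, v) S)" and uv: "u < v" "v \<in> \<sigma>"
        and S: "S \<subseteq> X (u, v)" "card S = j"
        by (auto simp: \<Phi>_def nonedges_def P_def)
      have finS: "finite S" using S(1) finX finite_subset by blast
      have "x \<le> u" if "(False, x) \<in> c" for x
        using that S(1) unfolding c X_def by auto
      moreover have "v \<le> x" "x \<in> \<sigma>" if "(True, x) \<in> c" for x
        using that S(1) uv(2) unfolding c X_def by auto
      ultimately have "cell \<sigma> c"
        using uv finS by (intro cellI[of c u v]) (force simp: c)+
      moreover have "card c = Suc (Suc j)"
        using finS S nin[of "(u, v)"] unfolding c by (subst card_insert_disjoint | auto)+
      ultimately show "c \<in> {c. cell \<sigma> c \<and> card c = Suc (Suc j)}" by simp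
    next
      fix c assume "c \<in> {c. cell \<sigma> c \<and> card c = Suc (Suc j)}"
      then have c: "cell \<sigma> c" "card c = Suc (Suc j)" by auto
      let ?A = "{x. (False, x) \<in> c}" and ?B = "{x. (True, x) \<in> c}"
      have "?A \<subseteq> snd ` c" "?B \<subseteq> snd ` c" by force+
      then have fin: "finite ?A" "finite ?B" using cellD(1)[OF c(1)] finite_subset by blast+
      define u where "u = Max ?A"
      define v where "v = Min ?B"
      have u: "(False, u) \<in> c" "\<And>x. (False, x) \<in> c \<Longrightarrow> x \<le> u"
        using Max_in[OF fin(1)] cellD(2)[OF c(1)] Max_ge[OF fin(1)] by (auto simp: u_def)
      have v: "(True, v) \<in> c" "\<And>x. (True, x) \<in> c \<Longrightarrow> v \<le> x"
        using Min_in[OF fin(2)] cellD(3)[OF c(1)] Min_le[OF fin(2)] by (auto simp: v_def)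
      define S where "S = c - {(False, u), (True, v)}"
      have "c = \<Phi> ((u, v), S)" using u(1) v(1) by (auto simp: \<Phi>_def S_def)
      moreover have "(u, v) \<in> nonedges \<sigma>"
        using cellD(4)[OF c(1) u(1) v(1)] cellD(5)[OF c(1) v(1)] by (simp add: nonedges_def)
      moreover have "S \<in> P (u, v)"
      proof -
        have "x \<in> X (u, v)" if "x \<in> S" for x
        proof (cases x)
          case (Pair b w)
          then show ?thesis
            using that u(2)[of w] v(2)[of w] cellD(5)[OF c(1), of w] by (cases b) (auto simp: S_def X_def le_less)
        qed
        moreover have "card S = j"
          using c(2) u(1) v(1) cellD(1)[OF c(1)] by (simp add: S_def card_Diff_subset)
        ultimately show ?thesis by (auto simp: P_def)
      qed
      ultimately show "c \<in> \<Phi> ` Sigma (nonedges \<sigma>) P" by (intro image_eqI[of _ _ "((u, v), S)"]) auto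
    qed
  qed
  then have "card {c. cell \<sigma> c \<and> card c = Suc (Suc j)} = card (Sigma (nonedges \<sigma>) P)"
    by (metis bij_betw_same_card)
  also have "\<dots> = (\<Sum>e\<in>nonedges \<sigma>. card (P e))"
  proof (rule card_SigmaI[OF finite_nonedges[OF \<sigma>]])
    show "\<forall>e\<in>nonedges \<sigma>. finite (P e)"
      using finX by (auto simp: P_def intro: finite_subset[of _ "Pow (X _)"])
  qed
  also have "\<dots> = (\<Sum>(u, v)\<in>nonedges \<sigma>. (u + isolated_above \<sigma> v) choose j)"
    unfolding P_def n_subsets[OF finX] cardX by (simp add: split_def)
  finally show ?thesis .
qed

text \<open>A two-element set determines its increasing pair, so passing from pairs to edges
  identifies nothing.\<close>

lemma card_lambda_edges:
  assumes \<sigma>: "\<sigma> \<subseteq> {1..n}"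
  shows "card (lambda_edges n \<sigma> k) = card {(u, v) \<in> nonedges \<sigma>. lambda_label \<sigma> u v = k}"
proof -
  have iff: "{u, v} \<in> edges (complement_graph (threshold_graph n \<sigma>)) \<longleftrightarrow> v \<in> \<sigma>" if "u < v" for u v
  proof -
    have "{u, v} \<in> edges (complement_graph (threshold_graph n \<sigma>)) \<longleftrightarrow>
        u \<le> n \<and> v \<le> n \<and> {u, v} \<notin> edges (threshold_graph n \<sigma>)"
      using that by (auto simp: complement_graph_def doubleton_eq_iff insert_commute)
    then show ?thesis using edge_threshold_graph_iff[OF that] \<sigma> that by fastforce
  qed
  have "lambda_edges n \<sigma> k = (\<lambda>(u, v). {u, v}) ` {(u, v) \<in> nonedges \<sigma>. lambda_label \<sigma> u v = k}"
    using iff by (fastforce simp: lambda_edges_def nonedges_def)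
  moreover have "inj_on (\<lambda>(u, v). {u, v}) {(u, v) \<in> nonedges \<sigma>. lambda_label \<sigma> u v = k}"
    by (auto simp: inj_on_def nonedges_def doubleton_eq_iff)
  ultimately show ?thesis by (simp add: card_image)
qed

text \<open>At most \<open>n - v\<close> isolated vertices lie above \<open>v\<close>, and
  \<open>u + 1 \<le> v\<close>. Lowered by 1, the bound is the hypothesis of
  \<open>binomial_inversion\<close>.\<close>

lemma lambda_label_le:
  assumes "\<sigma> \<subseteq> {1..n}" "(u, v) \<in> nonedges \<sigma>"
  shows "lambda_label \<sigma> u v \<le> n"
proof -
  have "isolated_above \<sigma> v \<le> card {v<..n}"
    unfolding isolated_above_def using assms(1) by (intro card_mono) auto
  moreover have "u < v" "v \<le> n" using assms by (auto simp: nonedges_def)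
  ultimately show ?thesis by (simp add: lambda_label_def)
qed

text \<open>By \<open>(L choose j) * (j choose K) = (L choose K) * ((L - K) choose (j - K))\<close>
  an alternating row sum of binomial coefficients remains, which is zero unless
  \<open>L = K\<close>. Terms with \<open>j > L\<close> vanish, so \<open>N\<close> may exceed
  \<open>L\<close>.\<close>

lemma binomial_inversion:
  assumes "L \<le> N"
  shows "(\<Sum>j=K..N. (- 1) ^ (j + K) * int (j choose K) * int (L choose j)) = (if L = K then 1 else 0)"
proof (cases "K \<le> L")
  case True
  have "(\<Sum>j=K..N. (- 1) ^ (j + K) * int (j choose K) * int (L choose j))
      = (\<Sum>j=K..L. (- 1) ^ (j + K) * int (j choose K) * int (L choose j))"
    using assms by (intro sum.mono_neutral_right) (auto simp: binomial_eq_0)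
  also have "\<dots> = (\<Sum>t\<le>L - K. (- 1) ^ (t + K + K) * int ((t + K) choose K) * int (L choose (t + K)))"
    using True by (intro sum.reindex_bij_witness[of _ "\<lambda>t. t + K" "\<lambda>j. j - K"]) auto
  also have "\<dots> = (\<Sum>t\<le>L - K. int (L choose K) * ((- 1) ^ t * int ((L - K) choose t)))"
  proof (rule sum.cong[OF refl])
    fix t assume "t \<in> {..L - K}"
    then have "(L choose (t + K)) * ((t + K) choose K) = (L choose K) * ((L - K) choose t)"
      using True choose_mult[of K "t + K" L] by simp
    then have "int (L choose (t + K)) * int ((t + K) choose K) = int (L choose K) * int ((L - K) choose t)"
      by (metis of_nat_mult)
    then show "(- 1) ^ (t + K + K) * int ((t + K) choose K) * int (L choose (t + K))
        = int (L choose K) * ((- 1) ^ t * int ((L - K) choose t))"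
      by (simp add: power_add mult.assoc mult.left_commute mult.commute)
  qed
  also have "\<dots> = int (L choose K) * (\<Sum>t\<le>L - K. (- 1) ^ t * int ((L - K) choose t))"
    by (simp add: sum_distrib_left)
  also have "\<dots> = (if L = K then 1 else 0)"
    using True choose_alternating_sum[of "L - K", where 'a = int] by (cases "L = K") auto
  finally show ?thesis .
next
  case False
  then show ?thesis by (intro trans[OF sum.neutral]) (auto simp: binomial_eq_0)
qed

theorem theorem3p8:
  fixes n k :: nat and \<sigma> :: "nat set"
  assumes "n \<ge> 1" and "\<sigma> \<subseteq> {1..n}" and "1 \<le> k" and "k \<le> n"
  shows "anti_lecture_hall TYPE('k::field) n (threshold_graph n \<sigma>) k = int (card (lambda_edges n \<sigma> k))"
proof -
  note \<sigma> = assms(2)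
  \<comment> \<open>The binomials in \<open>anti_lecture_hall\<close> involve \<open>k - 1\<close>
    and \<open>i - 1\<close>, and a non-edge with label \<open>l\<close> leaves \<open>l - 1\<close>
    elements to choose from. The predecessors \<open>K\<close>, \<open>N\<close> and
    \<open>L e\<close> absorb both shifts.\<close>
  define K where "K = k - 1"
  define N where "N = n - 1"
  have kn: "k = Suc K" "n = Suc N" using assms by (simp_all add: K_def N_def)
  define L where "L e = lambda_label \<sigma> (fst e) (snd e) - 1" for e
  have label: "lambda_label \<sigma> u v = Suc (L (u, v))" for u v by (simp add: L_def lambda_label_def)
  have "anti_lecture_hall TYPE('k) n (threshold_graph n \<sigma>) k
      = (\<Sum>i=Suc K..Suc N. (- 1) ^ (i + k) * int ((i - 1) choose K) * int (card {c. cell \<sigma> c \<and> card c = Suc i}))"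
    unfolding anti_lecture_hall_def kn by (intro sum.cong) (simp_all add: betti_seq_threshold_graph[OF \<sigma>[unfolded kn(2)]] add.commute)
  also have "\<dots> = (\<Sum>j=K..N. (- 1) ^ (j + K) * int (j choose K) * int (card {c. cell \<sigma> c \<and> card c = Suc (Suc j)}))"
    unfolding sum.shift_bounds_cl_Suc_ivl by (simp add: kn)
  also have "\<dots> = (\<Sum>j=K..N. \<Sum>e\<in>nonedges \<sigma>. (- 1) ^ (j + K) * int (j choose K) * int (L e choose j))"
    unfolding card_cells[OF \<sigma>] by (simp add: sum_distrib_left split_def L_def lambda_label_def)
  also have "\<dots> = (\<Sum>e\<in>nonedges \<sigma>. \<Sum>j=K..N. (- 1) ^ (j + K) * int (j choose K) * int (L e choose j))"
    by (rule sum.swap)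
  also have "\<dots> = (\<Sum>e\<in>nonedges \<sigma>. if L e = K then 1 else 0)"
    using lambda_label_le[OF \<sigma>] kn(2) by (intro sum.cong binomial_inversion) (auto simp: label)
  also have "\<dots> = int (card {e \<in> nonedges \<sigma>. L e = K})"
    using finite_nonedges[OF \<sigma>] by (simp add: sum.If_cases Int_def)
  also have "{e \<in> nonedges \<sigma>. L e = K} = {(u, v) \<in> nonedges \<sigma>. lambda_label \<sigma> u v = k}"
    by (auto simp: label kn)
  finally show ?thesis by (simp add: card_lambda_edges[OF \<sigma>])
qed

end
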